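(* For all nonzero parameters $q_1,\dots,q_l$ and $\tilde q_b$ ($b\in B$), $$I(q,\tilde q)=\sum_{m_1,\dots,m_l\ge0,\;(m_b)_{b\in B}\ge0} A_{m_1,\dots,m_l,\dots,m_b,\dots}\;q_1^{m_1}\cdots q_l^{m_l}\prod_{b\in B}\tilde q_b^{\,m_b},$$ where $$A_{m_1,\dots,m_l,\dots,m_b,\dots}=\frac{1}{(m_1!)^{k_1+k_2}}\,\frac{1}{(m_2!)^{k_2+k_3}}\cdots\frac{1}{(m_l!)^{k_l+k_{l+1}}}\;B_{m_1,\dots,m_l,\dots,m_b,\dots},$$ $$B_{m_1,\dots,m_l,\dots,m_b,\dots}=\prod_{w\in W}\binom{m_{h(w)}}{m_{t(w)}},$$ with the conventions $m_0=0$ and $\binom{a}{c}=0$ for $c>a\geq 0$.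
   Context: Let $l\ge 1$ and let $k_1,\dots,k_{l+1}$ be positive integers; put $n_0=0$, $n_i=k_1+\dots+k_i$ and $n=n_{l+1}$. Ladder diagram. $\Lambda\subset\mathbb{R}^2$ is the union of the unit squares $[a-1,a]\times[c-1,c]$ ($a,c\ge1$ integers) such that $1\le c\le n-n_i$, where $i$ is the index with $n_{i-1}<a\le n_i$. The edges of $\Lambda$ are the sides of its unit squares. Graph $\Gamma$. $D$ is the set of centers of the unit squares of $\Lambda$. $S=\{s_1,\dots,s_{l+1}\}$ with $s_i=(n_{i-1}+\tfrac12,\,n-n_i+\tfrac12)$. $E$ is the set of horizontal and vertical unit segments joining two elements of $D\cup S$ at distance $1$; horizontal edges are oriented to the right and vertical edges downwards. $\Gamma$ is the oriented graph with vertex set $D\cup S$ and edge set $E$; $h(e)$, $t(e)$ are the head and tail of $e\in E$. $L(D),L(S),L(E)$ are the free abelian groups on $D,S,E$, and $\delta:L(E)\to L(D)$ is the composition of $\partial:L(E)\to L(D)\oplus L(S)$, $\partial(e)=h(e)-t(e)$, with the projection to $L(D)$. Boxes, corners, roofs. A box is a set $b\subset E$ of four edges forming a $4$-cycle (unit square) in $\Gamma$; $B$ is the set of boxes. The corner $\mathcal{C}_b$ is the pair of edges of $b$ meeting at its lower left vertex; the opposite corner $\mathcal{C}_b^-$ is the pair meeting at its upper right vertex. The $i$-th roof $\mathcal{R}_i$ ($1\le i\le l$) is the set of $k_i+k_{i+1}$ edges of the path from $s_i$ to $s_{i+1}$: one step down, $k_i-1$ steps right, $k_{i+1}-1$ steps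 down, one step right. The set $W$. $W$ is the set of edges of the diagram $\Lambda$ that intersect $\Gamma$ (each crosses exactly one edge of $\Gamma$). Vertical edges in $W$ are oriented upwards and horizontal ones to the right. For $w\in W$: if the starting point of $w$ is the center of a box $b_1\in B$ put $t(w)=b_1$, otherwise (the tail lies outside $\Gamma$) put $t(w)=0$; if the end point of $w$ is the center of a box $b_2\in B$ put $h(w)=b_2$, otherwise $w$ crosses a unique roof $\mathcal{R}_i$ and $h(w)=i$. The variety and the form. Let $y_e$ ($e\in E$) be coordinates on the complex affine space $\mathbb{A}^{|E|}$. For nonzero complex parameters $q_1,\dots,q_l$ and $\tilde q_b$ ($b\in B$) set $\mathcal{F}_i=\prod_{e\in\mathcal{R}_i}y_e-q_i$ and $\mathcal{G}_b=y_ey_f-\tilde q_b\,y_gy_h$, where $\{e,f\}=\mathcal{C}_b$ and $\{g,h\}=\mathcal{C}_b^-$. Let $M_{q,\tilde q}\subset\mathbb{A}^{|E|}$ be the subvariety $\mathcal{F}_i=0$ ($1\le i\le l$), $\mathcal{G}_b=0$ ($b\in B$), which is isomorphic to $(\mathbb{C}^* )^{|D|}$. Let $$\omega_{q,\tilde q}=\operatorname{Res}_{M_{q,\tilde q}}\left(\frac{\bigwedge_{e\in E}dy_e}{\prod_{i=1}^l\mathcal{F}_i\prod_{b\in B}\mathcal{G}_b}\right)$$ be the (Poincaré–Leray) residue, a holomorphic volume form on $M_{q,\tilde q}$, and $\mathcal{F}=\sum_{e\in E}y_e$. The cycle. Let $\widehat\Sigma$ be the fan in $L(D)\otimes\mathbb{R}$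 whose maximal cones are the cones generated by $\{\delta(e):e\in G\}$, where $G\subset E$ is obtained by omitting exactly one edge from each roof and exactly one edge from each corner. For a maximal cone $\sigma\in\widehat\Sigma$ let $\gamma=\gamma_{q,\tilde q}(\sigma)\subset M_{q,\tilde q}$ be the real $|D|$-dimensional torus $\{|y_e|=1 \text{ for all } e\in E\text{ with }\delta(e)\in\sigma\}$ (the remaining coordinates are determined by the defining equations of $M_{q,\tilde q}$). Then $$I(q,\tilde q)=\frac{1}{(2\pi i)^{|D|}}\int_{\gamma}e^{\mathcal{F}}\,\omega_{q,\tilde q},$$ where $i=\sqrt{-1}$ in the prefactor and $\gamma$ is oriented so that $\frac{1}{(2\pi i)^{|D|}}\int_\gamma\omega_{q,\tilde q}=1$. *)

theory Defs
  imports "HOL-Analysis.Analysis"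
begin

section \<open>Ladder diagram and graph\<close>

text \<open>
  The positive integers \<open>k\<^sub>1, \<dots>, k\<^sub>l\<^sub>+\<^sub>1\<close> are given by \<open>k :: nat \<Rightarrow> nat\<close>, of which only the values
  at \<open>1, \<dots>, l + 1\<close> matter.  Pairs of integers are used in two ways.

  \<^item> As a vertex of the graph, \<open>(a, c)\<close> is the unit square \<open>[a-1, a] \<times> [c-1, c]\<close>, or rather its
    center \<open>(a - 1/2, c - 1/2)\<close>.
  \<^item> As a lattice point, \<open>(a, c)\<close> is that point of the plane itself.  Lattice points are the end
    points of edges of the ladder diagram and the centers of boxes.
\<close>

type_synonym pt = "int \<times> int"
type_synonym edge = "pt \<times> pt"  \<comment> \<open>(tail, head)\<close>

definition nsum :: "(nat \<Rightarrow> nat) \<Rightarrow> nat \<Rightarrow> int" where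
  "nsum k i = (\<Sum>j = 1..i. int (k j))"

text \<open>The unit squares of the ladder diagram; as graph vertices they form the set \<open>D\<close>.\<close>

definition squares :: "(nat \<Rightarrow> nat) \<Rightarrow> nat \<Rightarrow> pt set" where
  "squares k l = {(a, c). 1 \<le> a \<and> 1 \<le> c \<and>
     (\<exists>i\<in>{1..l+1}. nsum k (i - 1) < a \<and> a \<le> nsum k i \<and> c \<le> nsum k (l + 1) - nsum k i)}"

text \<open>The vertex \<open>s\<^sub>i = (n\<^sub>i\<^sub>-\<^sub>1 + 1/2, n - n\<^sub>i + 1/2)\<close>.\<close>

definition s_vertex :: "(nat \<Rightarrow> nat) \<Rightarrow> nat \<Rightarrow> nat \<Rightarrow> pt" where
  "s_vertex k l i = (nsum k (i - 1) + 1, nsum k (l + 1) - nsum k i + 1)"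

definition vertices :: "(nat \<Rightarrow> nat) \<Rightarrow> nat \<Rightarrow> pt set" where
  "vertices k l = squares k l \<union> s_vertex k l ` {1..l+1}"

definition right_edge :: "pt \<Rightarrow> edge" where
  "right_edge p = (p, (fst p + 1, snd p))"

definition down_edge :: "pt \<Rightarrow> edge" where
  "down_edge p = (p, (fst p, snd p - 1))"

definition edges :: "(nat \<Rightarrow> nat) \<Rightarrow> nat \<Rightarrow> edge set" where
  "edges k l = {e. fst e \<in> vertices k l \<and> snd e \<in> vertices k l \<and>
     (e = right_edge (fst e) \<or> e = down_edge (fst e))}"

text \<open>Elements of \<open>L(D) \<otimes> \<real>\<close> are functions on vertices that vanish outside \<open>D\<close>.\<close>

definition delta :: "(nat \<Rightarrow> nat) \<Rightarrow> nat \<Rightarrow> edge \<Rightarrow> pt \<Rightarrow> real" where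
  "delta k l e = (\<lambda>v. if v \<in> squares k l then of_bool (v = snd e) - of_bool (v = fst e) else 0)"


section \<open>Boxes, corners, roofs\<close>

text \<open>A box is represented by its center, a lattice point.  The lower left vertex of the box
  centered at \<open>(a, c)\<close> is the square \<open>(a, c)\<close>.\<close>

definition corner :: "pt \<Rightarrow> edge set" where
  "corner b = (case b of (a, c) \<Rightarrow> {right_edge (a, c), down_edge (a, c + 1)})"

definition opp_corner :: "pt \<Rightarrow> edge set" where
  "opp_corner b = (case b of (a, c) \<Rightarrow> {right_edge (a, c + 1), down_edge (a + 1, c + 1)})"

definition boxes :: "(nat \<Rightarrow> nat) \<Rightarrow> nat \<Rightarrow> pt set" where
  "boxes k l = {b. corner b \<union> opp_corner b \<subseteq> edges k l}"

text \<open>The path from \<open>s\<^sub>i\<close> to \<open>s\<^sub>i\<^sub>+\<^sub>1\<close>: one step down, \<open>k\<^sub>i - 1\<close> steps right, \<open>k\<^sub>i\<^sub>+\<^sub>1 - 1\<close> steps down,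
  one step right.\<close>

definition roof :: "(nat \<Rightarrow> nat) \<Rightarrow> nat \<Rightarrow> nat \<Rightarrow> edge set" where
  "roof k l i = (case s_vertex k l i of (x, y) \<Rightarrow>
     {down_edge (x, y)}
     \<union> {right_edge (x + int j, y - 1) | j. j < k i - 1}
     \<union> {down_edge (x + int (k i) - 1, y - 1 - int j) | j. j < k (i + 1) - 1}
     \<union> {right_edge (x + int (k i) - 1, y - int (k (i + 1)))})"


section \<open>The edges of the ladder diagram crossing the graph\<close>

text \<open>Edges of the ladder diagram are pairs (starting point, end point) of lattice points,
  oriented to the right and upwards.\<close>

definition sides :: "pt \<Rightarrow> (pt \<times> pt) set" where
  "sides v = (case v of (a, c) \<Rightarrow>
     {((a - 1, c - 1), (a, c - 1)), ((a - 1, c), (a, c)),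
      ((a - 1, c - 1), (a - 1, c)), ((a, c - 1), (a, c))})"

text \<open>The lattice segment through the midpoint of an edge \<open>e\<close> of the graph, perpendicular to \<open>e\<close>.\<close>

definition crossing :: "edge \<Rightarrow> pt \<times> pt" where
  "crossing e = (case fst e of (a, c) \<Rightarrow>
     if e = right_edge (a, c) then ((a, c - 1), (a, c)) else ((a - 1, c - 1), (a, c - 1)))"

definition W_set :: "(nat \<Rightarrow> nat) \<Rightarrow> nat \<Rightarrow> (pt \<times> pt) set" where
  "W_set k l = {w \<in> (\<Union>v\<in>squares k l. sides v). \<exists>e\<in>edges k l. crossing e = w}"

datatype index = Zero | Roof nat | Box pt

definition W_tail :: "(nat \<Rightarrow> nat) \<Rightarrow> nat \<Rightarrow> pt \<times> pt \<Rightarrow> index" where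
  "W_tail k l w = (if fst w \<in> boxes k l then Box (fst w) else Zero)"

definition W_head :: "(nat \<Rightarrow> nat) \<Rightarrow> nat \<Rightarrow> pt \<times> pt \<Rightarrow> index" where
  "W_head k l w = (if snd w \<in> boxes k l then Box (snd w)
     else Roof (THE i. i \<in> {1..l} \<and> (\<exists>e\<in>roof k l i. crossing e = w)))"


section \<open>The coefficients\<close>

text \<open>Multi-indices \<open>(m\<^sub>1, \<dots>, m\<^sub>l, (m\<^sub>b)\<^sub>b)\<close>, with \<open>m\<^sub>0 = 0\<close>.\<close>

definition multi_indices :: "(nat \<Rightarrow> nat) \<Rightarrow> nat \<Rightarrow> (index \<Rightarrow> nat) set" where
  "multi_indices k l = {m. \<forall>j. j \<notin> Roof ` {1..l} \<union> Box ` boxes k l \<longrightarrow> m j = 0}"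

definition B_coeff :: "(nat \<Rightarrow> nat) \<Rightarrow> nat \<Rightarrow> (index \<Rightarrow> nat) \<Rightarrow> nat" where
  "B_coeff k l m = (\<Prod>w\<in>W_set k l. m (W_head k l w) choose m (W_tail k l w))"

definition A_coeff :: "(nat \<Rightarrow> nat) \<Rightarrow> nat \<Rightarrow> (index \<Rightarrow> nat) \<Rightarrow> complex" where
  "A_coeff k l m =
     (\<Prod>i = 1..l. 1 / fact (m (Roof i)) ^ (k i + k (i + 1))) * of_nat (B_coeff k l m)"


section \<open>The Poincare--Leray residue\<close>

text \<open>Affine space with coordinates indexed by a finite set \<open>E\<close>; it serves as its own tangent
  space at every point.\<close>

definition affine_space :: "'e set \<Rightarrow> ('e \<Rightarrow> complex) set" where
  "affine_space E = {y. \<forall>e. e \<notin> E \<longrightarrow> y e = 0}"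

text \<open>A \<open>p\<close>-form is a function on lists of vectors; only its values on lists of length \<open>p\<close> matter.
  A differential form is a function from points to forms.\<close>

definition alternating_form ::
  "'e set \<Rightarrow> nat \<Rightarrow> (('e \<Rightarrow> complex) list \<Rightarrow> complex) \<Rightarrow> bool" where
  "alternating_form E p \<psi> \<longleftrightarrow>
     (\<forall>vs i u v c. length vs = p \<and> set vs \<subseteq> affine_space E \<and> i < p \<and>
        u \<in> affine_space E \<and> v \<in> affine_space E \<longrightarrow>
        \<psi> (vs[i := (\<lambda>e. c * u e + v e)]) = c * \<psi> (vs[i := u]) + \<psi> (vs[i := v])) \<and>
     (\<forall>vs i j. length vs = p \<and> set vs \<subseteq> affine_space E \<and> i < j \<and> j < p \<and> vs ! i = vs ! j \<longrightarrow>
        \<psi> vs = 0)"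

text \<open>The wedge product \<open>\<alpha>\<^sub>1 \<and> \<dots> \<and> \<alpha>\<^sub>p\<close> of 1-forms, evaluated as \<open>det (\<alpha>\<^sub>i (v\<^sub>j))\<close>.\<close>

definition wedge_list ::
  "(('e \<Rightarrow> complex) \<Rightarrow> complex) list \<Rightarrow> ('e \<Rightarrow> complex) list \<Rightarrow> complex" where
  "wedge_list \<alpha>s vs = (\<Sum>\<pi> | \<pi> permutes {..<length \<alpha>s}.
     of_int (sign \<pi>) * (\<Prod>i<length \<alpha>s. (\<alpha>s ! i) (vs ! \<pi> i)))"

text \<open>The wedge product of a \<open>p\<close>-form and an \<open>r\<close>-form, in the normalization that is compatible
  with the determinant formula above.\<close>

definition wedge ::
  "nat \<Rightarrow> nat \<Rightarrow> (('e \<Rightarrow> complex) list \<Rightarrow> complex) \<Rightarrow> (('e \<Rightarrow> complex) list \<Rightarrow> complex) \<Rightarrow>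
     ('e \<Rightarrow> complex) list \<Rightarrow> complex" where
  "wedge p r \<phi> \<psi> vs = (\<Sum>\<pi> | \<pi> permutes {..<p + r}. of_int (sign \<pi>) *
     \<phi> (map (\<lambda>i. vs ! \<pi> i) [0..<p]) * \<psi> (map (\<lambda>i. vs ! \<pi> i) [p..<p + r])) / (fact p * fact r)"

text \<open>The differential of \<open>f\<close> at \<open>y\<close>.\<close>

definition diff1 :: "(('e \<Rightarrow> complex) \<Rightarrow> complex) \<Rightarrow> ('e \<Rightarrow> complex) \<Rightarrow> ('e \<Rightarrow> complex) \<Rightarrow> complex"
  where "diff1 f y v = deriv (\<lambda>t. f (\<lambda>e. y e + t * v e)) 0"

text \<open>
  The residue of \<open>(dy\<^sub>e\<^sub>1 \<and> \<dots> \<and> dy\<^sub>e\<^sub>N) / (f\<^sub>1 \<cdots> f\<^sub>r)\<close> along \<open>f\<^sub>1 = \<dots> = f\<^sub>r = 0\<close> is the restriction of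
  any form \<open>\<psi>\<close> with \<open>df\<^sub>1 \<and> \<dots> \<and> df\<^sub>r \<and> \<psi> = dy\<^sub>e\<^sub>1 \<and> \<dots> \<and> dy\<^sub>e\<^sub>N\<close>.  Where the \<open>df\<^sub>i\<close> are independent, \<open>\<psi>\<close>
  exists and its values on vectors tangent to the subvariety do not depend on the choice.
\<close>

definition residue_form ::
  "'e list \<Rightarrow> (('e \<Rightarrow> complex) \<Rightarrow> complex) list \<Rightarrow>
     ('e \<Rightarrow> complex) \<Rightarrow> ('e \<Rightarrow> complex) list \<Rightarrow> complex" where
  "residue_form es fs y = (SOME \<psi>. alternating_form (set es) (length es - length fs) \<psi> \<and>
     (\<forall>vs. length vs = length es \<and> set vs \<subseteq> affine_space (set es) \<longrightarrow>
        wedge (length fs) (length es - length fs) (wedge_list (map (\<lambda>f. diff1 f y) fs)) \<psi> vs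
          = wedge_list (map (\<lambda>e v. v e) es) vs))"


section \<open>The variety, the cycle and the period integral\<close>

definition F_eq :: "(nat \<Rightarrow> nat) \<Rightarrow> nat \<Rightarrow> (nat \<Rightarrow> complex) \<Rightarrow> nat \<Rightarrow> (edge \<Rightarrow> complex) \<Rightarrow> complex" where
  "F_eq k l q i y = (\<Prod>e\<in>roof k l i. y e) - q i"

definition G_eq :: "(pt \<Rightarrow> complex) \<Rightarrow> pt \<Rightarrow> (edge \<Rightarrow> complex) \<Rightarrow> complex" where
  "G_eq qt b y = (\<Prod>e\<in>corner b. y e) - qt b * (\<Prod>e\<in>opp_corner b. y e)"

definition M_variety ::
  "(nat \<Rightarrow> nat) \<Rightarrow> nat \<Rightarrow> (nat \<Rightarrow> complex) \<Rightarrow> (pt \<Rightarrow> complex) \<Rightarrow> (edge \<Rightarrow> complex) set" where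
  "M_variety k l q qt = {y \<in> affine_space (edges k l).
     (\<forall>i\<in>{1..l}. F_eq k l q i y = 0) \<and> (\<forall>b\<in>boxes k l. G_eq qt b y = 0)}"

text \<open>The form \<open>\<omega>\<close>.  The lists \<open>es\<close> and \<open>bs\<close> enumerate the edges and the boxes; changing the order
  changes the form at most by a sign.\<close>

definition omega ::
  "(nat \<Rightarrow> nat) \<Rightarrow> nat \<Rightarrow> (nat \<Rightarrow> complex) \<Rightarrow> (pt \<Rightarrow> complex) \<Rightarrow> edge list \<Rightarrow> pt list \<Rightarrow>
     (edge \<Rightarrow> complex) \<Rightarrow> (edge \<Rightarrow> complex) list \<Rightarrow> complex" where
  "omega k l q qt es bs = residue_form es (map (F_eq k l q) [1..<l + 1] @ map (G_eq qt) bs)"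

definition cone_of :: "(pt \<Rightarrow> real) set \<Rightarrow> (pt \<Rightarrow> real) set" where
  "cone_of A = {(\<lambda>v. \<Sum>a\<in>A. c a * a v) | c. \<forall>a\<in>A. 0 \<le> c a}"

definition maximal_cones :: "(nat \<Rightarrow> nat) \<Rightarrow> nat \<Rightarrow> (pt \<Rightarrow> real) set set" where
  "maximal_cones k l = {cone_of (delta k l ` G) | G. G \<subseteq> edges k l \<and>
     (\<forall>i\<in>{1..l}. card (roof k l i - G) = 1) \<and> (\<forall>b\<in>boxes k l. card (corner b - G) = 1)}"

definition cone_edges :: "(nat \<Rightarrow> nat) \<Rightarrow> nat \<Rightarrow> (pt \<Rightarrow> real) set \<Rightarrow> edge set" where
  "cone_edges k l \<sigma> = {e \<in> edges k l. delta k l e \<in> \<sigma>}"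

definition gamma_torus ::
  "(nat \<Rightarrow> nat) \<Rightarrow> nat \<Rightarrow> (nat \<Rightarrow> complex) \<Rightarrow> (pt \<Rightarrow> complex) \<Rightarrow> (pt \<Rightarrow> real) set \<Rightarrow>
     (edge \<Rightarrow> complex) set" where
  "gamma_torus k l q qt \<sigma> = {y \<in> M_variety k l q qt. \<forall>e\<in>cone_edges k l \<sigma>. norm (y e) = 1}"

text \<open>The parametrization of the torus by the arguments of the coordinates in \<open>cone_edges\<close>.\<close>

definition torus_point ::
  "(nat \<Rightarrow> nat) \<Rightarrow> nat \<Rightarrow> (nat \<Rightarrow> complex) \<Rightarrow> (pt \<Rightarrow> complex) \<Rightarrow> (pt \<Rightarrow> real) set \<Rightarrow>
     (edge \<Rightarrow> real) \<Rightarrow> edge \<Rightarrow> complex" where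
  "torus_point k l q qt \<sigma> \<theta> =
     (THE y. y \<in> gamma_torus k l q qt \<sigma> \<and> (\<forall>e\<in>cone_edges k l \<sigma>. y e = cis (\<theta> e)))"

definition torus_tangent ::
  "(nat \<Rightarrow> nat) \<Rightarrow> nat \<Rightarrow> (nat \<Rightarrow> complex) \<Rightarrow> (pt \<Rightarrow> complex) \<Rightarrow> (pt \<Rightarrow> real) set \<Rightarrow>
     (edge \<Rightarrow> real) \<Rightarrow> edge \<Rightarrow> edge \<Rightarrow> complex" where
  "torus_tangent k l q qt \<sigma> \<theta> g =
     (\<lambda>e. vector_derivative (\<lambda>t. torus_point k l q qt \<sigma> (\<theta>(g := t)) e) (at (\<theta> g)))"

text \<open>The integral of a differential form over the torus, oriented by the order in which \<open>gs\<close>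
  enumerates \<open>cone_edges\<close>.\<close>

definition torus_integral ::
  "(nat \<Rightarrow> nat) \<Rightarrow> nat \<Rightarrow> (nat \<Rightarrow> complex) \<Rightarrow> (pt \<Rightarrow> complex) \<Rightarrow> (pt \<Rightarrow> real) set \<Rightarrow> edge list \<Rightarrow>
     ((edge \<Rightarrow> complex) \<Rightarrow> (edge \<Rightarrow> complex) list \<Rightarrow> complex) \<Rightarrow> complex" where
  "torus_integral k l q qt \<sigma> gs \<eta> =
     set_lebesgue_integral (PiM (cone_edges k l \<sigma>) (\<lambda>_. lborel))
       (PiE (cone_edges k l \<sigma>) (\<lambda>_. {0..2 * pi}))
       (\<lambda>\<theta>. \<eta> (torus_point k l q qt \<sigma> \<theta>) (map (torus_tangent k l q qt \<sigma> \<theta>) gs))"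

text \<open>The sign that turns the orientation given by \<open>gs\<close> into the one for which the normalized
  integral of \<open>\<omega>\<close> is 1.\<close>

definition torus_sign ::
  "(nat \<Rightarrow> nat) \<Rightarrow> nat \<Rightarrow> (nat \<Rightarrow> complex) \<Rightarrow> (pt \<Rightarrow> complex) \<Rightarrow> (pt \<Rightarrow> real) set \<Rightarrow>
     edge list \<Rightarrow> pt list \<Rightarrow> edge list \<Rightarrow> complex" where
  "torus_sign k l q qt \<sigma> es bs gs = (THE \<epsilon>. \<epsilon> \<in> {1, -1} \<and>
     1 / (2 * pi * \<i>) ^ card (squares k l) *
       (\<epsilon> * torus_integral k l q qt \<sigma> gs (omega k l q qt es bs)) = 1)"

definition period_integral ::
  "(nat \<Rightarrow> nat) \<Rightarrow> nat \<Rightarrow> (nat \<Rightarrow> complex) \<Rightarrow> (pt \<Rightarrow> complex) \<Rightarrow> (pt \<Rightarrow> real) set \<Rightarrow>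
     edge list \<Rightarrow> pt list \<Rightarrow> edge list \<Rightarrow> complex" where
  "period_integral k l q qt \<sigma> es bs gs =
     1 / (2 * pi * \<i>) ^ card (squares k l) *
       (torus_sign k l q qt \<sigma> es bs gs *
        torus_integral k l q qt \<sigma> gs
          (\<lambda>y vs. exp (\<Sum>e\<in>edges k l. y e) * omega k l q qt es bs y vs))"

end

theory Submission imports Defs
begin

text \<open>
  Every edge \<open>e\<close> of the graph is crossed by one segment \<open>w\<close> of the ladder diagram.  Let \<open>H e\<close> and
  \<open>T e\<close> be the indices (roof, box or zero) attached to the end and the start of \<open>w\<close>.  The edges with
  \<open>H e = j\<close> are the roof \<open>j\<close>, or the corner of the box \<open>j\<close>; those with \<open>T e = j\<close> are the opposite
  corner of the box \<open>j\<close>, and there are none if \<open>j\<close> is a roof.  So all equations of the variety have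
  the same shape: the product of \<open>y\<^sub>e\<close> over \<open>H e = j\<close> equals \<open>Q\<^sub>j\<close> times the product over
  \<open>T e = j\<close>, where \<open>Q\<^sub>j\<close> is the parameter of \<open>j\<close>.  The coefficients have a uniform shape, too: since
  a box is the head of two edges and the tail of two edges, the factorials of the indices of boxes
  cancel in \<open>A\<^sub>m\<close>, and the roof factors cancel those left in the numerator.  What remains is the
  product over all edges of \<open>1 / (m\<^sub>H - m\<^sub>T)!\<close>, read as zero when \<open>m\<^sub>T > m\<^sub>H\<close>
  (\<open>coefficient_eq\<close>).

  On the variety the residue form is, up to sign, the invariant form of an algebraic torus whose
  coordinates are the \<open>y\<^sub>g\<close> for the kept edges \<open>g\<close>, those in the chosen cone.  The period is
  therefore the mean of \<open>exp (\<Sum> y\<^sub>e)\<close> over the compact torus.  Expand it in the monomials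
  \<open>\<Prod> y\<^sub>e ^ n\<^sub>e / n\<^sub>e!\<close>, with \<open>n\<close> ranging over all families of natural numbers, and integrate term
  by term.  Exactly one edge with head \<open>j\<close> is omitted for each index \<open>j\<close>; the equations
  \<open>n\<^sub>e = m\<^sub>H - m\<^sub>T\<close> for the omitted edges determine a unique family \<open>m\<close> of natural numbers,
  computed by moving from small indices to large ones.  By the equations of the variety, the monomial
  equals \<open>\<Prod> Q\<^sub>j ^ m\<^sub>j\<close> times a character of the torus with exponents \<open>n\<^sub>g - (m\<^sub>H - m\<^sub>T)\<close>.
  Its mean is zero unless all these exponents vanish, that is, unless \<open>n\<^sub>e = m\<^sub>H - m\<^sub>T\<close> for all
  edges.  This gives the series (\<open>torus_mean_of_exp\<close>).

  Everything rests on one triangularity: a segment leads from an index to a strictly larger one.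
  It makes the recursion for \<open>m\<close> work, it shows that the torus is parametrized by the kept
  coordinates, and it makes the determinant that compares the residue with the invariant form a
  sign, as only one permutation contributes (\<open>incidence_determinant\<close>).

  It remains to be seen that the cone contains no further edge (\<open>cone_edges_eq\<close>) and that there
  are as many kept edges as squares (\<open>card_G\<close>).  An omitted edge in the cone would give a flow on
  the graph with conservation at all squares.  As the graph is planar, the flow along each edge is
  a difference of values of a potential on the indices (\<open>flow_potential\<close>), and triangularity forces
  it to be positive on some kept edge, against the sign of the coefficients in a cone.
\<close>

section \<open>Alternating forms and the residue\<close>

definition linear_on_affine_space :: "'e set \<Rightarrow> (('e \<Rightarrow> complex) \<Rightarrow> complex) \<Rightarrow> bool" where
  "linear_on_affine_space E \<alpha> \<longleftrightarrow>
     (\<forall>u\<in>affine_space E. \<forall>v\<in>affine_space E. \<forall>c. \<alpha> (\<lambda>e. c * u e + v e) = c * \<alpha> u + \<alpha> v)"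

lemma affine_space_add:
  "u \<in> affine_space E \<Longrightarrow> v \<in> affine_space E \<Longrightarrow> (\<lambda>e. c * u e + v e) \<in> affine_space E"
  by (auto simp: affine_space_def)

lemma wedge_list_repeated_vector:
  assumes "i < j" "j < length \<alpha>s" "vs ! i = vs ! j"
  shows "wedge_list \<alpha>s vs = 0"
proof -
  define p where "p = length \<alpha>s"
  define q :: "nat \<Rightarrow> nat" where "q = Transposition.transpose i j"
  define f where "f \<pi> = of_int (sign \<pi>) * (\<Prod>k<p. (\<alpha>s ! k) (vs ! \<pi> k))" for \<pi>
  have q: "q permutes {..<p}"
    unfolding q_def using assms by (intro permutes_swap_id) (auto simp: p_def)
  have vq: "vs ! q x = vs ! x" for x
    using assms(3) by (auto simp: q_def Transposition.transpose_def)
  have f_q: "f (q \<circ> \<pi>) = - f \<pi>" if "\<pi> permutes {..<p}" for \<pi>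
  proof -
    have "sign (q \<circ> \<pi>) = sign q * sign \<pi>"
      using q that by (intro sign_compose permutes_imp_permutation[of "{..<p}"]) auto
    moreover have "sign q = -1"
      using assms(1) by (simp add: q_def sign_swap_id)
    ultimately show ?thesis by (simp add: f_def vq)
  qed
  have "wedge_list \<alpha>s vs = (\<Sum>\<pi> | \<pi> permutes {..<p}. f \<pi>)"
    by (simp add: wedge_list_def f_def p_def)
  also have "\<dots> = (\<Sum>\<pi> | \<pi> permutes {..<p}. f (q \<circ> \<pi>))"
    by (rule setum_permutations_compose_left[OF q])
  also have "\<dots> = - (\<Sum>\<pi> | \<pi> permutes {..<p}. f \<pi>)"
    by (simp add: f_q sum_negf)
  also have "(\<Sum>\<pi> | \<pi> permutes {..<p}. f \<pi>) = wedge_list \<alpha>s vs"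
    by (simp add: wedge_list_def f_def p_def)
  finally show ?thesis by simp
qed

lemma alternating_form_wedge_list:
  fixes E :: "'e set"
  assumes "\<And>\<alpha>. \<alpha> \<in> set \<alpha>s \<Longrightarrow> linear_on_affine_space E \<alpha>"
  shows "alternating_form E (length \<alpha>s) (wedge_list \<alpha>s)"
  unfolding alternating_form_def
proof (intro conjI allI impI; elim conjE)
  fix vs :: "('e \<Rightarrow> complex) list" and i j assume "i < j" "j < length \<alpha>s" "vs ! i = vs ! j"
  then show "wedge_list \<alpha>s vs = 0" by (rule wedge_list_repeated_vector)
next
  fix vs :: "('e \<Rightarrow> complex) list" and i u v c
  assume vs: "length vs = length \<alpha>s" and i: "i < length \<alpha>s"
    and u: "u \<in> affine_space E" and v: "v \<in> affine_space E"
  define rest where "rest \<pi> = (\<Prod>k\<in>{..<length \<alpha>s} - {inv \<pi> i}. (\<alpha>s ! k) (vs ! \<pi> k))" for \<pi>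
  have split: "(\<Prod>k<length \<alpha>s. (\<alpha>s ! k) (vs[i := w] ! \<pi> k)) = (\<alpha>s ! inv \<pi> i) w * rest \<pi>"
    if \<pi>: "\<pi> permutes {..<length \<alpha>s}" for w \<pi>
  proof -
    have ipi: "inv \<pi> i < length \<alpha>s" "\<pi> (inv \<pi> i) = i"
      using \<pi> i permutes_in_image[OF permutes_inv[OF \<pi>]] permutes_inverses[OF \<pi>] by auto
    have neq: "i \<noteq> \<pi> k" if "k \<noteq> inv \<pi> i" for k
      using that permutes_inverses[OF \<pi>] by metis
    have "(\<Prod>k<length \<alpha>s. (\<alpha>s ! k) (vs[i := w] ! \<pi> k)) = (\<alpha>s ! inv \<pi> i) (vs[i := w] ! i) *
        (\<Prod>k\<in>{..<length \<alpha>s} - {inv \<pi> i}. (\<alpha>s ! k) (vs[i := w] ! \<pi> k))"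
      using ipi by (subst prod.remove[of _ "inv \<pi> i"]) auto
    also have "(\<Prod>k\<in>{..<length \<alpha>s} - {inv \<pi> i}. (\<alpha>s ! k) (vs[i := w] ! \<pi> k)) = rest \<pi>"
      unfolding rest_def using neq by (intro prod.cong) auto
    finally show ?thesis using vs i by simp
  qed
  have lin: "(\<alpha>s ! inv \<pi> i) (\<lambda>e. c * u e + v e) = c * (\<alpha>s ! inv \<pi> i) u + (\<alpha>s ! inv \<pi> i) v"
    if \<pi>: "\<pi> permutes {..<length \<alpha>s}" for \<pi>
  proof -
    have "inv \<pi> i < length \<alpha>s"
      using \<pi> i permutes_in_image[OF permutes_inv[OF \<pi>]] by auto
    then show ?thesis
      using assms[of "\<alpha>s ! inv \<pi> i"] u v by (auto simp: linear_on_affine_space_def)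
  qed
  have "wedge_list \<alpha>s (vs[i := (\<lambda>e. c * u e + v e)]) = (\<Sum>\<pi> | \<pi> permutes {..<length \<alpha>s}.
      c * (of_int (sign \<pi>) * ((\<alpha>s ! inv \<pi> i) u * rest \<pi>)) + of_int (sign \<pi>) * ((\<alpha>s ! inv \<pi> i) v * rest \<pi>))"
    unfolding wedge_list_def
  proof (intro sum.cong refl, elim CollectE)
    fix \<pi> assume \<pi>: "\<pi> permutes {..<length \<alpha>s}"
    show "of_int (sign \<pi>) * (\<Prod>k<length \<alpha>s. (\<alpha>s ! k) (vs[i := (\<lambda>e. c * u e + v e)] ! \<pi> k)) =
      c * (of_int (sign \<pi>) * ((\<alpha>s ! inv \<pi> i) u * rest \<pi>)) +
      of_int (sign \<pi>) * ((\<alpha>s ! inv \<pi> i) v * rest \<pi>)"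
      unfolding split[OF \<pi>] lin[OF \<pi>] by (simp add: algebra_simps)
  qed
  also have "\<dots> = c * wedge_list \<alpha>s (vs[i := u]) + wedge_list \<alpha>s (vs[i := v])"
    unfolding wedge_list_def sum.distrib sum_distrib_left
    by (intro arg_cong2[of _ _ _ _ "(+)"] sum.cong refl) (simp_all add: split)
  finally show "wedge_list \<alpha>s (vs[i := (\<lambda>e. c * u e + v e)]) =
      c * wedge_list \<alpha>s (vs[i := u]) + wedge_list \<alpha>s (vs[i := v])" .
qed

lemma alternating_form_scale:
  assumes "alternating_form E p \<psi>"
  shows "alternating_form E p (\<lambda>vs. c * \<psi> vs)"
  unfolding alternating_form_def
proof (intro conjI allI impI)
  fix vs i u v d
  assume "length vs = p \<and> set vs \<subseteq> affine_space E \<and> i < p \<and> u \<in> affine_space E \<and> v \<in> affine_space E"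
  then have "\<psi> (vs[i := (\<lambda>e. d * u e + v e)]) = d * \<psi> (vs[i := u]) + \<psi> (vs[i := v])"
    using assms unfolding alternating_form_def by blast
  then show "c * \<psi> (vs[i := (\<lambda>e. d * u e + v e)]) = d * (c * \<psi> (vs[i := u])) + c * \<psi> (vs[i := v])"
    by (simp add: algebra_simps)
next
  fix vs i j
  assume "length vs = p \<and> set vs \<subseteq> affine_space E \<and> i < j \<and> j < p \<and> vs ! i = vs ! j"
  then have "\<psi> vs = 0"
    using assms unfolding alternating_form_def by blast
  then show "c * \<psi> vs = 0" by simp
qed

text \<open>Expand \<open>\<psi>\<close> with \<open>v\<^sub>i + v\<^sub>j\<close> put into both places \<open>i\<close> and \<open>j\<close>.\<close>

lemma alternating_form_swap:
  assumes alt: "alternating_form E p \<psi>" and len: "length vs = p" and vs: "set vs \<subseteq> affine_space E"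
    and ij: "i < j" "j < p"
  shows "\<psi> (vs[i := vs ! j, j := vs ! i]) = - \<psi> vs"
proof -
  define B where "B u v = \<psi> (vs[i := u, j := v])" for u v
  define x y where "x = vs ! i" and "y = vs ! j"
  define w where "w = (\<lambda>e. 1 * x e + y e)"
  have mem: "x \<in> affine_space E" "y \<in> affine_space E"
    using vs ij len by (auto simp: x_def y_def)
  then have w: "w \<in> affine_space E"
    unfolding w_def by (intro affine_space_add)
  have sub: "set (vs[i := u, j := v]) \<subseteq> affine_space E"
    if "u \<in> affine_space E" "v \<in> affine_space E" for u v
    using that vs set_update_subset_insert[of vs i u] set_update_subset_insert[of "vs[i := u]" j v]
    by blast
  have zero: "\<psi> ws = 0" if "length ws = p" "set ws \<subseteq> affine_space E" "ws ! i = ws ! j" for ws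
    using alt that ij unfolding alternating_form_def by blast
  have diag: "B u u = 0" if "u \<in> affine_space E" for u
    unfolding B_def using len ij by (intro zero sub that) auto
  have multilin: "\<psi> (ws[k := (\<lambda>e. 1 * a e + b e)]) = 1 * \<psi> (ws[k := a]) + \<psi> (ws[k := b])"
    if "length ws = p" "set ws \<subseteq> affine_space E" "k < p" "a \<in> affine_space E" "b \<in> affine_space E"
    for ws k a b
    using alt that unfolding alternating_form_def by blast
  have right: "B u w = B u x + B u y" if "u \<in> affine_space E" for u
  proof -
    have "set (vs[i := u]) \<subseteq> affine_space E"
      using set_update_subset_insert[of vs i u] that vs by blast
    from multilin[OF _ this ij(2) mem] show ?thesis
      using len by (simp add: B_def w_def)
  qed
  have left: "B w u = B x u + B y u" if "u \<in> affine_space E" for u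
  proof -
    have sub': "set (vs[j := u]) \<subseteq> affine_space E"
      using set_update_subset_insert[of vs j u] that vs by blast
    have swap: "vs[i := a, j := b] = vs[j := b, i := a]" for a b
      using ij by (simp add: list_update_swap)
    show ?thesis
      using multilin[OF _ sub' _ mem, of i] len ij by (simp add: B_def w_def swap)
  qed
  have "0 = B x y + B y x"
    using diag[OF w] right[OF w] left[OF mem(1)] left[OF mem(2)] diag[OF mem(1)] diag[OF mem(2)]
    by (simp add: add.commute)
  moreover have "B x y = \<psi> vs"
    by (simp add: B_def x_def y_def)
  ultimately have "B y x = - \<psi> vs"
    by (simp add: add_eq_0_iff)
  then show ?thesis
    by (simp add: B_def x_def y_def)
qed

text \<open>The indices are shifted by \<open>p\<close> because in a wedge product the second factor is evaluated on the
  vectors with indices from \<open>p\<close> on.\<close>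

lemma alternating_form_permute:
  assumes alt: "alternating_form E r \<psi>"
    and \<tau>: "\<tau> permutes {p..<p + r}"
    and w: "\<And>i. i \<in> {p..<p + r} \<Longrightarrow> w i \<in> affine_space E"
  shows "\<psi> (map (\<lambda>i. w (\<tau> i)) [p..<p + r]) = of_int (sign \<tau>) * \<psi> (map w [p..<p + r])"
proof -
  have "finite {p..<p + r}" by simp
  then show ?thesis
    using \<tau>
  proof (induction rule: permutes_rev_induct)
    case id
    then show ?case by simp
  next
    case (swap a b \<tau>)
    define vs where "vs = map (\<lambda>i. w (\<tau> i)) [p..<p + r]"
    have vs: "length vs = r" "set vs \<subseteq> affine_space E"
      using w permutes_in_image[OF swap.hyps(4)] by (auto simp: vs_def)
    have less: "\<psi> (vs[i := vs ! j, j := vs ! i]) = - \<psi> vs" if "i < r" "j < r" "i \<noteq> j" for i j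
    proof (cases "i < j")
      case True
      then show ?thesis using alternating_form_swap[OF alt vs] that by simp
    next
      case False
      then have "\<psi> (vs[j := vs ! i, i := vs ! j]) = - \<psi> vs"
        using alternating_form_swap[OF alt vs, of j i] that by simp
      then show ?thesis using that by (simp add: list_update_swap)
    qed
    have "map (\<lambda>i. w ((\<tau> \<circ> Transposition.transpose a b) i)) [p..<p + r] = vs[a - p := vs ! (b - p), b - p := vs ! (a - p)]"
      using swap.hyps(1-3)
      by (intro nth_equalityI) (auto simp: vs_def nth_list_update Transposition.transpose_def)
    moreover have "\<psi> (vs[a - p := vs ! (b - p), b - p := vs ! (a - p)]) = - \<psi> vs"
      using swap.hyps(1-3) by (intro less) auto
    moreover have "sign (\<tau> \<circ> Transposition.transpose a b) = - sign \<tau>"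
      using swap.hyps(3,4)
      by (subst sign_compose)
        (auto simp: permutation_swap_id sign_swap_id intro: permutes_imp_permutation[of "{p..<p + r}"])
    ultimately show ?case
      using swap.IH unfolding vs_def by (simp add: o_def del: map_eq_conv)
  qed
qed

lemma wedge_list_repeated_form:
  assumes "i < j" "j < length \<alpha>s" "\<alpha>s ! i = \<alpha>s ! j"
  shows "wedge_list \<alpha>s vs = 0"
proof -
  define p where "p = length \<alpha>s"
  define q :: "nat \<Rightarrow> nat" where "q = Transposition.transpose i j"
  define f where "f \<pi> = of_int (sign \<pi>) * (\<Prod>k<p. (\<alpha>s ! k) (vs ! \<pi> k))" for \<pi>
  have q: "q permutes {..<p}"
    unfolding q_def using assms by (intro permutes_swap_id) (auto simp: p_def)
  have \<alpha>q: "\<alpha>s ! q x = \<alpha>s ! x" for x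
    using assms(3) by (auto simp: q_def Transposition.transpose_def)
  have f_q: "f (\<pi> \<circ> q) = - f \<pi>" if "\<pi> permutes {..<p}" for \<pi>
  proof -
    have "sign (\<pi> \<circ> q) = sign \<pi> * sign q"
      using q that by (intro sign_compose permutes_imp_permutation[of "{..<p}"]) auto
    moreover have "sign q = -1"
      using assms(1) by (simp add: q_def sign_swap_id)
    moreover have "(\<Prod>k<p. (\<alpha>s ! k) (vs ! (\<pi> \<circ> q) k)) = (\<Prod>k<p. (\<alpha>s ! q k) (vs ! \<pi> (q k)))"
      by (simp add: \<alpha>q)
    moreover have "\<dots> = (\<Prod>k<p. (\<alpha>s ! k) (vs ! \<pi> k))"
      using prod.permute[OF q, of "\<lambda>k. (\<alpha>s ! k) (vs ! \<pi> k)"] by (simp add: o_def)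
    ultimately show ?thesis by (simp add: f_def)
  qed
  have "wedge_list \<alpha>s vs = (\<Sum>\<pi> | \<pi> permutes {..<p}. f \<pi>)"
    by (simp add: wedge_list_def f_def p_def)
  also have "\<dots> = (\<Sum>\<pi> | \<pi> permutes {..<p}. f (\<pi> \<circ> q))"
    by (rule sum_permutations_compose_right[OF q])
  also have "\<dots> = - (\<Sum>\<pi> | \<pi> permutes {..<p}. f \<pi>)"
    by (simp add: f_q sum_negf)
  also have "(\<Sum>\<pi> | \<pi> permutes {..<p}. f \<pi>) = wedge_list \<alpha>s vs"
    by (simp add: wedge_list_def f_def p_def)
  finally show ?thesis by simp
qed

lemma wedge_list_permute_forms:
  assumes f: "f permutes {..<length \<alpha>s}"
  shows "wedge_list (map (\<lambda>i. \<alpha>s ! f i) [0..<length \<alpha>s]) vs = of_int (sign f) * wedge_list \<alpha>s vs"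
proof -
  define p where "p = length \<alpha>s"
  have *: "of_int (sign (\<pi> \<circ> f)) * (\<Prod>i<p. (\<alpha>s ! f i) (vs ! (\<pi> \<circ> f) i)) =
      of_int (sign f) * (of_int (sign \<pi>) * (\<Prod>i<p. (\<alpha>s ! i) (vs ! \<pi> i)) :: complex)"
    if "\<pi> permutes {..<p}" for \<pi>
  proof -
    have "sign (\<pi> \<circ> f) = sign \<pi> * sign f"
      using f that by (intro sign_compose permutes_imp_permutation[of "{..<p}"]) (auto simp: p_def)
    moreover have "(\<Prod>i<p. (\<alpha>s ! f i) (vs ! \<pi> (f i))) = (\<Prod>i<p. (\<alpha>s ! i) (vs ! \<pi> i))"
      using prod.permute[of f "{..<p}" "\<lambda>k. (\<alpha>s ! k) (vs ! \<pi> k)"] f by (simp add: o_def p_def)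
    ultimately show ?thesis by simp
  qed
  have "wedge_list (map (\<lambda>i. \<alpha>s ! f i) [0..<p]) vs =
      (\<Sum>\<pi> | \<pi> permutes {..<p}. of_int (sign \<pi>) * (\<Prod>i<p. (\<alpha>s ! f i) (vs ! \<pi> i)))"
    by (simp add: wedge_list_def)
  also have "\<dots> = (\<Sum>\<pi> | \<pi> permutes {..<p}.
      of_int (sign (\<pi> \<circ> f)) * (\<Prod>i<p. (\<alpha>s ! f i) (vs ! (\<pi> \<circ> f) i)))"
    by (rule sum_permutations_compose_right) (use f in \<open>simp add: p_def\<close>)
  also have "\<dots> = of_int (sign f) * wedge_list \<alpha>s vs"
    unfolding wedge_list_def p_def[symmetric] sum_distrib_left
    by (intro sum.cong refl *) auto
  finally show ?thesis by (simp add: p_def)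
qed

text \<open>The multiplicativity of the determinant.  Multiplying out the rows gives a sum over all maps
  \<open>f\<close> from rows to columns; the terms with non-injective \<open>f\<close> vanish because a form is repeated, and
  the others differ from the volume form by the sign of \<open>f\<close>.\<close>

lemma wedge_list_coefficient_matrix:
  fixes es :: "'e list"
  assumes es: "distinct es" and len: "length \<gamma>s = length es" "length vs = length es"
    and lin: "\<And>i v. i < length es \<Longrightarrow> v \<in> affine_space (set es) \<Longrightarrow> (\<gamma>s ! i) v = (\<Sum>j<length es. A i j * v (es ! j))"
    and vs: "set vs \<subseteq> affine_space (set es)"
  shows "wedge_list \<gamma>s vs =
     (\<Sum>f | f permutes {..<length es}. of_int (sign f) * (\<Prod>i<length es. A i (f i))) *
     wedge_list (map (\<lambda>e v. v e) es) vs"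
proof -
  define N where "N = length es"
  define co :: "(nat \<Rightarrow> nat) \<Rightarrow> (('e \<Rightarrow> complex) \<Rightarrow> complex) list"
    where "co f = map (\<lambda>i v. v (es ! f i)) [0..<N]" for f
  have map_es: "map (\<lambda>e v. v e) es = co id"
    by (intro nth_equalityI) (auto simp: co_def N_def)
  have not_inj: "wedge_list (co f) vs = 0"
    if f: "f \<in> {..<N} \<rightarrow>\<^sub>E {..<N}" "\<not> inj_on f {..<N}" for f
  proof -
    obtain i j where "i < N" "j < N" "i \<noteq> j" "f i = f j"
      using f(2) by (auto simp: inj_on_def)
    then show ?thesis
      using wedge_list_repeated_form[of i j "co f" vs] wedge_list_repeated_form[of j i "co f" vs]
      by (cases i j rule: linorder_cases) (auto simp: co_def)
  qed
  have perm: "wedge_list (co f) vs = of_int (sign f) * wedge_list (co id) vs"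
    if f: "f permutes {..<N}" for f
  proof -
    have len: "length (co id) = N" by (simp add: co_def)
    have eq: "co f = map (\<lambda>i. co id ! f i) [0..<length (co id)]"
      using permutes_in_image[OF f] by (auto simp: co_def)
    show ?thesis
      by (subst eq, rule wedge_list_permute_forms) (simp add: len f)
  qed
  have "wedge_list \<gamma>s vs =
      (\<Sum>\<pi> | \<pi> permutes {..<N}. of_int (sign \<pi>) * (\<Prod>i<N. \<Sum>j<N. A i j * (vs ! \<pi> i) (es ! j)))"
    unfolding wedge_list_def len N_def
  proof (intro sum.cong refl arg_cong2[of _ _ _ _ "(*)"] prod.cong, elim CollectE)
    fix \<pi> i assume \<pi>: "\<pi> permutes {..<length es}" and i: "i \<in> {..<length es}"
    then have "\<pi> i < length es"
      using permutes_in_image[OF \<pi>] by blast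
    then show "(\<gamma>s ! i) (vs ! \<pi> i) = (\<Sum>j<length es. A i j * (vs ! \<pi> i) (es ! j))"
      using vs len i by (intro lin) auto
  qed
  also have "\<dots> = (\<Sum>\<pi> | \<pi> permutes {..<N}. \<Sum>f\<in>{..<N} \<rightarrow>\<^sub>E {..<N}.
      (\<Prod>i<N. A i (f i)) * (of_int (sign \<pi>) * (\<Prod>i<N. (vs ! \<pi> i) (es ! f i))))"
    by (simp add: prod_sum_PiE prod.distrib sum_distrib_left mult_ac)
  also have "\<dots> = (\<Sum>f\<in>{..<N} \<rightarrow>\<^sub>E {..<N}. (\<Prod>i<N. A i (f i)) * wedge_list (co f) vs)"
    by (subst sum.swap) (simp add: wedge_list_def co_def sum_distrib_left)
  also have "\<dots> = (\<Sum>f\<in>{f\<in>{..<N} \<rightarrow>\<^sub>E {..<N}. inj_on f {..<N}}. (\<Prod>i<N. A i (f i)) * wedge_list (co f) vs)"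
    by (intro sum.mono_neutral_right finite_PiE) (auto simp: not_inj)
  also have "\<dots> = (\<Sum>f | f permutes {..<N}. (\<Prod>i<N. A i (f i)) * wedge_list (co f) vs)"
  proof (rule sum.reindex_bij_witness[where i = "\<lambda>f. restrict f {..<N}" and j = "\<lambda>f i. if i < N then f i else i"])
    fix f assume "f \<in> {f\<in>{..<N} \<rightarrow>\<^sub>E {..<N}. inj_on f {..<N}}"
    then have f: "f \<in> {..<N} \<rightarrow>\<^sub>E {..<N}" "inj_on f {..<N}" by auto
    show "restrict (\<lambda>i. if i < N then f i else i) {..<N} = f"
      using f(1) by (auto simp: fun_eq_iff PiE_def extensional_def)
    have "f ` {..<N} = {..<N}"
      by (rule endo_inj_surj) (use f in auto)
    then have "bij_betw f {..<N} {..<N}"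
      using f by (simp add: bij_betw_def)
    then have "bij_betw (\<lambda>i. if i < N then f i else i) {..<N} {..<N}"
      by (subst bij_betw_cong[of _ _ f]) auto
    then have "(\<lambda>i. if i < N then f i else i) permutes {..<N}"
      by (rule bij_imp_permutes) simp
    then show "(\<lambda>i. if i < N then f i else i) \<in> {f. f permutes {..<N}}"
      by simp
    show "(\<Prod>i<N. A i (if i < N then f i else i)) * wedge_list (co (\<lambda>i. if i < N then f i else i)) vs =
        (\<Prod>i<N. A i (f i)) * wedge_list (co f) vs"
      by (intro arg_cong2[of _ _ _ _ "(*)"] prod.cong arg_cong2[of _ _ _ _ wedge_list])
        (auto simp: co_def)
  next
    fix f assume "f \<in> {f. f permutes {..<N}}"
    then have f: "f permutes {..<N}" by simp
    show "(\<lambda>i. if i < N then restrict f {..<N} i else i) = f"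
      using permutes_not_in[OF f] by (auto simp: fun_eq_iff)
    show "restrict f {..<N} \<in> {f\<in>{..<N} \<rightarrow>\<^sub>E {..<N}. inj_on f {..<N}}"
      using permutes_in_image[OF f] permutes_inj_on[OF f, of "{..<N}"] by (auto simp: inj_on_restrict_eq)
  qed
  also have "\<dots> = (\<Sum>f | f permutes {..<N}. of_int (sign f) * (\<Prod>i<N. A i (f i))) * wedge_list (co id) vs"
    unfolding sum_distrib_right by (intro sum.cong refl, subst perm) (auto simp: mult_ac)
  finally show ?thesis
    by (simp add: map_es N_def)
qed

text \<open>For permutations \<open>\<sigma>\<close> and \<open>\<tau>\<close> of the two blocks of indices, replacing \<open>\<pi>\<close> by
  \<open>\<pi> \<circ> \<sigma> \<circ> \<tau>\<close> turns each term into one of the full determinant.  All of these \<open>p! r!\<close> choices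
  give the same sum, which is what the denominator of the wedge product compensates.\<close>

lemma wedge_wedge_list:
  assumes p: "length \<alpha>s = p" and r: "length \<beta>s = r"
  shows "wedge p r (wedge_list \<alpha>s) (wedge_list \<beta>s) vs = wedge_list (\<alpha>s @ \<beta>s) vs"
proof -
  define g where "g i = (\<alpha>s @ \<beta>s) ! i" for i
  define F where "F \<pi> = of_int (sign \<pi>) * (\<Prod>i<p + r. g i (vs ! \<pi> i))" for \<pi>
  let ?A = "{\<sigma>. \<sigma> permutes {..<p}}" and ?B = "{\<tau>. \<tau> permutes {p..<p + r}}"
  have W1: "wedge_list \<alpha>s (map (\<lambda>i. vs ! \<pi> i) [0..<p]) =
      (\<Sum>\<sigma>\<in>?A. of_int (sign \<sigma>) * (\<Prod>i<p. g i (vs ! \<pi> (\<sigma> i))))" for \<pi>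
    unfolding wedge_list_def p
  proof (intro sum.cong refl arg_cong2[of _ _ _ _ "(*)"] prod.cong, elim CollectE)
    fix \<sigma> i assume "\<sigma> permutes {..<p}" "i \<in> {..<p}"
    then show "(\<alpha>s ! i) (map (\<lambda>i. vs ! \<pi> i) [0..<p] ! \<sigma> i) = g i (vs ! \<pi> (\<sigma> i))"
      using permutes_in_image[of \<sigma> "{..<p}" i] by (simp add: g_def p nth_append)
  qed
  have W2: "wedge_list \<beta>s (map (\<lambda>i. vs ! \<pi> i) [p..<p + r]) =
      (\<Sum>\<tau>\<in>?B. of_int (sign \<tau>) * (\<Prod>i\<in>{p..<p + r}. g i (vs ! \<pi> (\<tau> i))))" for \<pi>
    unfolding wedge_list_def r
  proof (rule sum.reindex_bij_witness[where j = "map_permutation {..<r} ((+) p)"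
        and i = "map_permutation {p..<p + r} (\<lambda>i. i - p)"])
    have bij: "bij_betw ((+) p) {..<r} {p..<p + r}"
      by (rule bij_betwI[where g = "\<lambda>i. i - p"]) auto
    have bij': "bij_betw (\<lambda>i. i - p) {p..<p + r} {..<r}"
      by (rule bij_betwI[where g = "(+) p"]) auto
    fix \<tau>
    {
      assume "\<tau> \<in> {\<pi>. \<pi> permutes {..<r}}"
      then have \<tau>: "\<tau> permutes {..<r}" by simp
      show "map_permutation {p..<p + r} (\<lambda>i. i - p) (map_permutation {..<r} ((+) p) \<tau>) = \<tau>"
        using map_permutation_compose[OF bij, of "\<lambda>i. i - p" \<tau>] \<tau> bij'
        by (simp add: bij_betw_def o_def)
      show "map_permutation {..<r} ((+) p) \<tau> \<in> ?B"
        using map_permutation_permutes[OF bij \<tau>] by simp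
      have "sign (map_permutation {..<r} ((+) p) \<tau>) = sign \<tau>"
        by (intro sign_map_permutation \<tau>) auto
      moreover have "(\<Prod>i\<in>{p..<p + r}. g i (vs ! \<pi> (map_permutation {..<r} ((+) p) \<tau> i))) =
          (\<Prod>i<r. g (p + i) (vs ! \<pi> (map_permutation {..<r} ((+) p) \<tau> (p + i))))"
        by (rule prod.reindex_bij_betw[OF bij, symmetric])
      moreover have "\<dots> = (\<Prod>i<r. (\<beta>s ! i) (map (\<lambda>i. vs ! \<pi> i) [p..<p + r] ! \<tau> i))"
      proof (intro prod.cong refl)
        fix i assume i: "i \<in> {..<r}"
        then have "map_permutation {..<r} ((+) p) \<tau> (p + i) = p + \<tau> i"
          by (intro map_permutation_apply) auto
        then show "g (p + i) (vs ! \<pi> (map_permutation {..<r} ((+) p) \<tau> (p + i))) =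
            (\<beta>s ! i) (map (\<lambda>i. vs ! \<pi> i) [p..<p + r] ! \<tau> i)"
          using permutes_in_image[OF \<tau>, of i] i by (simp add: g_def nth_append p)
      qed
      ultimately show "of_int (sign (map_permutation {..<r} ((+) p) \<tau>)) *
          (\<Prod>i\<in>{p..<p + r}. g i (vs ! \<pi> (map_permutation {..<r} ((+) p) \<tau> i))) =
          of_int (sign \<tau>) * (\<Prod>i<r. (\<beta>s ! i) (map (\<lambda>i. vs ! \<pi> i) [p..<p + r] ! \<tau> i))"
        by simp
    next
      assume "\<tau> \<in> ?B"
      then have \<tau>: "\<tau> permutes {p..<p + r}" by simp
      have "map_permutation {..<r} ((+) p) (map_permutation {p..<p + r} (\<lambda>i. i - p) \<tau>) =
          map_permutation {p..<p + r} ((+) p \<circ> (\<lambda>i. i - p)) \<tau>"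
        using bij by (intro map_permutation_compose[OF bij']) (auto simp: bij_betw_def)
      also have "\<dots> = map_permutation {p..<p + r} (\<lambda>i. i) \<tau>"
        by (rule map_permutation_cong[OF _ \<tau>]) (auto simp: inj_on_def)
      also have "\<dots> = \<tau>"
        using \<tau> by simp
      finally show "map_permutation {..<r} ((+) p) (map_permutation {p..<p + r} (\<lambda>i. i - p) \<tau>) = \<tau>" .
      show "map_permutation {p..<p + r} (\<lambda>i. i - p) \<tau> \<in> {\<pi>. \<pi> permutes {..<r}}"
        using map_permutation_permutes[OF bij' \<tau>] by simp
    }
  qed
  have combine: "of_int (sign \<pi>) * ((of_int (sign \<sigma>) * (\<Prod>i<p. g i (vs ! \<pi> (\<sigma> i)))) *
      (of_int (sign \<tau>) * (\<Prod>i\<in>{p..<p + r}. g i (vs ! \<pi> (\<tau> i))))) = F (\<pi> \<circ> (\<sigma> \<circ> \<tau>))"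
    if \<pi>: "\<pi> permutes {..<p + r}" and \<sigma>: "\<sigma> permutes {..<p}" and \<tau>: "\<tau> permutes {p..<p + r}" for \<pi> \<sigma> \<tau>
  proof -
    have perms: "permutation \<pi>" "permutation \<sigma>" "permutation \<tau>"
      using \<pi> \<sigma> \<tau> by (auto intro: permutes_imp_permutation[rotated])
    then have sgn: "sign (\<pi> \<circ> (\<sigma> \<circ> \<tau>)) = sign \<pi> * (sign \<sigma> * sign \<tau>)"
      by (simp add: sign_compose permutation_compose)
    have "{..<p + r} = {..<p} \<union> {p..<p + r}" by auto
    then have "(\<Prod>i<p + r. g i (vs ! (\<pi> \<circ> (\<sigma> \<circ> \<tau>)) i)) =
        (\<Prod>i<p. g i (vs ! (\<pi> \<circ> (\<sigma> \<circ> \<tau>)) i)) * (\<Prod>i\<in>{p..<p + r}. g i (vs ! (\<pi> \<circ> (\<sigma> \<circ> \<tau>)) i))"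
      by (simp add: prod.union_disjoint ivl_disj_int)
    also have "(\<Prod>i<p. g i (vs ! (\<pi> \<circ> (\<sigma> \<circ> \<tau>)) i)) = (\<Prod>i<p. g i (vs ! \<pi> (\<sigma> i)))"
      using permutes_not_in[OF \<tau>] by (intro prod.cong) auto
    also have "(\<Prod>i\<in>{p..<p + r}. g i (vs ! (\<pi> \<circ> (\<sigma> \<circ> \<tau>)) i)) = (\<Prod>i\<in>{p..<p + r}. g i (vs ! \<pi> (\<tau> i)))"
    proof (intro prod.cong refl)
      fix i assume "i \<in> {p..<p + r}"
      then have "\<tau> i \<notin> {..<p}"
        using permutes_in_image[OF \<tau>, of i] by simp
      then show "g i (vs ! (\<pi> \<circ> (\<sigma> \<circ> \<tau>)) i) = g i (vs ! \<pi> (\<tau> i))"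
        using permutes_not_in[OF \<sigma>] by simp
    qed
    finally show ?thesis
      by (simp add: F_def sgn)
  qed
  have "(\<Sum>\<pi> | \<pi> permutes {..<p + r}. of_int (sign \<pi>) *
      wedge_list \<alpha>s (map (\<lambda>i. vs ! \<pi> i) [0..<p]) * wedge_list \<beta>s (map (\<lambda>i. vs ! \<pi> i) [p..<p + r])) =
      (\<Sum>\<pi> | \<pi> permutes {..<p + r}. \<Sum>\<sigma>\<in>?A. \<Sum>\<tau>\<in>?B. F (\<pi> \<circ> (\<sigma> \<circ> \<tau>)))"
  proof (intro sum.cong refl, elim CollectE)
    fix \<pi> assume \<pi>: "\<pi> permutes {..<p + r}"
    show "of_int (sign \<pi>) * wedge_list \<alpha>s (map (\<lambda>i. vs ! \<pi> i) [0..<p]) *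
        wedge_list \<beta>s (map (\<lambda>i. vs ! \<pi> i) [p..<p + r]) = (\<Sum>\<sigma>\<in>?A. \<Sum>\<tau>\<in>?B. F (\<pi> \<circ> (\<sigma> \<circ> \<tau>)))"
      unfolding W1 W2 mult.assoc
      unfolding sum_product
      unfolding sum_distrib_left
      by (rule sum.cong[OF refl], rule sum.cong[OF refl])
        (use combine[OF \<pi>] in \<open>simp add: mult.assoc\<close>)
  qed
  also have "\<dots> = (\<Sum>\<sigma>\<in>?A. \<Sum>\<tau>\<in>?B. \<Sum>\<pi> | \<pi> permutes {..<p + r}. F (\<pi> \<circ> (\<sigma> \<circ> \<tau>)))"
    by (rule trans[OF sum.swap], rule sum.cong[OF refl], rule sum.swap)
  also have "\<dots> = (\<Sum>\<sigma>\<in>?A. \<Sum>\<tau>\<in>?B. \<Sum>\<pi> | \<pi> permutes {..<p + r}. F \<pi>)"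
  proof (rule sum.cong[OF refl], rule sum.cong[OF refl])
    fix \<sigma> \<tau> assume "\<sigma> \<in> ?A" "\<tau> \<in> ?B"
    then have "\<sigma> \<circ> \<tau> permutes {..<p + r}"
      by (intro permutes_compose; elim CollectE permutes_subset) auto
    from sum_permutations_compose_right[OF this, of F]
    show "(\<Sum>\<pi> | \<pi> permutes {..<p + r}. F (\<pi> \<circ> (\<sigma> \<circ> \<tau>))) = (\<Sum>\<pi> | \<pi> permutes {..<p + r}. F \<pi>)"
      by simp
  qed
  also have "\<dots> = fact p * fact r * wedge_list (\<alpha>s @ \<beta>s) vs"
    by (simp add: card_permutations[of _ p] card_permutations[of _ r] wedge_list_def F_def g_def p r)
  finally show ?thesis
    by (simp add: wedge_def)
qed

text \<open>If the 1-forms vanish on \<open>vs\<close>, only the permutations that preserve the two blocks contribute,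
  and all of them contribute the same.  For the comparison of two forms \<open>\<psi>\<close> it is enough that their
  number is positive, so it is left uncounted.\<close>

lemma wedge_on_block:
  assumes p: "length \<alpha>s = p" and alt: "alternating_form E r \<psi>"
    and lin: "\<And>\<alpha>. \<alpha> \<in> set \<alpha>s \<Longrightarrow> linear_on_affine_space E \<alpha>"
    and us: "length us = p" "set us \<subseteq> affine_space E"
    and vs: "length vs = r" "set vs \<subseteq> affine_space E"
    and zero: "\<And>\<alpha> v. \<alpha> \<in> set \<alpha>s \<Longrightarrow> v \<in> set vs \<Longrightarrow> \<alpha> v = 0"
  shows "wedge p r (wedge_list \<alpha>s) \<psi> (us @ vs) =
     of_nat (card {\<pi>. \<pi> permutes {..<p + r} \<and> \<pi> ` {..<p} \<subseteq> {..<p}}) / (fact p * fact r) *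
     (wedge_list \<alpha>s us * \<psi> vs)"
proof -
  define w where "w i = (us @ vs) ! i" for i
  let ?P = "{\<pi>. \<pi> permutes {..<p + r} \<and> \<pi> ` {..<p} \<subseteq> {..<p}}"
  define t where "t \<pi> = of_int (sign \<pi>) * wedge_list \<alpha>s (map (\<lambda>i. w (\<pi> i)) [0..<p]) *
    \<psi> (map (\<lambda>i. w (\<pi> i)) [p..<p + r])" for \<pi>
  have w_us: "map w [0..<p] = us" and w_vs: "map w [p..<p + r] = vs"
    using us vs by (auto simp: w_def nth_append intro!: nth_equalityI)
  have w_mem: "w i \<in> affine_space E" if "i < p + r" for i
    using that us vs by (auto simp: w_def nth_append)
  have t_zero: "t \<pi> = 0" if \<pi>: "\<pi> permutes {..<p + r}" and not: "\<pi> \<notin> ?P" for \<pi>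
  proof -
    obtain j where j: "j < p" "\<pi> j \<ge> p"
      using \<pi> not by (auto simp: subset_iff)
    then have "\<pi> j < p + r"
      using permutes_in_image[OF \<pi>, of j] by simp
    then have wj: "w (\<pi> j) \<in> set vs"
      using j us vs by (auto simp: w_def nth_append)
    have "(\<Prod>i<length \<alpha>s. (\<alpha>s ! i) (map (\<lambda>i. w (\<pi> i)) [0..<p] ! \<sigma> i)) = 0"
      if \<sigma>: "\<sigma> permutes {..<p}" for \<sigma>
    proof -
      define i where "i = inv \<sigma> j"
      have i: "i < p" "\<sigma> i = j"
        using j permutes_in_image[OF permutes_inv[OF \<sigma>], of j] permutes_inverses[OF \<sigma>]
        by (auto simp: i_def)
      then have "(\<alpha>s ! i) (map (\<lambda>i. w (\<pi> i)) [0..<p] ! \<sigma> i) = 0"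
        using zero[of "\<alpha>s ! i"] wj j p by simp
      then show ?thesis
        using i p by (intro prod_zero) auto
    qed
    then have "wedge_list \<alpha>s (map (\<lambda>i. w (\<pi> i)) [0..<p]) = 0"
      unfolding wedge_list_def p by (intro sum.neutral) auto
    then show ?thesis
      by (simp add: t_def)
  qed
  have t_block: "t \<pi> = wedge_list \<alpha>s us * \<psi> vs" if "\<pi> \<in> ?P" for \<pi>
  proof -
    from that have \<pi>: "\<pi> permutes {..<p + r}" and sub: "\<pi> ` {..<p} \<subseteq> {..<p}" by auto
    have inj: "inj \<pi>" using \<pi> by (rule permutes_inj)
    have eq: "\<pi> ` {..<p} = {..<p}"
      using sub inj by (intro endo_inj_surj) (auto intro: inj_on_subset)
    have ge: "p \<le> \<pi> i" if "p \<le> i" for i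
    proof (rule ccontr)
      assume "\<not> p \<le> \<pi> i"
      then have "\<pi> i \<in> \<pi> ` {..<p}" using eq by simp
      then obtain j where "j < p" "\<pi> i = \<pi> j" by auto
      then show False using injD[OF inj, of i j] that by simp
    qed
    define \<sigma> where "\<sigma> i = (if i < p then \<pi> i else i)" for i
    define \<tau> where "\<tau> i = (if i < p then i else \<pi> i)" for i
    have "bij_betw \<pi> {..<p} {..<p}"
      using inj eq by (auto simp: bij_betw_def intro: inj_on_subset)
    then have "bij_betw \<sigma> {..<p} {..<p}"
      by (subst bij_betw_cong[of _ _ \<pi>]) (auto simp: \<sigma>_def)
    then have \<sigma>: "\<sigma> permutes {..<p}"
      by (rule bij_imp_permutes) (auto simp: \<sigma>_def)
    have "\<pi> ` {p..<p + r} \<subseteq> {p..<p + r}"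
      using ge permutes_in_image[OF \<pi>] by auto
    then have "\<pi> ` {p..<p + r} = {p..<p + r}"
      using inj by (intro endo_inj_surj) (auto intro: inj_on_subset)
    then have "bij_betw \<pi> {p..<p + r} {p..<p + r}"
      using inj by (auto simp: bij_betw_def intro: inj_on_subset)
    then have "bij_betw \<tau> {p..<p + r} {p..<p + r}"
      by (subst bij_betw_cong[of _ _ \<pi>]) (auto simp: \<tau>_def)
    then have \<tau>: "\<tau> permutes {p..<p + r}"
    proof (rule bij_imp_permutes)
      show "\<tau> i = i" if "i \<notin> {p..<p + r}" for i
        using that permutes_not_in[OF \<pi>, of i] by (auto simp: \<tau>_def)
    qed
    have "\<pi> = \<sigma> \<circ> \<tau>"
      by (rule ext) (auto simp: \<sigma>_def \<tau>_def not_less dest: ge)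
    then have sgn: "sign \<pi> = sign \<sigma> * sign \<tau>"
      using \<sigma> \<tau> by (auto intro!: sign_compose intro: permutes_imp_permutation[rotated])
    have "wedge_list \<alpha>s (map (\<lambda>i. w (\<pi> i)) [0..<p]) = wedge_list \<alpha>s (map (\<lambda>i. w (\<sigma> i)) [0..<0 + p])"
      by (intro arg_cong[of _ _ "wedge_list \<alpha>s"]) (auto simp: \<sigma>_def)
    also have "\<dots> = of_int (sign \<sigma>) * wedge_list \<alpha>s (map w [0..<0 + p])"
      using \<sigma> alternating_form_wedge_list[OF lin] p
      by (intro alternating_form_permute) (auto simp: atLeast0LessThan w_mem)
    finally have 1: "wedge_list \<alpha>s (map (\<lambda>i. w (\<pi> i)) [0..<p]) = of_int (sign \<sigma>) * wedge_list \<alpha>s us"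
      by (simp add: w_us)
    have "\<psi> (map (\<lambda>i. w (\<pi> i)) [p..<p + r]) = \<psi> (map (\<lambda>i. w (\<tau> i)) [p..<p + r])"
      by (intro arg_cong[of _ _ \<psi>]) (auto simp: \<tau>_def)
    also have "\<dots> = of_int (sign \<tau>) * \<psi> (map w [p..<p + r])"
      using \<tau> alt by (intro alternating_form_permute) (auto simp: w_mem)
    finally have 2: "\<psi> (map (\<lambda>i. w (\<pi> i)) [p..<p + r]) = of_int (sign \<tau>) * \<psi> vs"
      by (simp add: w_vs)
    have "complex_of_int (sign \<sigma>) * of_int (sign \<sigma>) = 1" "complex_of_int (sign \<tau>) * of_int (sign \<tau>) = 1"
      by (simp_all flip: of_int_mult)
    then show ?thesis
      by (simp add: t_def sgn 1 2 algebra_simps)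
  qed
  have "(\<Sum>\<pi> | \<pi> permutes {..<p + r}. t \<pi>) = (\<Sum>\<pi>\<in>?P. t \<pi>)"
    by (intro sum.mono_neutral_right finite_permutations) (use t_zero in auto)
  also have "\<dots> = of_nat (card ?P) * (wedge_list \<alpha>s us * \<psi> vs)"
    by (simp add: t_block)
  finally show ?thesis
    by (simp add: wedge_def t_def w_def)
qed

text \<open>The off-diagonal zeros leave only the identity permutation.\<close>

lemma wedge_list_dual_bases:
  assumes dual: "\<And>i k. i < length \<alpha>s \<Longrightarrow> k < length \<alpha>s \<Longrightarrow> (\<alpha>s ! i) (vs ! k) = c * of_bool (i = k)"
  shows "wedge_list \<alpha>s vs = c ^ length \<alpha>s"
proof -
  have "of_int (sign \<pi>) * (\<Prod>i<length \<alpha>s. (\<alpha>s ! i) (vs ! \<pi> i)) = (if \<pi> = id then c ^ length \<alpha>s else 0)"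
    if \<pi>: "\<pi> permutes {..<length \<alpha>s}" for \<pi>
  proof (cases "\<pi> = id")
    case False
    then obtain i where i: "i < length \<alpha>s" "\<pi> i \<noteq> i"
      using permutes_not_in[OF \<pi>] by (metis eq_id_iff lessThan_iff)
    then have "\<pi> i < length \<alpha>s"
      using permutes_in_image[OF \<pi>, of i] by simp
    then have "(\<alpha>s ! i) (vs ! \<pi> i) = 0"
      using i dual[of i "\<pi> i"] by simp
    then have "(\<Prod>i<length \<alpha>s. (\<alpha>s ! i) (vs ! \<pi> i)) = 0"
      using i by (intro prod_zero) auto
    then show ?thesis
      using False by simp
  qed (simp add: dual)
  then have "wedge_list \<alpha>s vs =
      (\<Sum>\<pi> | \<pi> permutes {..<length \<alpha>s}. if \<pi> = id then c ^ length \<alpha>s else 0)"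
    unfolding wedge_list_def by (intro sum.cong) simp_all
  also have "\<dots> = c ^ length \<alpha>s"
    by (subst sum.delta) (auto simp: finite_permutations permutes_id)
  finally show ?thesis .
qed

text \<open>This pins down the residue, which is defined by a choice: two forms with the same wedge product
  with the differentials agree on tangent vectors.  The reason is that the wedge product, evaluated
  on suitable vectors followed by tangent vectors, splits into two factors, of which the first is
  nonzero.\<close>

lemma residue_form_on_tangent_vectors:
  fixes es :: "'e list" and fs :: "(('e \<Rightarrow> complex) \<Rightarrow> complex) list"
  defines "p \<equiv> length fs" and "r \<equiv> length es - length fs" and "E \<equiv> set es"
  assumes es: "distinct es" and le: "length fs \<le> length es"
    and lin: "\<And>f. f \<in> set fs \<Longrightarrow> linear_on_affine_space E (diff1 f y)"
    and alt: "alternating_form E r \<psi>"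
    and wedge: "\<And>vs. length vs = length es \<Longrightarrow> set vs \<subseteq> affine_space E \<Longrightarrow>
        wedge p r (wedge_list (map (\<lambda>f. diff1 f y) fs)) \<psi> vs = wedge_list (map (\<lambda>e v. v e) es) vs"
    and vs: "length vs = r" "set vs \<subseteq> affine_space E"
    and tangent: "\<And>f v. f \<in> set fs \<Longrightarrow> v \<in> set vs \<Longrightarrow> diff1 f y v = 0"
  shows "residue_form es fs y vs = \<psi> vs"
proof -
  define \<alpha>s where "\<alpha>s = map (\<lambda>f. diff1 f y) fs"
  define \<phi> where "\<phi> = residue_form es fs y"
  have "\<exists>\<psi>. alternating_form E r \<psi> \<and> (\<forall>vs. length vs = length es \<and> set vs \<subseteq> affine_space E \<longrightarrow>
      wedge p r (wedge_list \<alpha>s) \<psi> vs = wedge_list (map (\<lambda>e v. v e) es) vs)"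
    using alt wedge unfolding \<alpha>s_def by blast
  from someI_ex[OF this]
  have \<phi>: "alternating_form E r \<phi>" "\<And>vs. length vs = length es \<Longrightarrow> set vs \<subseteq> affine_space E \<Longrightarrow>
      wedge p r (wedge_list \<alpha>s) \<phi> vs = wedge_list (map (\<lambda>e v. v e) es) vs"
    unfolding \<phi>_def residue_form_def \<alpha>s_def p_def r_def E_def by blast+
  \<comment> \<open>The volume form is 1 on the standard basis, so some term of the wedge product is nonzero there
    and provides the vectors for the first factor.\<close>
  define ws :: "('e \<Rightarrow> complex) list" where "ws = map (\<lambda>e e'. of_bool (e' = e)) es"
  have ws: "length ws = length es" "set ws \<subseteq> affine_space E"
    by (auto simp: ws_def affine_space_def E_def)
  have "wedge p r (wedge_list \<alpha>s) \<psi> ws = 1"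
    using wedge[OF ws] wedge_list_dual_bases[of "map (\<lambda>e v. v e) es" ws 1] es
    by (simp add: \<alpha>s_def ws_def nth_eq_iff_index_eq)
  then have "\<exists>\<pi>. \<pi> permutes {..<p + r} \<and> wedge_list \<alpha>s (map (\<lambda>i. ws ! \<pi> i) [0..<p]) \<noteq> 0"
    unfolding wedge_def by (rule contrapos_pp) (simp add: sum.neutral)
  then obtain \<pi> where \<pi>: "\<pi> permutes {..<p + r}"
    and nz: "wedge_list \<alpha>s (map (\<lambda>i. ws ! \<pi> i) [0..<p]) \<noteq> 0" by blast
  define us where "us = map (\<lambda>i. ws ! \<pi> i) [0..<p]"
  have pr: "p + r = length es"
    using le by (simp add: p_def r_def)
  have us: "length us = p" "set us \<subseteq> affine_space E"
    using ws permutes_in_image[OF \<pi>] pr by (auto simp: us_def subset_iff)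
  have "id \<in> {\<pi>. \<pi> permutes {..<p + r} \<and> \<pi> ` {..<p} \<subseteq> {..<p}}"
    by (simp add: permutes_id)
  moreover have "finite {\<pi>. \<pi> permutes {..<p + r} \<and> \<pi> ` {..<p} \<subseteq> {..<p}}"
    by (rule finite_subset[OF _ finite_permutations[of "{..<p + r}"]]) auto
  ultimately have card: "card {\<pi>. \<pi> permutes {..<p + r} \<and> \<pi> ` {..<p} \<subseteq> {..<p}} \<noteq> 0"
    by (metis card_eq_0_iff empty_iff)
  have block: "wedge p r (wedge_list \<alpha>s) \<xi> (us @ vs) =
      of_nat (card {\<pi>. \<pi> permutes {..<p + r} \<and> \<pi> ` {..<p} \<subseteq> {..<p}}) / (fact p * fact r) *
      (wedge_list \<alpha>s us * \<xi> vs)" if "alternating_form E r \<xi>" for \<xi>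
    using that us vs lin tangent
    by (intro wedge_on_block[where E = E]) (auto simp: \<alpha>s_def p_def)
  have "wedge p r (wedge_list \<alpha>s) \<phi> (us @ vs) = wedge p r (wedge_list \<alpha>s) \<psi> (us @ vs)"
    using \<phi>(2)[of "us @ vs"] wedge[of "us @ vs"] us vs pr by (simp add: \<alpha>s_def)
  then have "\<phi> vs = \<psi> vs"
    using nz card by (simp add: block \<phi>(1) alt us_def[symmetric])
  then show ?thesis by (simp add: \<phi>_def)
qed

section \<open>Fourier modes and multiple exponential series\<close>

text \<open>A finite set of families is contained in a finite product of sets, where the sum factors.\<close>

lemma abs_summable_on_prod_PiE:
  fixes f :: "'a \<Rightarrow> 'b \<Rightarrow> 'c :: {banach, real_normed_field}"
  assumes A: "finite A" and f: "\<And>x. x \<in> A \<Longrightarrow> (\<lambda>y. norm (f x y)) summable_on B x"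
  shows "(\<lambda>g. norm (\<Prod>x\<in>A. f x (g x))) summable_on PiE A B"
proof (rule nonneg_bdd_above_summable_on)
  show "bdd_above (sum (\<lambda>g. norm (\<Prod>x\<in>A. f x (g x))) ` {F. F \<subseteq> PiE A B \<and> finite F})"
  proof (rule bdd_aboveI2)
    fix F assume "F \<in> {F. F \<subseteq> PiE A B \<and> finite F}"
    then have F: "F \<subseteq> PiE A B" "finite F" by auto
    define B' where "B' x = (\<lambda>g. g x) ` F" for x
    have "(\<Sum>g\<in>F. norm (\<Prod>x\<in>A. f x (g x))) \<le> (\<Sum>g\<in>PiE A B'. \<Prod>x\<in>A. norm (f x (g x)))"
      unfolding prod_norm[symmetric]
      using F A by (intro sum_mono2 finite_PiE) (auto simp: B'_def prod_nonneg)
    also have "\<dots> = (\<Prod>x\<in>A. \<Sum>y\<in>B' x. norm (f x y))"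
      using F A by (subst prod_sum_PiE) (auto simp: B'_def)
    also have "\<dots> \<le> (\<Prod>x\<in>A. infsum (\<lambda>y. norm (f x y)) (B x))"
      using F f by (intro prod_mono conjI sum_nonneg finite_sum_le_infsum) (auto simp: B'_def)
    finally show "(\<Sum>g\<in>F. norm (\<Prod>x\<in>A. f x (g x))) \<le> \<dots>" .
  qed
qed auto

lemma summable_norm_exp_series: "summable (\<lambda>n. norm (z ^ n / fact n))" for z :: complex
  using summable_norm_exp[of z]
  by (simp add: scaleR_conv_of_real divide_inverse norm_mult norm_power norm_inverse mult.commute)

lemma exp_series_abs_summable: "(\<lambda>n. norm (z ^ n / fact n)) summable_on (UNIV :: nat set)" for z :: complex
  using norm_summable_imp_summable_on[of "\<lambda>n. norm (z ^ n / fact n)"] summable_norm_exp_series[of z]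
  by simp

lemma exp_sum_multiseries_abs_summable:
  fixes z :: "'e \<Rightarrow> complex"
  assumes "finite E"
  shows "(\<lambda>n. norm (\<Prod>e\<in>E. z e ^ n e / fact (n e))) summable_on PiE E (\<lambda>_. UNIV)"
  by (intro abs_summable_on_prod_PiE assms exp_series_abs_summable)

lemma exp_sum_multiseries:
  fixes z :: "'e \<Rightarrow> complex"
  assumes E: "finite E"
  shows "((\<lambda>n. \<Prod>e\<in>E. z e ^ n e / fact (n e)) has_sum exp (\<Sum>e\<in>E. z e)) (PiE E (\<lambda>_. UNIV))"
proof -
  have exp: "infsum (\<lambda>n. z ^ n / fact n) (UNIV :: nat set) = exp z" for z :: complex
  proof (rule infsumI, rule norm_summable_imp_has_sum[OF summable_norm_exp_series])
    show "(\<lambda>n. z ^ n / fact n) sums exp z"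
      using exp_converges[of z] by (simp add: scaleR_conv_of_real divide_inverse mult.commute)
  qed
  have "infsum (\<lambda>n. \<Prod>e\<in>E. z e ^ n e / fact (n e)) (PiE E (\<lambda>_. UNIV)) = (\<Prod>e\<in>E. exp (z e))"
    by (subst infsum_prod_PiE_abs[OF E exp_series_abs_summable]) (simp add: exp)
  also have "\<dots> = exp (\<Sum>e\<in>E. z e)"
    using E by (simp add: exp_sum)
  finally show ?thesis
    using has_sum_infsum[OF abs_summable_summable[OF exp_sum_multiseries_abs_summable[OF E, of z]]] by simp
qed

text \<open>Dominated convergence along finite subsets of an arbitrary index set.  On a set of finite measure
  the uniform bound on the tails gives the convergence directly, without choosing a sequence.\<close>

lemma has_sum_set_integral:
  fixes t :: "'n \<Rightarrow> 'a \<Rightarrow> complex"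
  assumes A: "A \<in> sets M" "emeasure M A < \<infinity>"
    and t: "\<And>n. n \<in> S \<Longrightarrow> t n \<in> borel_measurable M" and f: "f \<in> borel_measurable M"
    and bound: "\<And>n x. n \<in> S \<Longrightarrow> x \<in> A \<Longrightarrow> norm (t n x) \<le> b n" and b: "b summable_on S"
    and sum: "\<And>x. x \<in> A \<Longrightarrow> ((\<lambda>n. t n x) has_sum f x) S"
  shows "((\<lambda>n. set_lebesgue_integral M A (t n)) has_sum set_lebesgue_integral M A f) S"
proof -
  have integrable: "set_integrable M A g"
    if "g \<in> borel_measurable M" "\<And>x. x \<in> A \<Longrightarrow> norm (g x) \<le> B" for g :: "'a \<Rightarrow> complex" and B
    unfolding set_integrable_def using that A
    by (intro integrableI_bounded_set[where A = A and B = B]) auto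
  have tail: "norm (f x - (\<Sum>n\<in>X. t n x)) \<le> infsum b S - sum b X"
    if x: "x \<in> A" and X: "finite X" "X \<subseteq> S" for x X
  proof -
    have bX: "(b has_sum (infsum b S - sum b X)) (S - X)"
      using b X by (intro has_sum_Diff has_sum_infsum has_sum_finite) auto
    have norm_summable: "(\<lambda>n. norm (t n x)) summable_on (S - X)"
      using bX bound[OF _ x]
      by (intro summable_on_comparison_test[of b "S - X" "\<lambda>n. norm (t n x)"]) (auto simp: has_sum_imp_summable)
    have "((\<lambda>n. t n x) has_sum (f x - (\<Sum>n\<in>X. t n x))) (S - X)"
      using sum[OF x] X by (intro has_sum_Diff has_sum_finite) auto
    then have "norm (f x - (\<Sum>n\<in>X. t n x)) \<le> infsum (\<lambda>n. norm (t n x)) (S - X)"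
      by (rule norm_has_sum_bound[OF has_sum_infsum[OF norm_summable]])
    also have "\<dots> \<le> infsum b S - sum b X"
      by (rule has_sum_mono[OF has_sum_infsum[OF norm_summable] bX]) (use bound[OF _ x] in auto)
    finally show ?thesis .
  qed
  have int_t: "set_integrable M A (t n)" if "n \<in> S" for n
    using t that bound by (intro integrable) auto
  have int_f: "set_integrable M A f"
    using f tail[of _ "{}"] by (intro integrable[where B = "infsum b S"]) auto
  have close: "norm ((\<Sum>n\<in>X. set_lebesgue_integral M A (t n)) - set_lebesgue_integral M A f)
      \<le> measure M A * (infsum b S - sum b X)"
    if X: "finite X" "X \<subseteq> S" for X
  proof -
    have int_X: "set_integrable M A (\<lambda>x. \<Sum>n\<in>X. t n x)"
      using X int_t unfolding set_integrable_def scaleR_sum_right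
      by (intro Bochner_Integration.integrable_sum) blast
    define C where "C = infsum b S - sum b X"
    have const: "set_integrable M A (\<lambda>x. C)"
      using A unfolding set_integrable_def by simp
    have "(\<Sum>n\<in>X. set_lebesgue_integral M A (t n)) = set_lebesgue_integral M A (\<lambda>x. \<Sum>n\<in>X. t n x)"
      using X int_t unfolding set_lebesgue_integral_def set_integrable_def scaleR_sum_right
      by (intro Bochner_Integration.integral_sum[symmetric]) blast
    then have "norm ((\<Sum>n\<in>X. set_lebesgue_integral M A (t n)) - set_lebesgue_integral M A f) =
        norm (set_lebesgue_integral M A (\<lambda>x. f x - (\<Sum>n\<in>X. t n x)))"
      using int_X int_f by (simp add: norm_minus_commute)
    also have "\<dots> \<le> set_lebesgue_integral M A (\<lambda>x. norm (f x - (\<Sum>n\<in>X. t n x)))"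
      using int_X int_f by (intro set_integral_norm_bound set_integral_diff)
    also have "\<dots> \<le> set_lebesgue_integral M A (\<lambda>x. C)"
      using int_X int_f const tail[OF _ X, folded C_def]
      by (intro set_integral_mono set_integrable_norm set_integral_diff) auto
    also have "\<dots> = measure M A * (infsum b S - sum b X)"
      using A by (simp add: set_lebesgue_integral_def C_def)
    finally show ?thesis .
  qed
  have "((\<lambda>X. measure M A * (infsum b S - sum b X)) \<longlongrightarrow> measure M A * (infsum b S - infsum b S))
      (finite_subsets_at_top S)"
    using has_sum_infsum[OF b] unfolding has_sum_def by (intro tendsto_intros)
  then have lim: "((\<lambda>X. measure M A * (infsum b S - sum b X)) \<longlongrightarrow> 0) (finite_subsets_at_top S)"
    by simp
  have "((\<lambda>X. (\<Sum>n\<in>X. set_lebesgue_integral M A (t n)) - set_lebesgue_integral M A f) \<longlongrightarrow> 0)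
      (finite_subsets_at_top S)"
    by (rule Lim_null_comparison[OF eventually_finite_subsets_at_top_weakI lim]) (rule close)
  then show ?thesis
    unfolding has_sum_def by (rule LIM_zero_cancel)
qed

lemma integral_cis_period:
  fixes n :: int
  shows "set_lebesgue_integral lborel {0..2 * pi} (\<lambda>t. cis (of_int n * t)) = (if n = 0 then 2 * pi else 0)"
proof (cases "n = 0")
  case True
  then show ?thesis by (simp add: set_lebesgue_integral_def scaleR_conv_of_real)
next
  case False
  define F where "F t = cis (of_int n * t) / (\<i> * of_int n)" for t
  have "(F has_vector_derivative cis (of_int n * t)) (at t within {0..2 * pi})" for t
  proof -
    have "((\<lambda>z. exp (\<i> * of_int n * z) / (\<i> * of_int n)) has_field_derivative exp (\<i> * of_int n * of_real t))
        (at (of_real t))"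
      using False by (auto intro!: derivative_eq_intros)
    from has_vector_derivative_real_field[OF this]
    have "((\<lambda>t. exp (\<i> * of_int n * of_real t) / (\<i> * of_int n)) has_vector_derivative
        exp (\<i> * of_int n * of_real t)) (at t within {0..2 * pi})" .
    moreover have "exp (\<i> * of_int n * of_real t) = cis (of_int n * t)" for t
      by (simp add: cis_conv_exp mult.assoc)
    ultimately show ?thesis by (simp add: F_def[abs_def])
  qed
  then have "set_lebesgue_integral lborel {0..2 * pi} (\<lambda>t. cis (of_int n * t)) = F (2 * pi) - F 0"
    unfolding set_lebesgue_integral_def
    by (intro integral_FTC_atLeastAtMost) (auto intro!: continuous_intros)
  also have "F (2 * pi) = F 0"
    using cis_multiple_2pi[of "of_int n"] by (simp add: F_def mult.commute mult.left_commute)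
  finally show ?thesis using False by simp
qed

lemma emeasure_torus_box:
  assumes "finite G"
  shows "PiE G (\<lambda>_. {0..2 * pi}) \<in> sets (PiM G (\<lambda>_. lborel))"
    and "emeasure (PiM G (\<lambda>_. lborel)) (PiE G (\<lambda>_. {0..2 * pi})) < \<infinity>"
proof -
  interpret product_sigma_finite "\<lambda>_ :: 'a. lborel :: real measure"
    by standard
  show "PiE G (\<lambda>_. {0..2 * pi}) \<in> sets (PiM G (\<lambda>_. lborel))"
    using assms by (intro sets_PiM_I_finite) auto
  show "emeasure (PiM G (\<lambda>_. lborel)) (PiE G (\<lambda>_. {0..2 * pi})) < \<infinity>"
    using assms by (subst emeasure_PiM) (auto simp: power_less_top_ennreal)
qed

text \<open>The characters of the torus are orthogonal to the trivial one; by Fubini this follows from the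
  one-dimensional case.\<close>

lemma torus_integral_character:
  fixes n :: "'g \<Rightarrow> int"
  assumes G: "finite G"
  shows "set_lebesgue_integral (PiM G (\<lambda>_. lborel)) (PiE G (\<lambda>_. {0..2 * pi}))
      (\<lambda>\<theta>. exp (\<Sum>g\<in>G. \<i> * of_real (of_int (n g) * \<theta> g))) =
    (if \<forall>g\<in>G. n g = 0 then (2 * pi) ^ card G else 0)"
proof -
  interpret product_sigma_finite "\<lambda>_ :: 'g. lborel :: real measure"
    by standard
  define h where "h g t = indicator {0..2 * pi} t *\<^sub>R cis (of_int (n g) * t)" for g t
  have "set_lebesgue_integral (PiM G (\<lambda>_. lborel)) (PiE G (\<lambda>_. {0..2 * pi}))
      (\<lambda>\<theta>. exp (\<Sum>g\<in>G. \<i> * of_real (of_int (n g) * \<theta> g))) =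
      (\<integral>\<theta>. (\<Prod>g\<in>G. h g (\<theta> g)) \<partial>PiM G (\<lambda>_. lborel))"
    unfolding set_lebesgue_integral_def
  proof (intro Bochner_Integration.integral_cong refl)
    fix \<theta> :: "'g \<Rightarrow> real" assume "\<theta> \<in> space (PiM G (\<lambda>_. lborel))"
    then have "\<theta> \<in> extensional G"
      by (simp add: space_PiM PiE_def)
    then have "indicator (PiE G (\<lambda>_. {0..2 * pi})) \<theta> = (\<Prod>g\<in>G. indicator {0..2 * pi} (\<theta> g) :: real)"
      using G by (auto simp: indicator_def PiE_iff prod_zero_iff)
    moreover have "exp (\<Sum>g\<in>G. \<i> * of_real (of_int (n g) * \<theta> g)) = (\<Prod>g\<in>G. cis (of_int (n g) * \<theta> g))"
      using G by (simp add: exp_sum cis_conv_exp)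
    ultimately show "indicator (PiE G (\<lambda>_. {0..2 * pi})) \<theta> *\<^sub>R exp (\<Sum>g\<in>G. \<i> * of_real (of_int (n g) * \<theta> g)) =
        (\<Prod>g\<in>G. h g (\<theta> g))"
      by (simp add: h_def scaleR_conv_of_real prod.distrib)
  qed
  also have "\<dots> = (\<Prod>g\<in>G. integral\<^sup>L lborel (h g))"
  proof (rule product_integral_prod[OF G])
    fix g
    have [measurable]: "(\<lambda>t. cis (of_int (n g) * t)) \<in> borel_measurable borel"
      by (intro borel_measurable_continuous_onI continuous_intros)
    show "integrable lborel (h g)"
      unfolding h_def by (intro integrableI_bounded_set[where A = "{0..2 * pi}" and B = 1]) auto
  qed
  also have "\<dots> = (\<Prod>g\<in>G. if n g = 0 then 2 * pi else 0)"
    unfolding h_def integral_cis_period[unfolded set_lebesgue_integral_def] by simp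
  also have "\<dots> = (if \<forall>g\<in>G. n g = 0 then (2 * pi) ^ card G else 0)"
  proof (cases "\<forall>g\<in>G. n g = 0")
    case False
    then have "\<exists>g\<in>G. (if n g = 0 then 2 * pi else 0) = 0" by auto
    then show ?thesis using False G prod_zero by auto
  qed simp
  finally show ?thesis by simp
qed

section \<open>Systems of cycles with a triangular incidence structure\<close>

lemma has_field_derivative_prod_line:
  fixes y v :: "'e \<Rightarrow> complex"
  assumes "finite A" "\<And>e. e \<in> A \<Longrightarrow> y e \<noteq> 0"
  shows "((\<lambda>t. \<Prod>e\<in>A. y e + t * v e) has_field_derivative prod y A * (\<Sum>e\<in>A. v e / y e)) (at 0)"
  using assms
proof (induction A rule: finite_induct)
  case (insert a A)
  then have "((\<lambda>t. (y a + t * v a) * (\<Prod>e\<in>A. y e + t * v e)) has_field_derivative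
      v a * (\<Prod>e\<in>A. y e + 0 * v e) + (prod y A * (\<Sum>e\<in>A. v e / y e)) * (y a + 0 * v a)) (at 0)"
    by (intro DERIV_mult) (auto intro!: derivative_eq_intros)
  moreover have "v a * (\<Prod>e\<in>A. y e + 0 * v e) + (prod y A * (\<Sum>e\<in>A. v e / y e)) * (y a + 0 * v a) =
      prod y (insert a A) * (\<Sum>e\<in>insert a A. v e / y e)"
    using insert by (simp add: field_simps)
  ultimately show ?case
    using insert.hyps by (simp del: prod.insert sum.insert add: prod.insert[of A])
qed simp

text \<open>The combinatorial core.  For every edge \<open>e\<close> the indices \<open>H e\<close> and \<open>T e\<close> are the two ends of
  the segment that crosses \<open>e\<close>, \<open>z\<close> is the index zero, and \<open>omit j\<close> is the omitted edge with head
  \<open>j\<close>.  The rank expresses triangularity: segments lead upwards.\<close>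

locale cycle_system =
  fixes E :: "'e set" and J :: "'j set" and H T :: "'e \<Rightarrow> 'j" and z :: 'j
    and rank :: "'j \<Rightarrow> nat" and omit :: "'j \<Rightarrow> 'e"
  assumes finite_E: "finite E" and finite_J: "finite J" and z_notin: "z \<notin> J"
    and H_in: "e \<in> E \<Longrightarrow> H e \<in> J" and T_in: "e \<in> E \<Longrightarrow> T e \<in> insert z J"
    and rank_less: "e \<in> E \<Longrightarrow> rank (T e) < rank (H e)"
    and omit_in: "j \<in> J \<Longrightarrow> omit j \<in> E" and H_omit: "j \<in> J \<Longrightarrow> H (omit j) = j"
begin

text \<open>The edges that are kept; they serve as coordinates.\<close>

definition G where "G = E - omit ` J"
definition heads where "heads j = {e \<in> E. H e = j}"
definition tails where "tails j = {e \<in> E. T e = j}"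

lemma finite_G: "finite G" and finite_heads: "finite (heads j)" and finite_tails: "finite (tails j)"
  using finite_E by (auto simp: G_def heads_def tails_def)

lemma G_subset: "G \<subseteq> E"
  by (auto simp: G_def)

lemma omit_notin_G: "j \<in> J \<Longrightarrow> omit j \<notin> G"
  by (auto simp: G_def)

lemma inj_on_omit: "inj_on omit J"
  using H_omit by (metis inj_onI)

lemma E_cases:
  assumes "e \<in> E"
  obtains "e \<in> G" | "e = omit (H e)"
  using assms H_omit by (metis DiffI G_def imageE)

lemma E_eq: "E = omit ` J \<union> G"
  using omit_in by (auto simp: G_def)

lemma heads_eq: "j \<in> J \<Longrightarrow> heads j = insert (omit j) {g \<in> G. H g = j}"
  using omit_in H_omit by (auto simp: heads_def G_def)

lemma sum_heads:
  "j \<in> J \<Longrightarrow> sum x (heads j) = x (omit j) + sum x {g \<in> G. H g = j}"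
  for x :: "'e \<Rightarrow> 'a::comm_monoid_add"
  using finite_G omit_notin_G by (simp add: heads_eq)

lemma prod_heads:
  "j \<in> J \<Longrightarrow> prod x (heads j) = x (omit j) * prod x {g \<in> G. H g = j}"
  for x :: "'e \<Rightarrow> 'a::comm_monoid_mult"
  using finite_G omit_notin_G by (simp add: heads_eq)

lemma rank_tails: "e \<in> tails j \<Longrightarrow> rank j < rank (H e)"
  using rank_less by (auto simp: tails_def)

text \<open>The value at \<open>j\<close> is computed from an index of smaller rank.\<close>

lemma potential_exists:
  fixes x :: "'e \<Rightarrow> 'a::comm_monoid_add"
  shows "\<exists>m. (\<forall>j. j \<notin> J \<longrightarrow> m j = 0) \<and> (\<forall>j\<in>J. m j = x (omit j) + m (T (omit j)))"
proof -
  have "\<exists>m. (\<forall>j. j \<notin> J \<longrightarrow> m j = 0) \<and> (\<forall>j\<in>J. rank j < r \<longrightarrow> m j = x (omit j) + m (T (omit j)))" for r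
  proof (induction r)
    case 0
    show ?case by (intro exI[of _ "\<lambda>_. 0"]) simp
  next
    case (Suc r)
    then obtain m where m: "\<forall>j. j \<notin> J \<longrightarrow> m j = 0"
      "\<forall>j\<in>J. rank j < r \<longrightarrow> m j = x (omit j) + m (T (omit j))" by blast
    define m' where "m' j = (if j \<in> J \<and> rank j = r then x (omit j) + m (T (omit j)) else m j)" for j
    have keep: "m' (T (omit j)) = m (T (omit j))" if "j \<in> J" "rank j < Suc r" for j
      using rank_less[OF omit_in[OF that(1)]] H_omit[OF that(1)] that(2) by (simp add: m'_def)
    show ?case
      using m keep by (intro exI[of _ m']) (auto simp: m'_def less_Suc_eq)
  qed
  from this[of "Suc (Max (rank ` J))"] show ?thesis
    using finite_J by (auto simp: less_Suc_eq_le)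
qed

lemma potential_unique:
  fixes x :: "'e \<Rightarrow> 'a::comm_monoid_add"
  assumes "\<And>j. j \<notin> J \<Longrightarrow> m j = m' j"
    and "\<And>j. j \<in> J \<Longrightarrow> m j = x (omit j) + m (T (omit j))" and "\<And>j. j \<in> J \<Longrightarrow> m' j = x (omit j) + m' (T (omit j))"
  shows "m = m'"
proof
  fix j show "m j = m' j"
  proof (induction "rank j" arbitrary: j rule: less_induct)
    case less
    show ?case
    proof (cases "j \<in> J")
      case True
      then have "m (T (omit j)) = m' (T (omit j))"
        using less[of "T (omit j)"] rank_less[OF omit_in[OF True]] H_omit[OF True] by simp
      then show ?thesis using assms(2,3)[OF True] by simp
    qed (use assms(1) in simp)
  qed
qed

text \<open>The value at an omitted edge is computed from kept edges with the same head and from tails,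
  which have heads of larger rank; so the recursion runs downwards from the maximal rank.  This one
  additive statement yields both the logarithms of the constants and the exponents in the
  parametrization of the torus.\<close>

lemma relations_solvable:
  fixes L :: "'j \<Rightarrow> 'a::ab_group_add" and u :: "'e \<Rightarrow> 'a"
  shows "\<exists>x. (\<forall>g\<in>G. x g = u g) \<and> (\<forall>j\<in>J. sum x (heads j) = L j + sum x (tails j))"
proof -
  \<comment> \<open>The induction on \<open>r\<close> treats the indices of rank at least \<open>K - r\<close>.\<close>
  define K where "K = Suc (Max (rank ` J))"
  have K: "rank j < K" if "j \<in> J" for j
    using that finite_J by (auto simp: K_def less_Suc_eq_le)
  have "\<exists>x. (\<forall>g\<in>G. x g = u g) \<and>
      (\<forall>j\<in>J. K \<le> rank j + r \<longrightarrow> sum x (heads j) = L j + sum x (tails j))" for r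
  proof (induction r)
    case 0
    show ?case
      by (rule exI[of _ u]) (use K in \<open>auto simp: not_le[symmetric]\<close>)
  next
    case (Suc r)
    then obtain x where x: "\<forall>g\<in>G. x g = u g"
      "\<forall>j\<in>J. K \<le> rank j + r \<longrightarrow> sum x (heads j) = L j + sum x (tails j)" by blast
    define new where "new e \<longleftrightarrow> e \<in> omit ` J \<and> K = rank (H e) + Suc r" for e
    define x' where "x' e = (if new e
      then L (H e) + sum x (tails (H e)) - sum u {g \<in> G. H g = H e} else x e)" for e
    have x'G: "x' g = u g" if "g \<in> G" for g
      using that x(1) by (auto simp: x'_def new_def G_def)
    have tails: "sum x' (tails j) = sum x (tails j)" if "K \<le> rank j + Suc r" for j
    proof (rule sum.cong[OF refl])
      fix e assume "e \<in> tails j"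
      from rank_tails[OF this] that show "x' e = x e" by (simp add: x'_def new_def)
    qed
    have "sum x' (heads j) = L j + sum x' (tails j)" if j: "j \<in> J" and le: "K \<le> rank j + Suc r" for j
    proof (cases "K = rank j + Suc r")
      case True
      have "sum x' (heads j) = x' (omit j) + sum u {g \<in> G. H g = j}"
        unfolding sum_heads[OF j] by (intro arg_cong2[of _ _ _ _ "(+)"] sum.cong) (auto simp: x'G)
      also have "\<dots> = L j + sum x (tails j)"
        using j True by (simp add: x'_def new_def H_omit)
      finally show ?thesis by (simp add: tails[OF le])
    next
      case False
      then have "sum x' (heads j) = sum x (heads j)"
        by (intro sum.cong) (auto simp: x'_def new_def heads_def)
      then show ?thesis using x(2) j False le by (simp add: tails[OF le])
    qed
    then show ?case using x'G by (intro exI[of _ x']) auto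
  qed
  from this[of K] show ?thesis by auto
qed

text \<open>The same downward recursion determines the coordinates at omitted edges, since the kept
  coordinates can be cancelled.\<close>

lemma multiplicative_solution_unique:
  fixes y y' Q :: "_ \<Rightarrow> 'a::field"
  assumes y: "\<And>j. j \<in> J \<Longrightarrow> prod y (heads j) = Q j * prod y (tails j)"
    and y': "\<And>j. j \<in> J \<Longrightarrow> prod y' (heads j) = Q j * prod y' (tails j)"
    and G: "\<And>g. g \<in> G \<Longrightarrow> y g = y' g" "\<And>g. g \<in> G \<Longrightarrow> y g \<noteq> 0"
    and e: "e \<in> E"
  shows "y e = y' e"
  using e
proof (induction "Max (rank ` J) - rank (H e)" arbitrary: e rule: less_induct)
  case less
  from less.prems show ?case
  proof (cases rule: E_cases)
    case 1
    then show ?thesis by (rule G)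
  next
    case 2
    define j where "j = H e"
    have j: "j \<in> J" using less.prems H_in by (simp add: j_def)
    have "y e' = y' e'" if e': "e' \<in> tails j" for e'
    proof (rule less.hyps)
      have "rank (H e') \<le> Max (rank ` J)"
        using e' finite_J H_in by (auto simp: tails_def)
      then show "Max (rank ` J) - rank (H e') < Max (rank ` J) - rank (H e)"
        using rank_tails[OF e'] by (simp add: j_def)
      show "e' \<in> E" using e' by (simp add: tails_def)
    qed
    then have "prod y (tails j) = prod y' (tails j)"
      by (intro prod.cong) auto
    then have "prod y (heads j) = prod y' (heads j)"
      using y y' j by simp
    moreover have "prod y {g \<in> G. H g = j} = prod y' {g \<in> G. H g = j}"
      using G by (intro prod.cong) auto
    moreover have "prod y {g \<in> G. H g = j} \<noteq> 0"
      using G finite_G by simp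
    ultimately have "y (omit j) = y' (omit j)"
      by (simp add: prod_heads[OF j])
    then show ?thesis using 2 by (simp add: j_def)
  qed
qed

text \<open>Below \<open>j\<close> the potential vanishes by upward recursion, so both \<open>m j\<close> and the difference along
  any edge with head \<open>j\<close> equal the prescribed positive value.\<close>

lemma potential_positive:
  fixes m :: "'j \<Rightarrow> real"
  assumes m0: "m z = 0" and j: "j \<in> J"
    and other: "\<And>i. i \<in> J \<Longrightarrow> i \<noteq> j \<Longrightarrow> m i = m (T (omit i))"
    and mj: "m j - m (T (omit j)) > 0"
    and f: "f \<in> E" "H f = j"
  shows "m (H f) - m (T f) > 0"
proof -
  have zero: "m i = 0" if "i \<in> insert z J" "rank i < rank j" for i
    using that
  proof (induction "rank i" arbitrary: i rule: less_induct)
    case less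
    show ?case
    proof (cases "i = z")
      case False
      then have i: "i \<in> J" "i \<noteq> j" using less.prems by auto
      have "rank (T (omit i)) < rank i"
        using rank_less[OF omit_in[OF i(1)]] H_omit[OF i(1)] by simp
      then have "m (T (omit i)) = 0"
        using less.prems T_in[OF omit_in[OF i(1)]] by (intro less.hyps) auto
      then show ?thesis using other[OF i] by simp
    qed (use m0 in simp)
  qed
  have "m (T (omit j)) = 0"
    using zero[OF T_in[OF omit_in[OF j]]] rank_less[OF omit_in[OF j]] H_omit[OF j] by simp
  moreover have "m (T f) = 0"
    using zero[OF T_in[OF f(1)]] rank_less[OF f(1)] f(2) by simp
  ultimately show ?thesis using mj f by simp
qed

text \<open>Summation by parts along the incidence between edges and indices.\<close>

lemma sum_potential_differences:
  fixes x m :: "_ \<Rightarrow> 'a::comm_ring_1"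
  assumes "m z = 0" and "\<And>j. j \<in> J \<Longrightarrow> sum x (heads j) = L j + sum x (tails j)"
  shows "(\<Sum>e\<in>E. (m (H e) - m (T e)) * x e) = (\<Sum>j\<in>J. m j * L j)"
proof -
  have "(\<Sum>e\<in>E. m (H e) * x e) = (\<Sum>j\<in>J. \<Sum>e\<in>heads j. m (H e) * x e)"
    unfolding heads_def using finite_E finite_J H_in by (intro sum.group[symmetric]) auto
  also have "\<dots> = (\<Sum>j\<in>J. m j * sum x (heads j))"
    unfolding sum_distrib_left by (intro sum.cong) (auto simp: heads_def)
  finally have 1: "(\<Sum>e\<in>E. m (H e) * x e) = (\<Sum>j\<in>J. m j * sum x (heads j))" .
  have "(\<Sum>e\<in>E. m (T e) * x e) = (\<Sum>j\<in>insert z J. \<Sum>e\<in>tails j. m (T e) * x e)"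
    unfolding tails_def using finite_E finite_J T_in by (intro sum.group[symmetric]) auto
  also have "\<dots> = (\<Sum>j\<in>insert z J. m j * sum x (tails j))"
    unfolding sum_distrib_left by (intro sum.cong) (auto simp: tails_def)
  also have "\<dots> = (\<Sum>j\<in>J. m j * sum x (tails j))"
    using finite_J z_notin assms(1) by simp
  finally have 2: "(\<Sum>e\<in>E. m (T e) * x e) = (\<Sum>j\<in>J. m j * sum x (tails j))" .
  have "(\<Sum>e\<in>E. (m (H e) - m (T e)) * x e) = (\<Sum>j\<in>J. m j * sum x (heads j) - m j * sum x (tails j))"
    by (simp add: left_diff_distrib sum_subtractf 1 2)
  also have "\<dots> = (\<Sum>j\<in>J. m j * L j)"
    by (intro sum.cong) (simp_all add: assms(2) algebra_simps)
  finally show ?thesis .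
qed

text \<open>The exponent of a kept coordinate after the relations have been used to remove the omitted
  coordinates from a monomial.\<close>

definition charge :: "('e \<Rightarrow> nat) \<Rightarrow> ('j \<Rightarrow> nat) \<Rightarrow> 'e \<Rightarrow> int" where
  "charge n m e = int (n e) - (int (m (H e)) - int (m (T e)))"

text \<open>Taking logarithms, summation by parts replaces the part \<open>m\<^sub>H - m\<^sub>T\<close> of the exponents by the
  parameters.  The rest of the exponents vanishes at omitted edges by the choice of \<open>m\<close>.\<close>

lemma monomial_on_torus:
  fixes x :: "'e \<Rightarrow> complex"
  assumes x: "\<And>j. j \<in> J \<Longrightarrow> sum x (heads j) = L j + sum x (tails j)"
    and m: "m z = 0" "\<And>j. j \<in> J \<Longrightarrow> m j = n (omit j) + m (T (omit j))"
  shows "(\<Prod>e\<in>E. exp (x e) ^ n e) = (\<Prod>j\<in>J. exp (L j) ^ m j) * exp (\<Sum>g\<in>G. of_int (charge n m g) * x g)"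
proof -
  have om0: "charge n m (omit j) = 0" if "j \<in> J" for j
    using m(2)[OF that] H_omit[OF that] by (simp add: charge_def)
  have "(\<Sum>e\<in>E. of_nat (n e) * x e) = (\<Sum>e\<in>E. (of_nat (m (H e)) - of_nat (m (T e))) * x e) +
      (\<Sum>e\<in>E. of_int (charge n m e) * x e)"
    by (simp add: charge_def algebra_simps flip: sum.distrib)
  also have "(\<Sum>e\<in>E. (of_nat (m (H e)) - of_nat (m (T e))) * x e) = (\<Sum>j\<in>J. of_nat (m j) * L j)"
    using m(1) x by (intro sum_potential_differences) auto
  also have "(\<Sum>e\<in>E. of_int (charge n m e) * x e) = (\<Sum>g\<in>G. of_int (charge n m g) * x g)"
    using finite_E by (intro sum.mono_neutral_right) (auto simp: G_def om0)
  finally have "exp (\<Sum>e\<in>E. of_nat (n e) * x e) = (\<Prod>j\<in>J. exp (of_nat (m j) * L j)) *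
      exp (\<Sum>g\<in>G. of_int (charge n m g) * x g)"
    using finite_J by (simp add: exp_add exp_sum)
  then show ?thesis
    using finite_E by (simp add: exp_sum exp_of_nat_mult)
qed

text \<open>The relations are linear in the logarithms of the coordinates, so they hold on the whole torus
  once they hold for the constant terms and for the coefficients of each angle.\<close>

lemma affine_log_relation:
  fixes a :: "'e \<Rightarrow> complex" and M :: "'e \<Rightarrow> 'e \<Rightarrow> real"
  assumes "sum a (heads j) = c + sum a (tails j)"
    and "\<And>h. (\<Sum>e\<in>heads j. M e h) = (\<Sum>e\<in>tails j. M e h)"
  shows "(\<Sum>e\<in>heads j. a e + \<i> * of_real (\<Sum>h\<in>G. M e h * \<theta> h)) =
    c + (\<Sum>e\<in>tails j. a e + \<i> * of_real (\<Sum>h\<in>G. M e h * \<theta> h))"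
proof -
  have "(\<Sum>e\<in>A. \<Sum>h\<in>G. M e h * \<theta> h) = (\<Sum>h\<in>G. (\<Sum>e\<in>A. M e h) * \<theta> h)" for A
    by (subst sum.swap) (simp add: sum_distrib_right)
  then show ?thesis
    using assms by (simp add: sum.distrib flip: sum_distrib_left of_real_sum)
qed

lemma affine_log_on_G:
  fixes a :: "'e \<Rightarrow> complex" and M :: "'e \<Rightarrow> 'e \<Rightarrow> real"
  assumes "g \<in> G" "a g = 0" "\<And>h. M g h = of_bool (g = h)"
  shows "a g + \<i> * of_real (\<Sum>h\<in>G. M g h * \<theta> h) = \<i> * of_real (\<theta> g)"
proof -
  have "(\<Sum>h\<in>G. M g h * \<theta> h) = (\<Sum>h\<in>G. if g = h then \<theta> h else 0)"
    using assms(3) by (intro sum.cong) auto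
  also have "\<dots> = \<theta> g"
    using assms(1) finite_G by simp
  finally show ?thesis using assms(2) by (simp del: of_real_sum)
qed

text \<open>The mean of a monomial is \<open>\<Prod> Q\<^sub>j ^ m\<^sub>j\<close> if its charges vanish and zero otherwise.  The
  families \<open>n\<close> of exponents with vanishing charges correspond to the families \<open>m\<close> that do not
  decrease along any edge, by \<open>n\<^sub>e = m\<^sub>H - m\<^sub>T\<close>.\<close>

lemma torus_mean_of_exp:
  fixes a :: "'e \<Rightarrow> complex" and M :: "'e \<Rightarrow> 'e \<Rightarrow> real" and Q L :: "'j \<Rightarrow> complex"
    and x :: "('e \<Rightarrow> real) \<Rightarrow> 'e \<Rightarrow> complex"
  defines "x \<equiv> \<lambda>\<theta> e. a e + \<i> * of_real (\<Sum>h\<in>G. M e h * \<theta> h)"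
  assumes a: "\<And>g. g \<in> G \<Longrightarrow> a g = 0" "\<And>j. j \<in> J \<Longrightarrow> sum a (heads j) = L j + sum a (tails j)"
    and M: "\<And>g h. g \<in> G \<Longrightarrow> M g h = of_bool (g = h)"
      "\<And>j h. j \<in> J \<Longrightarrow> (\<Sum>e\<in>heads j. M e h) = (\<Sum>e\<in>tails j. M e h)"
    and L: "\<And>j. j \<in> J \<Longrightarrow> exp (L j) = Q j"
  shows "((\<lambda>m. (\<Prod>j\<in>J. Q j ^ m j) *
        (\<Prod>e\<in>E. of_bool (m (T e) \<le> m (H e)) / fact (m (H e) - m (T e)))) has_sum
      1 / (2 * pi) ^ card G * set_lebesgue_integral (PiM G (\<lambda>_. lborel)) (PiE G (\<lambda>_. {0..2 * pi}))
        (\<lambda>\<theta>. exp (\<Sum>e\<in>E. exp (x \<theta> e)))) {m. \<forall>j. j \<notin> J \<longrightarrow> m j = 0}"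
proof -
  let ?int = "set_lebesgue_integral (PiM G (\<lambda>_. lborel)) (PiE G (\<lambda>_. {0..2 * pi}))"
  define pot where "pot n = (SOME m. (\<forall>j. j \<notin> J \<longrightarrow> m j = 0) \<and> (\<forall>j\<in>J. m j = n (omit j) + m (T (omit j))))"
    for n :: "'e \<Rightarrow> nat"
  have pot: "\<forall>j. j \<notin> J \<longrightarrow> pot n j = 0" "\<And>j. j \<in> J \<Longrightarrow> pot n j = n (omit j) + pot n (T (omit j))" for n
    using someI_ex[OF potential_exists[of n]] unfolding pot_def by blast+
  have pot_eqI: "pot n = m" if "\<And>j. j \<notin> J \<Longrightarrow> m j = 0" "\<And>j. j \<in> J \<Longrightarrow> m j = n (omit j) + m (T (omit j))" for n m
    using pot that by (intro potential_unique[of _ _ n]) auto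
  define ch where "ch n = charge n (pot n)" for n
  define C where "C n = (\<Prod>j\<in>J. Q j ^ pot n j) / (\<Prod>e\<in>E. fact (n e))" for n
  define t where "t n \<theta> = (\<Prod>e\<in>E. exp (x \<theta> e) ^ n e / fact (n e))" for n \<theta>
  have x_heads: "sum (x \<theta>) (heads j) = L j + sum (x \<theta>) (tails j)" if "j \<in> J" for j \<theta>
    unfolding x_def using a(2)[OF that] M(2)[OF that] by (rule affine_log_relation)
  have x_G: "x \<theta> g = \<i> * of_real (\<theta> g)" if "g \<in> G" for g \<theta>
    unfolding x_def using that a(1)[OF that] M(1)[OF that] by (rule affine_log_on_G)
  have t_eq: "t n \<theta> = C n * exp (\<Sum>g\<in>G. \<i> * of_real (of_int (ch n g) * \<theta> g))" for n \<theta>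
  proof -
    have "(\<Prod>e\<in>E. exp (x \<theta> e) ^ n e) = (\<Prod>j\<in>J. exp (L j) ^ pot n j) * exp (\<Sum>g\<in>G. of_int (ch n g) * x \<theta> g)"
      unfolding ch_def using pot(1)[of n] pot(2)[of _ n] z_notin x_heads by (intro monomial_on_torus) auto
    also have "(\<Sum>g\<in>G. of_int (ch n g) * x \<theta> g) = (\<Sum>g\<in>G. \<i> * of_real (of_int (ch n g) * \<theta> g))"
      by (intro sum.cong) (auto simp: x_G)
    also have "(\<Prod>j\<in>J. exp (L j) ^ pot n j) = (\<Prod>j\<in>J. Q j ^ pot n j)"
      by (intro prod.cong) (auto simp: L)
    finally show ?thesis by (simp add: t_def C_def prod_dividef)
  qed
  have int_t: "?int (t n) = (if \<forall>g\<in>G. ch n g = 0 then (2 * pi) ^ card G * C n else 0)" for n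
    using torus_integral_character[OF finite_G, of "ch n"] by (simp add: t_eq[abs_def])
  have meas_x: "(\<lambda>\<theta>. x \<theta> e) \<in> borel_measurable (PiM G (\<lambda>_. lborel))" for e
    unfolding x_def by measurable
  have "((\<lambda>n. ?int (t n)) has_sum ?int (\<lambda>\<theta>. exp (\<Sum>e\<in>E. exp (x \<theta> e)))) (PiE E (\<lambda>_. UNIV))"
  proof (rule has_sum_set_integral)
    show "PiE G (\<lambda>_. {0..2 * pi}) \<in> sets (PiM G (\<lambda>_. lborel))"
      "emeasure (PiM G (\<lambda>_. lborel)) (PiE G (\<lambda>_. {0..2 * pi})) < \<infinity>"
      using emeasure_torus_box[OF finite_G] by auto
    show "t n \<in> borel_measurable (PiM G (\<lambda>_. lborel))" for n
      unfolding t_def using meas_x by measurable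
    show "(\<lambda>\<theta>. exp (\<Sum>e\<in>E. exp (x \<theta> e))) \<in> borel_measurable (PiM G (\<lambda>_. lborel))"
      using meas_x by measurable
    show "((\<lambda>n. t n \<theta>) has_sum exp (\<Sum>e\<in>E. exp (x \<theta> e))) (PiE E (\<lambda>_. UNIV))" for \<theta>
      unfolding t_def by (rule exp_sum_multiseries[OF finite_E])
    show "norm (t n \<theta>) \<le> norm (\<Prod>e\<in>E. exp (a e) ^ n e / fact (n e))" for n \<theta>
      by (simp add: t_def x_def norm_mult norm_divide norm_power exp_add flip: prod_norm)
    show "(\<lambda>n. norm (\<Prod>e\<in>E. exp (a e) ^ n e / fact (n e))) summable_on PiE E (\<lambda>_. UNIV)"
      by (rule exp_sum_multiseries_abs_summable[OF finite_E])
  qed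
  from has_sum_cmult_right[OF this, of "1 / (2 * pi) ^ card G"]
  have "((\<lambda>n. if \<forall>g\<in>G. ch n g = 0 then C n else 0) has_sum
      1 / (2 * pi) ^ card G * ?int (\<lambda>\<theta>. exp (\<Sum>e\<in>E. exp (x \<theta> e)))) (PiE E (\<lambda>_. UNIV))"
    by (simp add: int_t if_distrib cong: if_cong)
  also have "?this \<longleftrightarrow> (C has_sum 1 / (2 * pi) ^ card G * ?int (\<lambda>\<theta>. exp (\<Sum>e\<in>E. exp (x \<theta> e))))
      {n \<in> PiE E (\<lambda>_. UNIV). \<forall>g\<in>G. ch n g = 0}"
    by (intro has_sum_cong_neutral) auto
  also have "\<dots> \<longleftrightarrow> ((\<lambda>m :: 'j \<Rightarrow> nat. (\<Prod>j\<in>J. Q j ^ m j) / (\<Prod>e\<in>E. fact (m (H e) - m (T e)))) has_sum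
      1 / (2 * pi) ^ card G * ?int (\<lambda>\<theta>. exp (\<Sum>e\<in>E. exp (x \<theta> e))))
      {m. (\<forall>j. j \<notin> J \<longrightarrow> m j = 0) \<and> (\<forall>e\<in>E. m (T e) \<le> m (H e))}"
  proof (rule has_sum_reindex_bij_witness[where j = pot and i = "\<lambda>m. restrict (\<lambda>e. m (H e) - m (T e)) E"])
    fix n assume "n \<in> {n \<in> PiE E (\<lambda>_. UNIV). \<forall>g\<in>G. ch n g = 0}"
    then have n: "n \<in> extensional E" "\<And>g. g \<in> G \<Longrightarrow> ch n g = 0" by (auto simp: PiE_def)
    have eq: "int (n e) = int (pot n (H e)) - int (pot n (T e))" if "e \<in> E" for e
      using that
    proof (cases rule: E_cases)
      case 1
      then show ?thesis using n(2)[of e] by (simp add: ch_def charge_def)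
    next
      case 2
      then show ?thesis using pot(2)[OF H_in[OF that], of n] by simp
    qed
    then have le: "pot n (T e) \<le> pot n (H e)" "n e = pot n (H e) - pot n (T e)" if "e \<in> E" for e
      using that by force+
    show "restrict (\<lambda>e. pot n (H e) - pot n (T e)) E = n"
      using n(1) le by (auto simp: fun_eq_iff extensional_def)
    show "pot n \<in> {m. (\<forall>j. j \<notin> J \<longrightarrow> m j = 0) \<and> (\<forall>e\<in>E. m (T e) \<le> m (H e))}"
      using pot(1) le by blast
    show "(\<Prod>j\<in>J. Q j ^ pot n j) / (\<Prod>e\<in>E. fact (pot n (H e) - pot n (T e))) = C n"
      using le by (simp add: C_def)
  next
    fix m :: "'j \<Rightarrow> nat"
    assume "m \<in> {m. (\<forall>j. j \<notin> J \<longrightarrow> m j = 0) \<and> (\<forall>e\<in>E. m (T e) \<le> m (H e))}"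
    then have m: "\<And>j. j \<notin> J \<Longrightarrow> m j = 0" "\<And>e. e \<in> E \<Longrightarrow> m (T e) \<le> m (H e)" by auto
    show pot_m: "pot (restrict (\<lambda>e. m (H e) - m (T e)) E) = m"
      using m omit_in H_omit by (intro pot_eqI) (auto, metis le_add_diff_inverse2)
    show "restrict (\<lambda>e. m (H e) - m (T e)) E \<in> {n \<in> PiE E (\<lambda>_. UNIV). \<forall>g\<in>G. ch n g = 0}"
      using m(2) G_subset by (auto simp: ch_def pot_m charge_def of_nat_diff)
  qed simp
  also have "\<dots> \<longleftrightarrow> ((\<lambda>m :: 'j \<Rightarrow> nat. (\<Prod>j\<in>J. Q j ^ m j) *
        (\<Prod>e\<in>E. of_bool (m (T e) \<le> m (H e)) / fact (m (H e) - m (T e)))) has_sum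
      1 / (2 * pi) ^ card G * ?int (\<lambda>\<theta>. exp (\<Sum>e\<in>E. exp (x \<theta> e)))) {m. \<forall>j. j \<notin> J \<longrightarrow> m j = 0}"
  proof (rule has_sum_cong_neutral)
    fix m :: "'j \<Rightarrow> nat" assume "m \<in> {m. \<forall>j. j \<notin> J \<longrightarrow> m j = 0} -
        {m. (\<forall>j. j \<notin> J \<longrightarrow> m j = 0) \<and> (\<forall>e\<in>E. m (T e) \<le> m (H e))}"
    then have "\<exists>e\<in>E. \<not> m (T e) \<le> m (H e)" by blast
    then have "(\<Prod>e\<in>E. of_bool (m (T e) \<le> m (H e)) / fact (m (H e) - m (T e))) = (0::complex)"
      using finite_E by (intro prod_zero) auto
    then show "(\<Prod>j\<in>J. Q j ^ m j) *
        (\<Prod>e\<in>E. of_bool (m (T e) \<le> m (H e)) / fact (m (H e) - m (T e))) = 0" by simp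
  next
    fix m :: "'j \<Rightarrow> nat"
    assume "m \<in> {m. (\<forall>j. j \<notin> J \<longrightarrow> m j = 0) \<and> (\<forall>e\<in>E. m (T e) \<le> m (H e))} \<inter>
        {m. \<forall>j. j \<notin> J \<longrightarrow> m j = 0}"
    then have "(\<Prod>e\<in>E. of_bool (m (T e) \<le> m (H e)) / fact (m (H e) - m (T e))) =
        (\<Prod>e\<in>E. 1 / fact (m (H e) - m (T e)) :: complex)"
      by (intro prod.cong) auto
    also have "\<dots> = 1 / (\<Prod>e\<in>E. fact (m (H e) - m (T e)))"
      by (simp add: prod_dividef)
    finally have eq: "(\<Prod>e\<in>E. of_bool (m (T e) \<le> m (H e)) / fact (m (H e) - m (T e))) =
        1 / (\<Prod>e\<in>E. fact (m (H e) - m (T e)) :: complex)" .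
    show "(\<Prod>j\<in>J. Q j ^ m j) / (\<Prod>e\<in>E. fact (m (H e) - m (T e))) = (\<Prod>j\<in>J. Q j ^ m j) *
        (\<Prod>e\<in>E. of_bool (m (T e) \<le> m (H e)) / fact (m (H e) - m (T e)))"
      by (subst eq) simp
  qed auto
  finally show ?thesis .
qed

definition relation :: "('j \<Rightarrow> complex) \<Rightarrow> 'j \<Rightarrow> ('e \<Rightarrow> complex) \<Rightarrow> complex" where
  "relation Q j y = prod y (heads j) - Q j * prod y (tails j)"

text \<open>At a point of the variety both terms of the relation have the same value, which can be
  factored out of the differential; the other factor is a logarithmic differential with constant
  coefficients.\<close>

lemma diff1_relation:
  assumes y: "\<And>e. e \<in> E \<Longrightarrow> y e \<noteq> 0" and rel: "prod y (heads j) = Q j * prod y (tails j)"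
  shows "diff1 (relation Q j) y v =
    prod y (heads j) * ((\<Sum>e\<in>heads j. v e / y e) - (\<Sum>e\<in>tails j. v e / y e))"
proof -
  have "((\<lambda>t. relation Q j (\<lambda>e. y e + t * v e)) has_field_derivative
      prod y (heads j) * (\<Sum>e\<in>heads j. v e / y e) -
      Q j * (prod y (tails j) * (\<Sum>e\<in>tails j. v e / y e))) (at 0)"
    unfolding relation_def using y finite_heads finite_tails
    by (intro DERIV_diff DERIV_cmult has_field_derivative_prod_line) (auto simp: heads_def tails_def)
  then show ?thesis
    unfolding diff1_def using rel by (simp add: DERIV_imp_deriv algebra_simps)
qed

text \<open>The matrix of the logarithmic differentials of the relations \<open>js\<close>, followed by those of the
  coordinates \<open>gs\<close>, in terms of the logarithmic differentials of all coordinates.\<close>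

definition incidence :: "'j list \<Rightarrow> 'e list \<Rightarrow> nat \<Rightarrow> 'e \<Rightarrow> int" where
  "incidence js gs i e = (if i < length js then of_bool (H e = js ! i) - of_bool (T e = js ! i)
     else of_bool (e = gs ! (i - length js)))"

lemma card_E_lists:
  assumes "distinct js" "set js = J" "distinct gs" "set gs = G"
  shows "distinct (map omit js @ gs)" "set (map omit js @ gs) = E" "length js + length gs = card E"
proof -
  show d: "distinct (map omit js @ gs)"
    using assms inj_on_omit omit_notin_G by (auto simp: distinct_map)
  show s: "set (map omit js @ gs) = E"
    using assms E_eq by auto
  show "length js + length gs = card E"
    using distinct_card[OF d] s by simp
qed

text \<open>In a nonzero term of the determinant the rows of \<open>gs\<close> take their own columns, so the rows of
  \<open>js\<close> are matched with omitted edges.  A row \<open>j\<close> is matched with an edge with head \<open>j\<close> or with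
  tail \<open>j\<close>, so the head has at least the rank of \<open>j\<close>.  Since the heads run over all indices, the
  sums of the ranks are equal, and no rank can be strictly larger.\<close>

lemma incidence_permutation_unique:
  assumes js: "distinct js" "set js = J" and gs: "distinct gs" "set gs = G"
    and es: "distinct es" "set es = E"
    and f: "f permutes {..<length es}"
    and nz: "(\<Prod>i<length es. incidence js gs i (es ! f i)) \<noteq> 0" and i: "i < length es"
  shows "es ! f i = (map omit js @ gs) ! i"
proof -
  define r where "r = length js"
  have len: "length es = r + length gs"
    using card_E_lists[OF js gs] distinct_card[OF es(1)] es(2) by (simp add: r_def)
  have fi: "f i < length es" if "i < length es" for i
    using that permutes_in_image[OF f] by simp
  have entry: "incidence js gs i (es ! f i) \<noteq> 0" if "i < length es" for i
    using nz that by (auto simp: prod_zero_iff)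
  have last: "es ! f (r + k) = gs ! k" if "k < length gs" for k
    using entry[of "r + k"] that len by (auto simp: incidence_def r_def split: if_splits)
  have inj: "es ! f i \<noteq> es ! f k" if "i < length es" "k < length es" "i \<noteq> k" for i k
    using es(1) fi[OF that(1)] fi[OF that(2)] that(3) permutes_inj[OF f]
    by (auto simp: nth_eq_iff_index_eq inj_eq)
  have omit: "es ! f i = omit (H (es ! f i))" if "i < r" for i
  proof (rule ccontr)
    have "es ! f i \<in> E"
      using fi[of i] that len es by auto
    moreover assume "es ! f i \<noteq> omit (H (es ! f i))"
    ultimately have "es ! f i \<in> set gs"
      using gs(2) by (metis E_cases)
    then obtain k where "k < length gs" "es ! f i = gs ! k"
      by (auto simp: in_set_conv_nth)
    then show False
      using inj[of i "r + k"] last[of k] that len by simp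
  qed
  have mem: "es ! f i \<in> E" if "i < length es" for i
    using fi[OF that] es by auto
  have HT: "H (es ! f i) = js ! i \<or> T (es ! f i) = js ! i" if "i < r" for i
    using entry[of i] that len by (auto simp: incidence_def r_def split: if_splits)
  have rank_le: "rank (js ! i) \<le> rank (H (es ! f i))" if "i < r" for i
    using HT[OF that] rank_less[OF mem[of i]] that len by auto
  have bij: "bij_betw (\<lambda>i. H (es ! f i)) {..<r} J"
  proof -
    have "inj_on (\<lambda>i. H (es ! f i)) {..<r}"
      using omit inj len by (intro inj_onI) (metis lessThan_iff trans_less_add1)
    moreover have "(\<lambda>i. H (es ! f i)) ` {..<r} \<subseteq> J"
      using H_in mem len by auto
    moreover have "card J = r"
      using js distinct_card by (force simp: r_def)
    ultimately show ?thesis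
      using finite_J by (simp add: bij_betw_def card_image card_subset_eq)
  qed
  have "(\<Sum>i<r. rank (js ! i)) = (\<Sum>j\<in>J. rank j)"
    using js by (intro sum.reindex_bij_betw bij_betw_nth) (auto simp: r_def)
  also have "\<dots> = (\<Sum>i<r. rank (H (es ! f i)))"
    using sum.reindex_bij_betw[OF bij, of rank] by simp
  finally have sums: "(\<Sum>i<r. rank (js ! i)) = (\<Sum>i<r. rank (H (es ! f i)))" .
  show ?thesis
  proof (cases "i < r")
    case True
    have "rank (js ! i) = rank (H (es ! f i))"
      by (rule sum_mono_inv[OF sums]) (use rank_le True in auto)
    then have "H (es ! f i) = js ! i"
      using HT[OF True] rank_less[OF mem[OF i]] by auto
    then show ?thesis
      using omit[OF True] True by (simp add: nth_append r_def)
  next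
    case False
    then show ?thesis
      using last[of "i - r"] i len by (simp add: nth_append r_def)
  qed
qed

lemma incidence_determinant:
  assumes js: "distinct js" "set js = J" and gs: "distinct gs" "set gs = G"
    and es: "distinct es" "set es = E"
  shows "(\<Sum>f | f permutes {..<length es}. sign f * (\<Prod>i<length es. incidence js gs i (es ! f i))) \<in> {1, -1}"
proof -
  note lists = card_E_lists[OF js gs]
  have len: "length es = length js + length gs"
    using lists(3) distinct_card[OF es(1)] es(2) by simp
  have "mset (map omit js @ gs) = mset es"
    using lists es by (simp only: set_eq_iff_mset_eq_distinct[symmetric])
  \<comment> \<open>The single contributing permutation matches each index with its omitted edge.\<close>
  from mset_eq_permutation[OF this] obtain f0
    where f0: "f0 permutes {..<length es}" "permute_list f0 es = map omit js @ gs" .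
  have f0_nth: "es ! f0 i = (map omit js @ gs) ! i" if "i < length es" for i
    using permute_list_nth[OF f0(1) that] f0(2) by simp
  have unique: "f = f0"
    if f: "f permutes {..<length es}" and nz: "(\<Prod>i<length es. incidence js gs i (es ! f i)) \<noteq> 0" for f
  proof
    fix i show "f i = f0 i"
    proof (cases "i < length es")
      case True
      then have "es ! f i = es ! f0 i"
        using incidence_permutation_unique[OF js gs es f nz True] f0_nth by simp
      then show ?thesis
        using es(1) permutes_in_image[OF f, of i] permutes_in_image[OF f0(1), of i] True
        by (simp add: nth_eq_iff_index_eq)
    next
      case False
      then show ?thesis
        using permutes_not_in[OF f, of i] permutes_not_in[OF f0(1), of i] by simp
    qed
  qed
  have "incidence js gs i (es ! f0 i) = 1" if i: "i < length es" for i
  proof (cases "i < length js")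
    case True
    then have j: "js ! i \<in> J" using js by auto
    then have "T (omit (js ! i)) \<noteq> js ! i"
      using rank_less[OF omit_in[OF j]] H_omit[OF j] by auto
    then show ?thesis
      using True i H_omit[OF j] by (simp add: incidence_def f0_nth nth_append)
  next
    case False
    then show ?thesis
      using i by (simp add: incidence_def f0_nth nth_append)
  qed
  then have one: "(\<Prod>i<length es. incidence js gs i (es ! f0 i)) = 1"
    by simp
  have "(\<Sum>f | f permutes {..<length es}. sign f * (\<Prod>i<length es. incidence js gs i (es ! f i))) =
      (\<Sum>f\<in>{f0}. sign f * (\<Prod>i<length es. incidence js gs i (es ! f i)))"
    using f0(1) unique by (intro sum.mono_neutral_right) (auto simp: finite_permutations)
  also have "\<dots> = sign f0"
    by (simp add: one)
  finally show ?thesis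
    by (simp add: sign_def)
qed

lemma prod_heads_all: "(\<Prod>j\<in>J. prod y (heads j)) = prod y E"
  for y :: "'e \<Rightarrow> 'a::comm_monoid_mult"
  unfolding heads_def using finite_E finite_J H_in by (intro prod.group) auto

text \<open>The candidate form is the wedge product of the logarithmic differentials of the kept
  coordinates, times the sign.  The factors \<open>y\<^sub>e\<close> cancel from the determinant because each edge has
  exactly one head: the products over the heads of all indices multiply to the product of all
  coordinates.  The
  sign depends on the enumerations only, not on the point of the torus.\<close>

lemma residue_on_torus:
  assumes js: "distinct js" "set js = J" and gs: "distinct gs" "set gs = G"
    and es: "distinct es" "set es = E"
  shows "\<exists>\<epsilon>\<in>{1, -1}. \<forall>y t. (\<forall>e\<in>E. y e \<noteq> 0) \<longrightarrow> (\<forall>j\<in>J. relation Q j y = 0) \<longrightarrow>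
      (\<forall>g\<in>G. t g \<in> affine_space E) \<longrightarrow>
      (\<forall>g\<in>G. \<forall>j\<in>J. (\<Sum>e\<in>heads j. t g e / y e) = (\<Sum>e\<in>tails j. t g e / y e)) \<longrightarrow>
      (\<forall>g\<in>G. \<forall>h\<in>G. t h g / y g = \<i> * of_bool (g = h)) \<longrightarrow>
      residue_form es (map (relation Q) js) y (map t gs) = \<epsilon> * \<i> ^ card G"
proof -
  define \<epsilon> where "\<epsilon> = (\<Sum>f | f permutes {..<length es}. sign f * (\<Prod>i<length es. incidence js gs i (es ! f i)))"
  have \<epsilon>: "\<epsilon> = 1 \<or> \<epsilon> = -1"
    using incidence_determinant[OF assms] by (simp add: \<epsilon>_def)
  have len: "length es = length js + length gs"
    using card_E_lists(3)[OF js gs] distinct_card[OF es(1)] es(2) by simp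
  have "residue_form es (map (relation Q) js) y (map t gs) = of_int \<epsilon> * \<i> ^ card G"
    if y: "\<forall>e\<in>E. y e \<noteq> 0" and M: "\<forall>j\<in>J. relation Q j y = 0"
      and t: "\<forall>g\<in>G. t g \<in> affine_space E"
      and tangent: "\<forall>g\<in>G. \<forall>j\<in>J. (\<Sum>e\<in>heads j. t g e / y e) = (\<Sum>e\<in>tails j. t g e / y e)"
      and dual: "\<forall>g\<in>G. \<forall>h\<in>G. t h g / y g = \<i> * of_bool (g = h)" for y t
  proof -
    define \<alpha>s where "\<alpha>s = map (\<lambda>f. diff1 f y) (map (relation Q) js)"
    define \<beta>s :: "(('e \<Rightarrow> complex) \<Rightarrow> complex) list" where "\<beta>s = map (\<lambda>g v. v g / y g) gs"
    \<comment> \<open>The coefficient matrix is the incidence matrix with row factors \<open>c\<close> and column factors \<open>1 / y\<close>.\<close>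
    define c where "c i = (if i < length js then prod y (heads (js ! i)) else 1)" for i
    define A where "A i k = c i * of_int (incidence js gs i (es ! k)) / y (es ! k)" for i k
    have d: "diff1 (relation Q j) y v =
        prod y (heads j) * ((\<Sum>e\<in>heads j. v e / y e) - (\<Sum>e\<in>tails j. v e / y e))" if "j \<in> J" for j v
      using y M that by (intro diff1_relation) (auto simp: relation_def)
    have sum_es: "(\<Sum>k<length es. h (es ! k)) = (\<Sum>e\<in>E. h e)" for h :: "'e \<Rightarrow> complex"
      using es by (intro sum.reindex_bij_betw bij_betw_nth) auto
    have prod_es: "(\<Prod>k<length es. h (es ! k)) = (\<Prod>e\<in>E. h e)" for h :: "'e \<Rightarrow> complex"
      using es by (intro prod.reindex_bij_betw bij_betw_nth) auto
    have rows: "((\<alpha>s @ \<beta>s) ! i) v = (\<Sum>k<length es. A i k * v (es ! k))" if i: "i < length es" for i v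
    proof (cases "i < length js")
      case True
      then have j: "js ! i \<in> J" using js by auto
      have "(\<Sum>k<length es. A i k * v (es ! k)) =
          c i * (\<Sum>e\<in>E. of_int (incidence js gs i e) * (v e / y e))"
        using sum_es[of "\<lambda>e. c i * of_int (incidence js gs i e) / y e * v e"]
        by (simp add: A_def sum_distrib_left mult_ac)
      also have "(\<Sum>e\<in>E. of_int (incidence js gs i e) * (v e / y e)) =
          (\<Sum>e\<in>E. of_bool (H e = js ! i) * (v e / y e)) - (\<Sum>e\<in>E. of_bool (T e = js ! i) * (v e / y e))"
        using True by (simp add: incidence_def left_diff_distrib diff_divide_distrib sum_subtractf)
      also have "(\<Sum>e\<in>E. of_bool (H e = js ! i) * (v e / y e)) = (\<Sum>e\<in>heads (js ! i). v e / y e)"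
        unfolding heads_def using finite_E by (intro sum.mono_neutral_cong_right) auto
      also have "(\<Sum>e\<in>E. of_bool (T e = js ! i) * (v e / y e)) = (\<Sum>e\<in>tails (js ! i). v e / y e)"
        unfolding tails_def using finite_E by (intro sum.mono_neutral_cong_right) auto
      finally show ?thesis
        using True d[OF j] by (simp add: \<alpha>s_def c_def nth_append)
    next
      case False
      define g where "g = gs ! (i - length js)"
      have g: "g \<in> E"
        using False i len gs G_subset by (auto simp: g_def)
      have "(\<Sum>k<length es. A i k * v (es ! k)) = (\<Sum>e\<in>E. of_bool (e = g) * (v e / y e))"
        using sum_es[of "\<lambda>e. of_int (incidence js gs i e) / y e * v e"] False
        by (simp add: A_def c_def incidence_def g_def)
      also have "\<dots> = (\<Sum>e\<in>{g}. v e / y e)"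
        using finite_E g by (intro sum.mono_neutral_cong_right) auto
      finally show ?thesis
        using False i len by (simp add: \<alpha>s_def \<beta>s_def nth_append g_def)
    qed
    have det: "(\<Sum>f | f permutes {..<length es}. of_int (sign f) * (\<Prod>i<length es. A i (f i))) = of_int \<epsilon>"
    proof -
      have "(\<Prod>i<length es. A i (f i)) = of_int (\<Prod>i<length es. incidence js gs i (es ! f i))"
        if f: "f permutes {..<length es}" for f
      proof -
        have "(\<Prod>i<length es. y (es ! f i)) = prod y E"
          using prod.permute[OF f, of "\<lambda>k. y (es ! k)"] prod_es[of y] by (simp add: o_def)
        moreover have "(\<Prod>i<length es. c i) = prod y E"
        proof -
          have "{..<length es} = {..<length js} \<union> {length js..<length es}"
            using len by auto
          then have "(\<Prod>i<length es. c i) = (\<Prod>i<length js. c i) * (\<Prod>i\<in>{length js..<length es}. c i)"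
            by (simp add: prod.union_disjoint ivl_disj_int)
          also have "\<dots> = (\<Prod>i<length js. prod y (heads (js ! i)))"
            by (simp add: c_def)
          also have "\<dots> = (\<Prod>j\<in>J. prod y (heads j))"
            using js by (intro prod.reindex_bij_betw bij_betw_nth) auto
          finally show ?thesis by (simp add: prod_heads_all)
        qed
        ultimately show ?thesis
          using y finite_E by (simp add: A_def prod.distrib prod_dividef)
      qed
      then show ?thesis
        by (simp add: \<epsilon>_def)
    qed
    have lin: "linear_on_affine_space E \<alpha>" if "\<alpha> \<in> set (\<alpha>s @ \<beta>s)" for \<alpha>
    proof -
      have "length (\<alpha>s @ \<beta>s) = length es"
        by (simp add: \<alpha>s_def \<beta>s_def len)
      moreover have "\<exists>i<length (\<alpha>s @ \<beta>s). (\<alpha>s @ \<beta>s) ! i = \<alpha>"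
        using that by (simp only: in_set_conv_nth)
      ultimately obtain i where i: "i < length es" "\<alpha> = (\<alpha>s @ \<beta>s) ! i"
        by auto
      show ?thesis
        unfolding linear_on_affine_space_def i(2) rows[OF i(1)]
        by (simp add: sum.distrib distrib_left sum_distrib_left mult_ac)
    qed
    define \<psi> where "\<psi> vs = of_int \<epsilon> * wedge_list \<beta>s vs" for vs
    have alt_\<beta>: "alternating_form E (length gs) (wedge_list \<beta>s)"
      using alternating_form_wedge_list[of \<beta>s E] lin by (simp add: \<beta>s_def)
    have alt: "alternating_form E (length gs) \<psi>"
      unfolding \<psi>_def by (rule alternating_form_scale[OF alt_\<beta>])
    have "residue_form es (map (relation Q) js) y (map t gs) = \<psi> (map t gs)"
    proof (rule residue_form_on_tangent_vectors)
      show "distinct es" by (rule es)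
      show "length (map (relation Q) js) \<le> length es" using len by simp
      show "linear_on_affine_space (set es) (diff1 f y)" if "f \<in> set (map (relation Q) js)" for f
        using lin[of "diff1 f y"] that es by (auto simp: \<alpha>s_def)
      show "alternating_form (set es) (length es - length (map (relation Q) js)) \<psi>"
        using alt len es by simp
      show "wedge (length (map (relation Q) js)) (length es - length (map (relation Q) js))
          (wedge_list (map (\<lambda>f. diff1 f y) (map (relation Q) js))) \<psi> vs = wedge_list (map (\<lambda>e v. v e) es) vs"
        if vs: "length vs = length es" "set vs \<subseteq> affine_space (set es)" for vs
      proof -
        have "wedge (length js) (length gs) (wedge_list \<alpha>s) \<psi> vs =
            of_int \<epsilon> * wedge (length js) (length gs) (wedge_list \<alpha>s) (wedge_list \<beta>s) vs"
          by (simp add: wedge_def \<psi>_def sum_distrib_left mult_ac)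
        also have "wedge (length js) (length gs) (wedge_list \<alpha>s) (wedge_list \<beta>s) vs = wedge_list (\<alpha>s @ \<beta>s) vs"
          by (rule wedge_wedge_list) (simp_all add: \<alpha>s_def \<beta>s_def)
        also have "\<dots> = of_int \<epsilon> * wedge_list (map (\<lambda>e v. v e) es) vs"
          unfolding det[symmetric] using es vs len rows
          by (intro wedge_list_coefficient_matrix) (auto simp: \<alpha>s_def \<beta>s_def)
        finally have "wedge (length js) (length gs) (wedge_list \<alpha>s) \<psi> vs = wedge_list (map (\<lambda>e v. v e) es) vs"
          using \<epsilon> by auto
        then show ?thesis by (simp add: \<alpha>s_def len)
      qed
      show "length (map t gs) = length es - length (map (relation Q) js)" using len by simp
      show "set (map t gs) \<subseteq> affine_space (set es)" using t gs es by auto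
      show "diff1 f y v = 0" if "f \<in> set (map (relation Q) js)" "v \<in> set (map t gs)" for f v
        using that tangent d js gs by auto
    qed
    also have "wedge_list \<beta>s (map t gs) = \<i> ^ length \<beta>s"
    proof (rule wedge_list_dual_bases)
      fix i k assume "i < length \<beta>s" "k < length \<beta>s"
      then show "(\<beta>s ! i) (map t gs ! k) = \<i> * of_bool (i = k)"
        using dual[rule_format, of "gs ! i" "gs ! k"] gs
        by (simp add: \<beta>s_def nth_eq_iff_index_eq nth_mem[of _ gs, unfolded gs(2)])
    qed
    then have "\<psi> (map t gs) = of_int \<epsilon> * \<i> ^ card G"
      using gs distinct_card[OF gs(1)] by (simp add: \<psi>_def \<beta>s_def)
    finally show ?thesis .
  qed
  then show ?thesis
    using \<epsilon> by (intro bexI[of _ "of_int \<epsilon>"]) auto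
qed

end

section \<open>The shape of the ladder diagram\<close>

lemma nsum_0: "nsum k 0 = 0"
  by (simp add: nsum_def)

lemma nsum_Suc: "nsum k (Suc i) = nsum k i + int (k (Suc i))"
  by (simp add: nsum_def)

lemma nsum_pred: "i \<ge> 1 \<Longrightarrow> nsum k i = nsum k (i - 1) + int (k i)"
  by (cases i) (simp_all add: nsum_Suc)

lemma nsum_mono: "i \<le> j \<Longrightarrow> nsum k i \<le> nsum k j"
  by (induction j rule: dec_induct) (simp_all add: nsum_Suc)

lemma right_edge_eq: "right_edge (a, c) = ((a, c), (a + 1, c))"
  by (simp add: right_edge_def)

lemma down_edge_eq: "down_edge (a, c) = ((a, c), (a, c - 1))"
  by (simp add: down_edge_def)

lemmas edge_eqs = right_edge_eq down_edge_eq

lemma crossing_right: "crossing (right_edge (a, c)) = ((a, c - 1), (a, c))"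
  by (simp add: crossing_def edge_eqs)

lemma crossing_down: "crossing (down_edge (a, c)) = ((a - 1, c - 1), (a, c - 1))"
  by (simp add: crossing_def edge_eqs)

locale ladder =
  fixes k :: "nat \<Rightarrow> nat" and l :: nat
  assumes k_pos: "\<And>i. i \<in> {1..l + 1} \<Longrightarrow> k i \<ge> 1"
begin

definition n where "n = nsum k (l + 1)"

definition block :: "nat \<Rightarrow> int set" where
  "block i = {nsum k (i - 1)<..nsum k i}"

definition block_of :: "int \<Rightarrow> nat" where
  "block_of a = (THE i. i \<in> {1..l + 1} \<and> a \<in> block i)"

text \<open>The numbers of squares and of vertices in a column.  The first column of each block carries one
  of the vertices \<open>s\<^sub>i\<close> above its squares.\<close>

definition square_height :: "int \<Rightarrow> int" where
  "square_height a = (if a \<in> {1..n} then n - nsum k (block_of a) else 0)"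

definition vertex_height :: "int \<Rightarrow> int" where
  "vertex_height a = (if a \<in> {1..n} then square_height a + of_bool (a = nsum k (block_of a - 1) + 1) else 0)"

lemma nsum_less: "i < j \<Longrightarrow> j \<le> l + 1 \<Longrightarrow> nsum k i < nsum k j"
proof -
  assume "i < j" "j \<le> l + 1"
  then have "nsum k i \<le> nsum k (j - 1)" "nsum k j = nsum k (j - 1) + int (k j)" "k j \<ge> 1"
    using k_pos[of j] nsum_mono[of i "j - 1" k] nsum_pred[of j k] by auto
  then show ?thesis by simp
qed

lemma block_unique:
  assumes "i \<in> {1..l + 1}" "j \<in> {1..l + 1}" "a \<in> block i" "a \<in> block j"
  shows "i = j"
proof (rule ccontr)
  assume "i \<noteq> j"
  moreover have "\<not> i < j" if "a \<in> block i" "a \<in> block j" for i j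
    using that nsum_mono[of i "j - 1" k] unfolding block_def by fastforce
  ultimately show False
    using assms by (metis nat_neq_iff)
qed

lemma block_of_eqI: "i \<in> {1..l + 1} \<Longrightarrow> a \<in> block i \<Longrightarrow> block_of a = i"
  unfolding block_of_def by (rule the_equality) (auto intro: block_unique)

lemma block_of: assumes "a \<in> {1..n}" shows "block_of a \<in> {1..l + 1}" "a \<in> block (block_of a)"
proof -
  have "\<exists>i\<in>{1..j}. a \<in> block i" if "1 \<le> a" "a \<le> nsum k j" for j
    using that
  proof (induction j)
    case (Suc j)
    then show ?case
      by (cases "a \<le> nsum k j") (force simp: block_def)+
  qed (simp add: nsum_0)
  from this[of "l + 1"] obtain i where "i \<in> {1..l + 1}" "a \<in> block i"
    using assms by (auto simp: n_def)
  then show "block_of a \<in> {1..l + 1}" "a \<in> block (block_of a)"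
    using block_of_eqI by auto
qed

lemma block_subset: "i \<in> {1..l + 1} \<Longrightarrow> block i \<subseteq> {1..n}"
  using nsum_mono[of 0 "i - 1" k] nsum_mono[of i "l + 1" k] by (auto simp: block_def n_def nsum_0)

lemma block_bounds: "i \<in> {1..l + 1} \<Longrightarrow> a \<in> block i \<Longrightarrow> a \<in> {1..n}"
  using block_subset by blast

lemma square_height_block: "i \<in> {1..l + 1} \<Longrightarrow> a \<in> block i \<Longrightarrow> square_height a = n - nsum k i"
  by (simp only: square_height_def block_bounds block_of_eqI if_True)

lemma vertex_height_block: "i \<in> {1..l + 1} \<Longrightarrow> a \<in> block i \<Longrightarrow>
    vertex_height a = n - nsum k i + of_bool (a = nsum k (i - 1) + 1)"
  by (simp only: vertex_height_def block_bounds square_height_block block_of_eqI if_True)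

lemma square_height_nonneg: "0 \<le> square_height a"
  using block_of[of a] nsum_mono[of "block_of a" "l + 1" k] by (auto simp: square_height_def n_def)

lemma square_height_le_vertex_height: "square_height a \<le> vertex_height a" and vertex_height_le_square_height: "vertex_height a \<le> square_height a + 1"
  by (auto simp: vertex_height_def square_height_def)

lemma vertex_height_le_n: "vertex_height a \<le> n"
proof (cases "a \<in> {1..n}")
  case True
  then have "nsum k 0 < nsum k (block_of a)"
    using block_of[OF True] by (intro nsum_less) auto
  then show ?thesis using vertex_height_le_square_height[of a] True by (simp add: square_height_def nsum_0)
next
  case False
  then have "vertex_height a = 0" by (simp only: vertex_height_def if_False)
  then show ?thesis using nsum_mono[of 0 "l + 1" k] by (simp add: n_def nsum_0)
qed

lemma nsum_first: assumes "i \<in> {1..l + 1}" shows "nsum k (i - 1) + 1 \<in> block i"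
  using assms nsum_less[of "i - 1" i] by (simp add: block_def)

text \<open>The squares alone form a staircase; the additional vertex at the top of the first column of a
  block still fits below the previous column, because blocks have positive width.  Hence the left
  and lower ends of edges are controlled by the other end.\<close>

lemma vertex_height_Suc_le_square_height: assumes "1 \<le> a" shows "vertex_height (a + 1) \<le> square_height a"
proof (cases "a + 1 \<le> n")
  case True
  then have a: "a \<in> {1..n}" using assms by simp
  define i where "i = block_of a"
  have i: "i \<in> {1..l + 1}" "a \<in> block i" using block_of[OF a] by (auto simp: i_def)
  show ?thesis
  proof (cases "a + 1 \<le> nsum k i")
    case True
    then have "a + 1 \<in> block i" using i by (simp add: block_def)
    then show ?thesis
      using i vertex_height_block[of i "a + 1"] square_height_block[of i a] by (simp add: block_def)
  next
    case False
    then have eq: "a = nsum k i" using i by (simp add: block_def)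
    then have "i \<noteq> l + 1" using \<open>a + 1 \<le> n\<close> by (auto simp: n_def)
    then have i': "i + 1 \<in> {1..l + 1}" using i by simp
    then have "a + 1 \<in> block (i + 1)"
      using nsum_first[OF i'] eq by simp
    then have "vertex_height (a + 1) \<le> n - nsum k (i + 1) + 1"
      using vertex_height_block[OF i'] by simp
    moreover have "square_height a = n - nsum k i" using square_height_block[OF i] .
    moreover have "nsum k i < nsum k (i + 1)" using i' by (intro nsum_less) auto
    ultimately show ?thesis by linarith
  qed
next
  case False
  then show ?thesis using square_height_nonneg by (simp add: vertex_height_def)
qed

lemma vertex_height_Suc_le: "1 \<le> a \<Longrightarrow> vertex_height (a + 1) \<le> vertex_height a"
  using vertex_height_Suc_le_square_height square_height_le_vertex_height order_trans by blast

lemma squares_iff: "(a, c) \<in> squares k l \<longleftrightarrow> a \<in> {1..n} \<and> 1 \<le> c \<and> c \<le> square_height a"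
proof
  assume "(a, c) \<in> squares k l"
  then obtain i where "1 \<le> c" "i \<in> {1..l + 1}" "a \<in> block i" "c \<le> n - nsum k i"
    by (auto simp: squares_def block_def n_def)
  then show "a \<in> {1..n} \<and> 1 \<le> c \<and> c \<le> square_height a"
    using block_bounds square_height_block by metis
next
  assume *: "a \<in> {1..n} \<and> 1 \<le> c \<and> c \<le> square_height a"
  then show "(a, c) \<in> squares k l"
    using block_of[of a] unfolding squares_def n_def by (auto simp: square_height_def block_def n_def intro!: bexI[of _ "block_of a"])
qed

lemma vertices_iff: "(a, c) \<in> vertices k l \<longleftrightarrow> a \<in> {1..n} \<and> 1 \<le> c \<and> c \<le> vertex_height a"
proof -
  have "(a, c) \<in> s_vertex k l ` {1..l + 1} \<longleftrightarrow> a \<in> {1..n} \<and> c = square_height a + 1 \<and> a = nsum k (block_of a - 1) + 1"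
  proof
    assume "(a, c) \<in> s_vertex k l ` {1..l + 1}"
    then obtain i where i: "i \<in> {1..l + 1}" "a = nsum k (i - 1) + 1" "c = n - nsum k i + 1"
      by (auto simp: s_vertex_def n_def)
    then have "a \<in> block i" using nsum_first by simp
    then show "a \<in> {1..n} \<and> c = square_height a + 1 \<and> a = nsum k (block_of a - 1) + 1"
      using i block_bounds[of i a] block_of_eqI[of i a] square_height_block[of i a] by metis
  next
    assume "a \<in> {1..n} \<and> c = square_height a + 1 \<and> a = nsum k (block_of a - 1) + 1"
    then show "(a, c) \<in> s_vertex k l ` {1..l + 1}"
      using block_of[of a] by (auto simp: s_vertex_def n_def square_height_def intro!: image_eqI[of _ _ "block_of a"])
  qed
  then show ?thesis
    using square_height_nonneg[of a] unfolding vertices_def by (auto simp: squares_iff vertex_height_def)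
qed

lemma right_edge_iff: "right_edge (a, c) \<in> edges k l \<longleftrightarrow> 1 \<le> a \<and> 1 \<le> c \<and> c \<le> vertex_height (a + 1)"
proof -
  have "c \<le> vertex_height a \<and> a + 1 \<le> n" if "1 \<le> a" "1 \<le> c" "c \<le> vertex_height (a + 1)"
    using that vertex_height_Suc_le[of a] by (auto simp: vertex_height_def split: if_splits)
  then show ?thesis
    by (auto simp: edges_def edge_eqs vertices_iff)
qed

lemma down_edge_iff: "down_edge (a, c) \<in> edges k l \<longleftrightarrow> 1 \<le> a \<and> 2 \<le> c \<and> c \<le> vertex_height a"
proof -
  have "a \<le> n" if "2 \<le> c" "c \<le> vertex_height a"
    using that by (auto simp: vertex_height_def split: if_splits)
  then show ?thesis
    by (auto simp: edges_def edge_eqs vertices_iff)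
qed

lemma edges_cases:
  assumes "e \<in> edges k l"
  obtains (right) a c where "e = right_edge (a, c)" "1 \<le> a" "1 \<le> c" "c \<le> vertex_height (a + 1)"
  | (down) a c where "e = down_edge (a, c)" "1 \<le> a" "2 \<le> c" "c \<le> vertex_height a"
proof -
  obtain a c where ac: "fst e = (a, c)" by (cases "fst e")
  have "e = right_edge (a, c) \<or> e = down_edge (a, c)"
    using assms ac by (auto simp: edges_def)
  then show ?thesis
    using that assms by (auto simp: right_edge_iff down_edge_iff)
qed

lemma boxes_iff: "(a, c) \<in> boxes k l \<longleftrightarrow> 1 \<le> a \<and> 1 \<le> c \<and> c < vertex_height (a + 1)"
  using vertex_height_Suc_le[of a] by (auto simp: boxes_def corner_def opp_corner_def right_edge_iff down_edge_iff)

lemma finite_squares: "finite (squares k l)"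
proof (rule finite_subset)
  show "squares k l \<subseteq> {1..n} \<times> {1..n}"
    by (auto simp: squares_iff intro: order_trans[OF order_trans[OF _ square_height_le_vertex_height] vertex_height_le_n])
qed simp

lemma finite_edges: "finite (edges k l)"
proof (rule finite_subset)
  show "edges k l \<subseteq> (right_edge ` ({1..n} \<times> {1..n})) \<union> (down_edge ` ({1..n} \<times> {1..n}))"
  proof
    fix e assume "e \<in> edges k l"
    then show "e \<in> (right_edge ` ({1..n} \<times> {1..n})) \<union> (down_edge ` ({1..n} \<times> {1..n}))"
    proof (cases rule: edges_cases)
      case (right a c)
      then have "a + 1 \<le> n" "c \<le> n"
        using vertex_height_le_n[of "a + 1"] by (auto simp: vertex_height_def split: if_splits)
      then show ?thesis using right by auto
    next
      case (down a c)
      then have "a \<le> n" "c \<le> n"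
        using vertex_height_le_n[of a] by (auto simp: vertex_height_def split: if_splits)
      then show ?thesis using down by auto
    qed
  qed
qed auto

lemma finite_boxes: "finite (boxes k l)"
proof (rule finite_subset)
  show "boxes k l \<subseteq> (\<lambda>e. fst e) ` edges k l"
    unfolding boxes_def corner_def by (force simp: right_edge_eq)
qed (simp add: finite_edges)

lemma vertex_height_Suc_pos: assumes "i \<in> {1..l}" "a \<in> block i" shows "1 \<le> vertex_height (a + 1)"
proof (cases "a + 1 \<le> nsum k i")
  case True
  then have "a + 1 \<in> block i" using assms by (simp add: block_def)
  then show ?thesis
    using assms nsum_less[of i "l + 1"] vertex_height_block[of i "a + 1"] by (simp add: n_def)
next
  case False
  then have eq: "a = nsum k i" using assms by (simp add: block_def)
  have i': "i + 1 \<in> {1..l + 1}" using assms by simp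
  then have "a + 1 \<in> block (i + 1)" using nsum_first[OF i'] eq by simp
  then show ?thesis
    using vertex_height_block[OF i', of "a + 1"] eq nsum_mono[of "i + 1" "l + 1" k] assms by (simp add: n_def)
qed

text \<open>The roofs are exactly the edges whose crossing segments end outside all boxes, sorted by the
  block of the column of their tails.\<close>

lemma roof_iff:
  assumes i: "i \<in> {1..l}"
  shows "e \<in> roof k l i \<longleftrightarrow> (\<exists>a\<in>block i. e = right_edge (a, vertex_height (a + 1)) \<or>
    (\<exists>c. e = down_edge (a, c) \<and> vertex_height (a + 1) < c \<and> c \<le> vertex_height a))"
proof -
  define x y where "x = nsum k (i - 1) + 1" and "y = n - nsum k i + 1"
  have i1: "i \<in> {1..l + 1}" "i + 1 \<in> {1..l + 1}" using i by auto
  have ki: "nsum k i = x - 1 + int (k i)" "k i \<ge> 1"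
    using i k_pos[of i] nsum_pred[of i k] by (auto simp: x_def)
  have ki1: "nsum k (i + 1) = nsum k i + int (k (i + 1))" "k (i + 1) \<ge> 1"
    using i k_pos[of "i + 1"] by (auto simp: nsum_Suc)
  have blk: "a \<in> block i \<longleftrightarrow> x \<le> a \<and> a \<le> x + int (k i) - 1" for a
    using ki by (auto simp: block_def x_def)
  have vertex_height_in: "vertex_height a = y - 1 + of_bool (a = x)" if "a \<in> block i" for a
    using vertex_height_block[OF i1(1) that] by (simp add: x_def y_def)
  have vertex_height_next: "vertex_height (x + int (k i) - 1 + 1) = y - int (k (i + 1))"
  proof -
    have eq: "x + int (k i) - 1 + 1 = nsum k (i + 1 - 1) + 1" using ki by simp
    then have "x + int (k i) - 1 + 1 \<in> block (i + 1)"
      using nsum_first[OF i1(2)] by simp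
    from vertex_height_block[OF i1(2) this] show ?thesis
      using eq ki1 by (simp add: y_def)
  qed
  have roof: "roof k l i = {down_edge (x, y)}
     \<union> {right_edge (x + int j, y - 1) | j. j < k i - 1}
     \<union> {down_edge (x + int (k i) - 1, y - 1 - int j) | j. j < k (i + 1) - 1}
     \<union> {right_edge (x + int (k i) - 1, y - int (k (i + 1)))}"
    by (simp add: roof_def s_vertex_def x_def y_def n_def)
  have vertex_height_inner: "vertex_height (a + 1) = y - 1" if "x \<le> a" "a < x + int (k i) - 1" for a
    using vertex_height_in[of "a + 1"] that by (simp add: blk)
  have last_blk: "x + int (k i) - 1 \<in> block i" and x_blk: "x \<in> block i"
    using ki by (auto simp: blk)
  show ?thesis
  proof
    assume "e \<in> roof k l i"
    then consider "e = down_edge (x, y)"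
      | j where "e = right_edge (x + int j, y - 1)" "j < k i - 1"
      | j where "e = down_edge (x + int (k i) - 1, y - 1 - int j)" "j < k (i + 1) - 1"
      | "e = right_edge (x + int (k i) - 1, y - int (k (i + 1)))"
      unfolding roof by blast
    then show "\<exists>a\<in>block i. e = right_edge (a, vertex_height (a + 1)) \<or>
      (\<exists>c. e = down_edge (a, c) \<and> vertex_height (a + 1) < c \<and> c \<le> vertex_height a)"
    proof cases
      case 1
      have "vertex_height (x + 1) < y"
      proof (cases "k i = 1")
        case True
        then show ?thesis using vertex_height_next ki1 by simp
      next
        case False
        then show ?thesis using vertex_height_inner[of x] ki by simp
      qed
      then show ?thesis
        using 1 x_blk vertex_height_in[OF x_blk] by auto
    next
      case (2 j)
      then have j: "x \<le> x + int j" "x + int j < x + int (k i) - 1" by auto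
      then have "x + int j \<in> block i" by (simp add: blk)
      moreover have "e = right_edge (x + int j, vertex_height (x + int j + 1))"
        using 2 vertex_height_inner[OF j] by simp
      ultimately show ?thesis by blast
    next
      case (3 j)
      have "vertex_height (x + int (k i) - 1 + 1) < y - 1 - int j" using vertex_height_next 3 by linarith
      moreover have "y - 1 - int j \<le> vertex_height (x + int (k i) - 1)" using vertex_height_in[OF last_blk] by simp
      ultimately show ?thesis using 3 last_blk by blast
    next
      case 4
      then show ?thesis using vertex_height_next last_blk by metis
    qed
  next
    assume "\<exists>a\<in>block i. e = right_edge (a, vertex_height (a + 1)) \<or>
      (\<exists>c. e = down_edge (a, c) \<and> vertex_height (a + 1) < c \<and> c \<le> vertex_height a)"
    then obtain a where a: "a \<in> block i"
      and e: "e = right_edge (a, vertex_height (a + 1)) \<or> (\<exists>c. e = down_edge (a, c) \<and> vertex_height (a + 1) < c \<and> c \<le> vertex_height a)"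
      by blast
    show "e \<in> roof k l i"
    proof (cases "a = x + int (k i) - 1")
      case True
      then have vertex_height_next': "vertex_height (a + 1) = y - int (k (i + 1))" using vertex_height_next by simp
      from e show ?thesis
      proof (elim disjE exE conjE)
        assume "e = right_edge (a, vertex_height (a + 1))"
        then show ?thesis unfolding roof using True vertex_height_next' by simp
      next
        fix c assume c: "e = down_edge (a, c)" "vertex_height (a + 1) < c" "c \<le> vertex_height a"
        show ?thesis
        proof (cases "c = y")
          case True
          then have "a = x" using c(3) vertex_height_in[OF a] by (auto split: if_splits)
          then show ?thesis unfolding roof using c True by simp
        next
          case False
          then have "c \<le> y - 1" using c(3) vertex_height_in[OF a] by (cases "a = x") auto
          then have "c = y - 1 - int (nat (y - 1 - c))" "nat (y - 1 - c) < k (i + 1) - 1"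
            using c(2) vertex_height_next' by auto
          then have "e = down_edge (x + int (k i) - 1, y - 1 - int (nat (y - 1 - c))) \<and> nat (y - 1 - c) < k (i + 1) - 1"
            using c(1) True by simp
          then show ?thesis unfolding roof by blast
        qed
      qed
    next
      case False
      then have a': "x \<le> a" "a < x + int (k i) - 1" using a by (auto simp: blk)
      from e show ?thesis
      proof (elim disjE exE conjE)
        assume "e = right_edge (a, vertex_height (a + 1))"
        then have "e = right_edge (x + int (nat (a - x)), y - 1)" "nat (a - x) < k i - 1"
          using vertex_height_inner[OF a'] a' by auto
        then show ?thesis unfolding roof by blast
      next
        fix c assume c: "e = down_edge (a, c)" "vertex_height (a + 1) < c" "c \<le> vertex_height a"
        then have ax: "a = x" using vertex_height_inner[OF a'] vertex_height_in[OF a] by (cases "a = x") auto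
        then have "c = y" using c vertex_height_inner[OF a'] vertex_height_in[OF a] by simp
        then show ?thesis unfolding roof using c ax by simp
      qed
    qed
  qed
qed

lemma card_roof:
  assumes i: "i \<in> {1..l}"
  shows "card (roof k l i) = k i + k (i + 1)"
proof -
  define x y where "x = nsum k (i - 1) + 1" and "y = n - nsum k i + 1"
  have ki: "k i \<ge> 1" "k (i + 1) \<ge> 1"
    using i k_pos[of i] k_pos[of "i + 1"] by auto
  let ?A = "{down_edge (x, y)}" and ?D = "{right_edge (x + int (k i) - 1, y - int (k (i + 1)))}"
  let ?B = "(\<lambda>j. right_edge (x + int j, y - 1)) ` {..<k i - 1}"
  let ?C = "(\<lambda>j. down_edge (x + int (k i) - 1, y - 1 - int j)) ` {..<k (i + 1) - 1}"
  have "roof k l i = (?A \<union> ?C) \<union> (?B \<union> ?D)"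
    unfolding roof_def s_vertex_def x_def y_def n_def by auto
  moreover have "card ?B = k i - 1" "card ?C = k (i + 1) - 1"
    by (subst card_image; auto simp: inj_on_def edge_eqs)+
  moreover have "card (?A \<union> ?C) = card ?A + card ?C"
    by (rule card_Un_disjoint) (auto simp: edge_eqs)
  moreover have "card (?B \<union> ?D) = card ?B + card ?D"
    using ki by (intro card_Un_disjoint) (auto simp: edge_eqs)
  moreover have "card ((?A \<union> ?C) \<union> (?B \<union> ?D)) = card (?A \<union> ?C) + card (?B \<union> ?D)"
    by (rule card_Un_disjoint) (auto simp: edge_eqs)
  ultimately show ?thesis using ki by simp
qed

section \<open>Edges and their crossing segments\<close>

definition head_index :: "edge \<Rightarrow> index" where
  "head_index e = W_head k l (crossing e)"

definition tail_index :: "edge \<Rightarrow> index" where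
  "tail_index e = W_tail k l (crossing e)"

definition indices :: "index set" where
  "indices = Roof ` {1..l} \<union> Box ` boxes k l"

lemma crossing_inj: "inj_on crossing (edges k l)"
proof (rule inj_onI)
  fix e e' assume "e \<in> edges k l" "e' \<in> edges k l" "crossing e = crossing e'"
  then show "e = e'"
    by (elim edges_cases) (auto simp: crossing_right crossing_down)
qed

lemma roof_subset_edges: "i \<in> {1..l} \<Longrightarrow> roof k l i \<subseteq> edges k l"
proof
  fix e assume i: "i \<in> {1..l}" and "e \<in> roof k l i"
  then obtain a where a: "a \<in> block i" and e: "e = right_edge (a, vertex_height (a + 1)) \<or>
    (\<exists>c. e = down_edge (a, c) \<and> vertex_height (a + 1) < c \<and> c \<le> vertex_height a)"
    using roof_iff[OF i] by blast
  have "1 \<le> a"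
    using a i block_bounds[of i a] by simp
  then show "e \<in> edges k l"
    using e vertex_height_Suc_pos[OF i a] by (auto simp: right_edge_iff down_edge_iff)
qed

lemma head_index_roof_edge:
  assumes "i \<in> {1..l}" "e \<in> roof k l i" "snd (crossing e) \<notin> boxes k l"
  shows "head_index e = Roof i"
proof -
  have "j = i" if j: "j \<in> {1..l}" "e' \<in> roof k l j" "crossing e' = crossing e" for j e'
  proof -
    have "e' = e"
      using j assms roof_subset_edges crossing_inj by (meson inj_onD subsetD)
    then obtain a b where ab: "a \<in> block i" "b \<in> block j"
      "fst (fst e) = a" "fst (fst e) = b"
      using j(2) assms(2) unfolding roof_iff[OF j(1)] roof_iff[OF assms(1)]
      by (auto simp: edge_eqs)
    then show ?thesis
      using block_unique[of j i a] j(1) assms(1) by auto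
  qed
  then have "(THE j. j \<in> {1..l} \<and> (\<exists>e'\<in>roof k l j. crossing e' = crossing e)) = i"
    using assms by (intro the_equality) blast+
  then show ?thesis
    using assms(3) by (simp add: head_index_def W_head_def)
qed

text \<open>Columns of the last block carry no squares, hence no roof edges.\<close>

lemma roof_column: assumes "1 \<le> a" "1 \<le> vertex_height (a + 1)" shows "a \<in> block (block_of a)" "block_of a \<in> {1..l}"
proof -
  have an: "a + 1 \<le> n" using assms by (auto simp: vertex_height_def split: if_splits)
  then have a: "a \<in> {1..n}" using assms by simp
  show "a \<in> block (block_of a)" using block_of[OF a] by simp
  have "block_of a \<noteq> l + 1"
  proof
    assume "block_of a = l + 1"
    then have "square_height a = 0" using square_height_block[of "l + 1" a] block_of[OF a] by (simp add: n_def)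
    then show False using assms vertex_height_Suc_le_square_height[of a] by simp
  qed
  then show "block_of a \<in> {1..l}" using block_of[OF a] by simp
qed

lemma vertex_height_Suc_pos_of_down_edge: assumes "1 \<le> a" "2 \<le> vertex_height a" shows "1 \<le> vertex_height (a + 1)"
proof -
  have a: "a \<in> {1..n}" using assms by (auto simp: vertex_height_def split: if_splits)
  have "block_of a \<noteq> l + 1"
  proof
    assume "block_of a = l + 1"
    then have "square_height a = 0" using square_height_block[of "l + 1" a] block_of[OF a] by (simp add: n_def)
    then show False using assms vertex_height_le_square_height[of a] by simp
  qed
  then have "block_of a \<in> {1..l}" using block_of[OF a] by simp
  then show ?thesis using vertex_height_Suc_pos block_of[OF a] by blast
qed

lemma head_index_right:
  assumes "1 \<le> a" "1 \<le> c" "c \<le> vertex_height (a + 1)"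
  shows "head_index (right_edge (a, c)) = (if c < vertex_height (a + 1) then Box (a, c) else Roof (block_of a))"
proof (cases "c < vertex_height (a + 1)")
  case True
  then show ?thesis
    using assms by (simp add: head_index_def W_head_def crossing_right boxes_iff)
next
  case False
  then have "c = vertex_height (a + 1)" using assms by simp
  then show ?thesis
    using False assms roof_column[of a]
    by (simp add: head_index_roof_edge[of "block_of a"] roof_iff crossing_right boxes_iff bexI[of _ a])
qed

lemma head_index_down:
  assumes "1 \<le> a" "2 \<le> c" "c \<le> vertex_height a"
  shows "head_index (down_edge (a, c)) =
    (if c \<le> vertex_height (a + 1) then Box (a, c - 1) else Roof (block_of a))"
proof (cases "c \<le> vertex_height (a + 1)")
  case True
  then show ?thesis
    using assms by (simp add: head_index_def W_head_def crossing_down boxes_iff)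
next
  case False
  have "1 \<le> vertex_height (a + 1)" using assms vertex_height_Suc_pos_of_down_edge[of a] by simp
  then have i: "block_of a \<in> {1..l}" "a \<in> block (block_of a)" using roof_column[of a] assms by auto
  have "down_edge (a, c) \<in> roof k l (block_of a)"
    unfolding roof_iff[OF i(1)] by (intro bexI[OF _ i(2)] disjI2 exI[of _ c]) (use False assms in auto)
  then show ?thesis
    using False assms head_index_roof_edge[OF i(1)] by (simp add: crossing_down boxes_iff)
qed

lemma tail_index_right:
  assumes "1 \<le> a" "1 \<le> c" "c \<le> vertex_height (a + 1)"
  shows "tail_index (right_edge (a, c)) = (if 2 \<le> c then Box (a, c - 1) else Zero)"
  using assms by (simp add: tail_index_def W_tail_def crossing_right boxes_iff)

lemma tail_index_down:
  assumes "1 \<le> a" "2 \<le> c" "c \<le> vertex_height a"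
  shows "tail_index (down_edge (a, c)) = (if 2 \<le> a then Box (a - 1, c - 1) else Zero)"
  using assms by (simp add: tail_index_def W_tail_def crossing_down boxes_iff)

lemma edge_head_in: "e \<in> edges k l \<Longrightarrow> head_index e \<in> indices"
proof (elim edges_cases)
  fix a c assume e: "e = right_edge (a, c)" "1 \<le> a" "1 \<le> c" "c \<le> vertex_height (a + 1)"
  then show "head_index e \<in> indices"
    using roof_column[of a] by (auto simp: head_index_right indices_def boxes_iff)
next
  fix a c assume e: "e = down_edge (a, c)" "1 \<le> a" "2 \<le> c" "c \<le> vertex_height a"
  then show "head_index e \<in> indices"
    using vertex_height_Suc_pos_of_down_edge[of a] roof_column[of a] by (auto simp: head_index_down indices_def boxes_iff)
qed

lemma edge_tail_in: "e \<in> edges k l \<Longrightarrow> tail_index e \<in> insert Zero indices"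
  by (auto simp: tail_index_def W_tail_def indices_def)

lemma Zero_notin_indices: "Zero \<notin> indices"
  by (auto simp: indices_def)

lemma finite_indices: "finite indices"
  by (simp add: indices_def finite_boxes)

text \<open>The coordinate sum of the center orders the boxes along the segments; roofs lie above all boxes.\<close>

definition index_rank :: "index \<Rightarrow> nat" where
  "index_rank j = (case j of Zero \<Rightarrow> 0 | Box b \<Rightarrow> nat (fst b + snd b) | Roof i \<Rightarrow> nat (2 * n + 1))"

lemma index_rank_less: "e \<in> edges k l \<Longrightarrow> index_rank (tail_index e) < index_rank (head_index e)"
proof (elim edges_cases)
  fix a c assume e: "e = right_edge (a, c)" "1 \<le> a" "1 \<le> c" "c \<le> vertex_height (a + 1)"
  then have "a + 1 \<le> n" "c \<le> n"
    using vertex_height_le_n[of "a + 1"] by (auto simp: vertex_height_def split: if_splits)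
  then show ?thesis
    using e by (simp add: head_index_right tail_index_right index_rank_def)
next
  fix a c assume e: "e = down_edge (a, c)" "1 \<le> a" "2 \<le> c" "c \<le> vertex_height a"
  then have "a \<le> n" "c \<le> n"
    using vertex_height_le_n[of a] by (auto simp: vertex_height_def split: if_splits)
  then show ?thesis
    using e by (simp add: head_index_down tail_index_down index_rank_def)
qed

lemma heads_Box:
  assumes "b \<in> boxes k l"
  shows "{e \<in> edges k l. head_index e = Box b} = corner b"
proof -
  obtain a c where b: "b = (a, c)" by (cases b)
  then have ac: "1 \<le> a" "1 \<le> c" "c < vertex_height (a + 1)" using assms by (auto simp: boxes_iff)
  show ?thesis
  proof
    show "{e \<in> edges k l. head_index e = Box b} \<subseteq> corner b"
    proof safe
      fix e assume "e \<in> edges k l" "head_index e = Box b"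
      then show "e \<in> corner b"
        by (elim edges_cases) (auto simp: head_index_right head_index_down b corner_def split: if_splits)
    qed
    show "corner b \<subseteq> {e \<in> edges k l. head_index e = Box b}"
      using ac vertex_height_Suc_le[of a]
      by (auto simp: b corner_def right_edge_iff down_edge_iff head_index_right head_index_down)
  qed
qed

lemma tails_Box:
  assumes "b \<in> boxes k l"
  shows "{e \<in> edges k l. tail_index e = Box b} = opp_corner b"
proof -
  obtain a c where b: "b = (a, c)" by (cases b)
  then have ac: "1 \<le> a" "1 \<le> c" "c < vertex_height (a + 1)" using assms by (auto simp: boxes_iff)
  show ?thesis
  proof
    show "{e \<in> edges k l. tail_index e = Box b} \<subseteq> opp_corner b"
    proof safe
      fix e assume "e \<in> edges k l" "tail_index e = Box b"
      then show "e \<in> opp_corner b"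
        by (elim edges_cases) (auto simp: tail_index_right tail_index_down b opp_corner_def split: if_splits)
    qed
    show "opp_corner b \<subseteq> {e \<in> edges k l. tail_index e = Box b}"
      using ac by (auto simp: b opp_corner_def right_edge_iff down_edge_iff tail_index_right tail_index_down)
  qed
qed

lemma tails_Roof: "{e \<in> edges k l. tail_index e = Roof i} = {}"
  by (auto simp: tail_index_def W_tail_def)

lemma heads_Roof:
  assumes i: "i \<in> {1..l}"
  shows "{e \<in> edges k l. head_index e = Roof i} = roof k l i"
proof
  show "{e \<in> edges k l. head_index e = Roof i} \<subseteq> roof k l i"
  proof safe
    fix e assume "e \<in> edges k l" and h: "head_index e = Roof i"
    then show "e \<in> roof k l i"
    proof (elim edges_cases)
      fix a c assume e: "e = right_edge (a, c)" "1 \<le> a" "1 \<le> c" "c \<le> vertex_height (a + 1)"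
      then have "c = vertex_height (a + 1)" "block_of a = i"
        using h by (auto simp: head_index_right split: if_splits)
      then show ?thesis
        using e roof_column[of a] unfolding roof_iff[OF i] by auto
    next
      fix a c assume e: "e = down_edge (a, c)" "1 \<le> a" "2 \<le> c" "c \<le> vertex_height a"
      then have "vertex_height (a + 1) < c" "block_of a = i"
        using h by (auto simp: head_index_down split: if_splits)
      moreover have "1 \<le> vertex_height (a + 1)" using e vertex_height_Suc_pos_of_down_edge[of a] by simp
      ultimately show ?thesis
        using e roof_column[of a] unfolding roof_iff[OF i] by auto
    qed
  qed
  show "roof k l i \<subseteq> {e \<in> edges k l. head_index e = Roof i}"
  proof
    fix e assume e: "e \<in> roof k l i"
    then have "e \<in> edges k l" using roof_subset_edges[OF i] by blast
    moreover have "snd (crossing e) \<notin> boxes k l"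
      using e unfolding roof_iff[OF i] by (auto simp: crossing_right crossing_down boxes_iff)
    ultimately show "e \<in> {e \<in> edges k l. head_index e = Roof i}"
      using head_index_roof_edge[OF i e] by simp
  qed
qed

lemma W_set_eq: "W_set k l = crossing ` edges k l"
proof -
  have "\<exists>v\<in>squares k l. crossing e \<in> sides v" if "e \<in> edges k l" for e
    using that
  proof (elim edges_cases)
    fix a c assume e: "e = right_edge (a, c)" "1 \<le> a" "1 \<le> c" "c \<le> vertex_height (a + 1)"
    then have "a + 1 \<le> n" by (auto simp: vertex_height_def split: if_splits)
    then have "(a, c) \<in> squares k l"
      using e vertex_height_Suc_le_square_height[of a] by (simp add: squares_iff)
    then show ?thesis
      using e by (intro bexI[of _ "(a, c)"]) (auto simp: sides_def crossing_right)
  next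
    fix a c assume e: "e = down_edge (a, c)" "1 \<le> a" "2 \<le> c" "c \<le> vertex_height a"
    then have "a \<le> n" by (auto simp: vertex_height_def split: if_splits)
    then have "(a, c - 1) \<in> squares k l"
      using e vertex_height_le_square_height[of a] by (simp add: squares_iff)
    then show ?thesis
      using e by (intro bexI[of _ "(a, c - 1)"]) (auto simp: sides_def crossing_down)
  qed
  then show ?thesis
    unfolding W_set_def by blast
qed

text \<open>A substitute for the Euler characteristic.  The map \<open>\<phi>\<close> sends a square to the right edge
  leaving it or, if there is none, to the down edge; \<open>\<psi>\<close> sends an index to a down edge with this
  head.  Together they reach every edge once.\<close>

lemma card_edges: "card (edges k l) = card (squares k l) + card indices"
proof -
  define \<phi> where "\<phi> v = (if snd v \<le> vertex_height (fst v + 1) then right_edge v else down_edge v)" for v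
  define \<psi> where "\<psi> j = (case j of Box b \<Rightarrow> down_edge (fst b, snd b + 1)
    | Roof i \<Rightarrow> down_edge (nsum k (i - 1) + 1, n - nsum k i + 1) | Zero \<Rightarrow> undefined)" for j
  have inj_\<phi>: "inj_on \<phi> (squares k l)"
    by (auto simp: inj_on_def \<phi>_def right_edge_def down_edge_def split: if_splits)
  have roof_top: "nsum k (i - 1) + 1 \<in> block i" "vertex_height (nsum k (i - 1) + 1) = n - nsum k i + 1"
    "square_height (nsum k (i - 1) + 1) = n - nsum k i" "n - nsum k i \<ge> 1" "1 \<le> nsum k (i - 1) + 1"
    if "i \<in> {1..l}" for i
  proof -
    have i: "i \<in> {1..l + 1}" using that by simp
    show blk: "nsum k (i - 1) + 1 \<in> block i" by (rule nsum_first[OF i])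
    show "vertex_height (nsum k (i - 1) + 1) = n - nsum k i + 1" using vertex_height_block[OF i blk] by simp
    show "square_height (nsum k (i - 1) + 1) = n - nsum k i" by (rule square_height_block[OF i blk])
    have "nsum k i < nsum k (l + 1)" using that by (intro nsum_less) auto
    then show "n - nsum k i \<ge> 1" by (simp add: n_def)
    show "1 \<le> nsum k (i - 1) + 1" using nsum_mono[of 0 "i - 1" k] by (simp add: nsum_0)
  qed
  have inj_\<psi>: "inj_on \<psi> indices"
  proof (rule inj_onI)
    fix j j' assume "j \<in> indices" "j' \<in> indices" "\<psi> j = \<psi> j'"
    moreover have "i = i'" if i: "i \<in> {1..l}" "i' \<in> {1..l}" "nsum k (i - 1) = nsum k (i' - 1)" for i i'
    proof -
      have "nsum k (i - 1) + 1 \<in> block i" "nsum k (i - 1) + 1 \<in> block i'"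
        using roof_top(1)[OF i(1)] roof_top(1)[OF i(2)] i(3) by auto
      then show ?thesis using i by (intro block_unique) auto
    qed
    moreover have no_box: "(nsum k (i - Suc 0) + 1, n - nsum k i) \<notin> boxes k l"
      if "Suc 0 \<le> i" "i \<le> l" for i
      using roof_top(3,5)[of i] that vertex_height_Suc_le_square_height[of "nsum k (i - 1) + 1"]
      by (auto simp: boxes_iff)
    ultimately show "j = j'"
      by (auto simp: indices_def \<psi>_def edge_eqs no_box)
  qed
  have "edges k l = \<phi> ` squares k l \<union> \<psi> ` indices"
  proof
    show "edges k l \<subseteq> \<phi> ` squares k l \<union> \<psi> ` indices"
    proof
      fix e assume "e \<in> edges k l"
      then show "e \<in> \<phi> ` squares k l \<union> \<psi> ` indices"
      proof (elim edges_cases)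
        fix a c assume e: "e = right_edge (a, c)" "1 \<le> a" "1 \<le> c" "c \<le> vertex_height (a + 1)"
        then have "a + 1 \<le> n" by (auto simp: vertex_height_def split: if_splits)
        then have "(a, c) \<in> squares k l"
          using e vertex_height_Suc_le_square_height[of a] by (simp add: squares_iff)
        moreover have "e = \<phi> (a, c)" using e by (simp add: \<phi>_def)
        ultimately show ?thesis by blast
      next
        fix a c assume e: "e = down_edge (a, c)" "1 \<le> a" "2 \<le> c" "c \<le> vertex_height a"
        then have an: "a \<in> {1..n}" by (auto simp: vertex_height_def split: if_splits)
        consider "c \<le> vertex_height (a + 1)" | "vertex_height (a + 1) < c" "c \<le> square_height a" | "square_height a < c"
          using vertex_height_Suc_le_square_height[of a] e by linarith
        then show ?thesis
        proof cases
          case 1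
          then have "(a, c - 1) \<in> boxes k l" using e by (simp add: boxes_iff)
          moreover have "e = \<psi> (Box (a, c - 1))" using e by (simp add: \<psi>_def)
          ultimately show ?thesis by (auto simp: indices_def)
        next
          case 2
          then have "(a, c) \<in> squares k l" using an e by (simp add: squares_iff)
          moreover have "e = \<phi> (a, c)" using 2 e by (simp add: \<phi>_def)
          ultimately show ?thesis by blast
        next
          case 3
          have i: "block_of a \<in> {1..l}" using roof_column[of a] vertex_height_Suc_pos_of_down_edge[of a] e by simp
          have c: "c = square_height a + 1" "a = nsum k (block_of a - 1) + 1"
            using 3 e(4) an by (cases "a = nsum k (block_of a - 1) + 1"; simp add: vertex_height_def)+
          have "e = \<psi> (Roof (block_of a))"
            using e c an by (simp add: \<psi>_def square_height_def)
          then show ?thesis using i by (auto simp: indices_def)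
        qed
      qed
    qed
    have "\<phi> v \<in> edges k l" if "v \<in> squares k l" for v
    proof -
      obtain a c where v: "v = (a, c)" by (cases v)
      then have ac: "a \<in> {1..n}" "1 \<le> c" "c \<le> square_height a" using that by (auto simp: squares_iff)
      show ?thesis
      proof (cases "c \<le> vertex_height (a + 1)")
        case True
        then show ?thesis using ac by (simp add: v \<phi>_def right_edge_iff)
      next
        case False
        have "block_of a \<noteq> l + 1"
          using ac by (auto simp: square_height_def n_def)
        then have "1 \<le> vertex_height (a + 1)"
          using vertex_height_Suc_pos[of "block_of a" a] block_of[OF ac(1)] by simp
        then show ?thesis
          using False ac square_height_le_vertex_height[of a] by (simp add: v \<phi>_def down_edge_iff)
      qed
    qed
    moreover have "\<psi> j \<in> edges k l" if "j \<in> indices" for j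
      using that vertex_height_Suc_le roof_top
      by (force simp: indices_def \<psi>_def down_edge_iff boxes_iff)
    ultimately show "\<phi> ` squares k l \<union> \<psi> ` indices \<subseteq> edges k l" by blast
  qed
  moreover have "\<phi> ` squares k l \<inter> \<psi> ` indices = {}"
  proof -
    have "\<phi> v \<noteq> \<psi> j" if "v \<in> squares k l" "j \<in> indices" for v j
    proof
      assume eq: "\<phi> v = \<psi> j"
      obtain a c where v: "v = (a, c)" by (cases v)
      show False
        using that(2)
        unfolding indices_def
      proof (elim UnE imageE)
        fix i assume i: "j = Roof i" "i \<in> {1..l}"
        then show False
          using eq that(1) roof_top(3)[OF i(2)]
          by (auto simp: v \<phi>_def \<psi>_def edge_eqs squares_iff split: if_splits)
      next
        fix b assume "j = Box b" "b \<in> boxes k l"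
        then show False
          using eq by (cases b) (auto simp: v \<phi>_def \<psi>_def edge_eqs boxes_iff split: if_splits)
      qed
    qed
    then show ?thesis by blast
  qed
  ultimately have "card (edges k l) = card (\<phi> ` squares k l) + card (\<psi> ` indices)"
    using finite_squares finite_indices by (simp add: card_Un_disjoint)
  then show ?thesis
    using inj_\<phi> inj_\<psi> by (simp add: card_image)
qed

section \<open>Flows on the graph\<close>

text \<open>At most four edges meet at a square, two arriving and two leaving; \<open>X\<close> vanishes on those that
  are missing.\<close>

lemma flow_conservation:
  fixes X :: "edge \<Rightarrow> real"
  assumes X0: "\<And>e. e \<notin> edges k l \<Longrightarrow> X e = 0"
    and flow: "(\<Sum>e\<in>edges k l. X e * delta k l e (a, c)) = 0"
    and v: "(a, c) \<in> squares k l"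
  shows "X (right_edge (a - 1, c)) + X (down_edge (a, c + 1)) =
    X (right_edge (a, c)) + X (down_edge (a, c))"
proof -
  have ends: "e = right_edge (fst e) \<or> e = down_edge (fst e)" if "e \<in> edges k l" for e
    using that by (auto simp: edges_def)
  have "(\<Sum>e\<in>edges k l. X e * of_bool ((a, c) = snd e)) =
      (\<Sum>e\<in>{right_edge (a - 1, c), down_edge (a, c + 1)}. X e)"
  proof (rule sum.mono_neutral_cong)
    fix e assume e: "e \<in> edges k l - {right_edge (a - 1, c), down_edge (a, c + 1)}"
    then have "snd e \<noteq> (a, c)"
      using ends[of e] by (cases e) (auto simp: right_edge_def down_edge_def)
    then show "X e * of_bool ((a, c) = snd e) = 0" by auto
  qed (auto simp: finite_edges X0 edge_eqs)
  also have "\<dots> = X (right_edge (a - 1, c)) + X (down_edge (a, c + 1))"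
    by (simp add: edge_eqs)
  finally have inflow: "(\<Sum>e\<in>edges k l. X e * of_bool ((a, c) = snd e)) =
      X (right_edge (a - 1, c)) + X (down_edge (a, c + 1))" .
  have "(\<Sum>e\<in>edges k l. X e * of_bool ((a, c) = fst e)) =
      (\<Sum>e\<in>{right_edge (a, c), down_edge (a, c)}. X e)"
  proof (rule sum.mono_neutral_cong)
    fix e assume e: "e \<in> edges k l - {right_edge (a, c), down_edge (a, c)}"
    then have "fst e \<noteq> (a, c)"
      using ends[of e] by auto
    then show "X e * of_bool ((a, c) = fst e) = 0" by auto
  qed (auto simp: finite_edges X0 edge_eqs)
  also have "\<dots> = X (right_edge (a, c)) + X (down_edge (a, c))"
    by (simp add: edge_eqs)
  finally have outflow: "(\<Sum>e\<in>edges k l. X e * of_bool ((a, c) = fst e)) =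
      X (right_edge (a, c)) + X (down_edge (a, c))" .
  have "(\<Sum>e\<in>edges k l. X e * delta k l e (a, c)) =
      (\<Sum>e\<in>edges k l. X e * of_bool ((a, c) = snd e)) - (\<Sum>e\<in>edges k l. X e * of_bool ((a, c) = fst e))"
    using v by (simp add: delta_def right_diff_distrib sum_subtractf)
  then show ?thesis
    using flow inflow outflow by simp
qed

text \<open>The potential of a lattice point is the flow through the vertical line below it.  By conservation
  it also accounts for the flow through horizontal segments.  Along the rim of the region of boxes it
  is constant within a block, because there are no edges outside the roof; this constant is the
  potential of the roof.\<close>

lemma flow_potential:
  fixes X :: "edge \<Rightarrow> real"
  assumes X0: "\<And>e. e \<notin> edges k l \<Longrightarrow> X e = 0"
    and flow: "\<And>v. v \<in> squares k l \<Longrightarrow> (\<Sum>e\<in>edges k l. X e * delta k l e v) = 0"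
  shows "\<exists>m. m Zero = 0 \<and> (\<forall>e\<in>edges k l. X e = m (head_index e) - m (tail_index e))"
proof -
  \<comment> \<open>The potential at the lattice point \<open>(a, c)\<close>, zero on the left and lower sides of the diagram.\<close>
  define \<mu> where "\<mu> a c = (\<Sum>c'\<in>{1..c}. X (right_edge (a, c')))" for a c
  have up: "\<mu> a c = \<mu> a (c - 1) + X (right_edge (a, c))" if "1 \<le> c" for a c
  proof -
    have "{1..c} = insert c {1..c - 1}" using that by auto
    then show ?thesis by (simp add: \<mu>_def)
  qed
  have across: "\<mu> a c = \<mu> (a - 1) c + X (down_edge (a, c + 1))"
    if "0 \<le> c" "c \<le> square_height a" "a \<in> {1..n}" for a c
    using that(1,2)
  proof (induction c rule: int_ge_induct)
    case base
    then show ?case by (simp add: \<mu>_def X0 down_edge_iff)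
  next
    case (step c)
    have "(a, c + 1) \<in> squares k l"
      using step that(3) by (simp add: squares_iff)
    from flow_conservation[OF X0 flow[OF this] this] show ?case
      using step up[of "c + 1" a] up[of "c + 1" "a - 1"] by simp
  qed
  have above_rim: "\<mu> a c = \<mu> a (vertex_height (a + 1))" if "1 \<le> a" "vertex_height (a + 1) \<le> c" "0 \<le> vertex_height (a + 1)" for a c
    using that(2)
  proof (induction c rule: int_ge_induct)
    case (step c)
    then show ?case
      using up[of "c + 1" a] that by (simp add: X0 right_edge_iff)
  qed simp
  have vh0: "0 \<le> vertex_height a" for a
    using square_height_nonneg[of a] square_height_le_vertex_height[of a] by linarith
  have rim: "\<mu> a (vertex_height (a + 1)) = \<mu> (nsum k (i - 1) + 1) (vertex_height (nsum k (i - 1) + 1 + 1))"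
    if i: "i \<in> {1..l}" and a: "a \<in> block i" for a i
  proof -
    have "nsum k (i - 1) + 1 \<le> a" "a \<le> nsum k i" using a by (auto simp: block_def)
    then show ?thesis
    proof (induction a rule: int_ge_induct)
      case (step a)
      have i': "i \<in> {1..l + 1}" using i by simp
      have blk: "a + 1 \<in> block i" using step by (simp add: block_def)
      have a1: "1 \<le> a" "a + 1 \<in> {1..n}"
        using step.hyps nsum_mono[of 0 "i - 1" k] block_bounds[OF i' blk] by (auto simp: nsum_0)
      have eq: "vertex_height (a + 1) = square_height (a + 1)"
        using vertex_height_block[OF i' blk] square_height_block[OF i' blk] step by simp
      have "\<mu> (a + 1) (vertex_height (a + 1)) = \<mu> a (vertex_height (a + 1)) + X (down_edge (a + 1, vertex_height (a + 1) + 1))"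
        using across[OF square_height_nonneg order_refl a1(2)] eq by simp
      also have "X (down_edge (a + 1, vertex_height (a + 1) + 1)) = 0"
        by (simp add: X0 down_edge_iff)
      finally have "\<mu> (a + 1) (vertex_height (a + 1)) = \<mu> a (vertex_height (a + 1))" by simp
      moreover have "\<mu> (a + 1) (vertex_height (a + 1)) = \<mu> (a + 1) (vertex_height (a + 1 + 1))"
        using a1 vh0 vertex_height_Suc_le[of "a + 1"] by (intro above_rim) auto
      ultimately show ?case using step by simp
    qed simp
  qed
  define m where "m j = (case j of Zero \<Rightarrow> 0 | Box b \<Rightarrow> \<mu> (fst b) (snd b)
    | Roof i \<Rightarrow> \<mu> (nsum k (i - 1) + 1) (vertex_height (nsum k (i - 1) + 1 + 1)))" for j
  have m_Roof: "m (Roof (block_of a)) = \<mu> a (vertex_height (a + 1))" if "1 \<le> a" "1 \<le> vertex_height (a + 1)" for a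
    using rim[of "block_of a" a] roof_column[OF that] by (simp add: m_def)
  have "X e = m (head_index e) - m (tail_index e)" if "e \<in> edges k l" for e
    using that
  proof (elim edges_cases)
    fix a c assume e: "e = right_edge (a, c)" "1 \<le> a" "1 \<le> c" "c \<le> vertex_height (a + 1)"
    have "m (head_index e) = \<mu> a c"
      using e m_Roof[of a] by (auto simp: head_index_right) (simp add: m_def)
    moreover have "m (tail_index e) = \<mu> a (c - 1)"
      using e by (auto simp: tail_index_right m_def \<mu>_def)
    ultimately show ?thesis using up[of c a] e by simp
  next
    fix a c assume e: "e = down_edge (a, c)" "1 \<le> a" "2 \<le> c" "c \<le> vertex_height a"
    then have an: "a \<in> {1..n}" by (auto simp: vertex_height_def split: if_splits)
    have pos: "1 \<le> vertex_height (a + 1)" using e vertex_height_Suc_pos_of_down_edge[of a] by simp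
    have "m (head_index e) = \<mu> a (c - 1)"
    proof (cases "c \<le> vertex_height (a + 1)")
      case True
      then show ?thesis using e by (simp add: head_index_down m_def)
    next
      case False
      then show ?thesis
        using e m_Roof[OF e(2) pos] above_rim[of a "c - 1"] pos by (simp add: head_index_down)
    qed
    moreover have "m (tail_index e) = \<mu> (a - 1) (c - 1)"
      using e by (auto simp: tail_index_down m_def \<mu>_def X0 right_edge_iff)
    moreover have "c - 1 \<le> square_height a" using e vertex_height_le_square_height[of a] by simp
    ultimately show ?thesis using across[of "c - 1" a] e an by simp
  qed
  then show ?thesis
    by (intro exI[of _ m]) (simp add: m_def)
qed

end

section \<open>The period of the ladder variety\<close>

context ladder
begin

lemma indices_cases:
  assumes "j \<in> indices"
  obtains (Roof) i where "j = Roof i" "i \<in> {1..l}" | (Box) b where "j = Box b" "b \<in> boxes k l"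
  using assms by (auto simp: indices_def)

lemma prod_indices:
  fixes f :: "index \<Rightarrow> 'a::comm_monoid_mult"
  shows "prod f indices = (\<Prod>i=1..l. f (Roof i)) * (\<Prod>b\<in>boxes k l. f (Box b))"
  unfolding indices_def
  by (subst prod.union_disjoint) (auto simp: finite_boxes prod.reindex inj_on_def)

lemma card_corner: "card (corner b) = 2" and card_opp_corner: "card (opp_corner b) = 2"
  by (auto simp: corner_def opp_corner_def edge_eqs split: prod.splits)

text \<open>Write the binomial coefficients in factorials.  The factorials of the heads multiply to powers
  with the cardinalities of roofs and corners as exponents, those of the tails to the second
  powers for the boxes.  So only the roof powers survive, and they cancel against the definition of \<open>A_coeff\<close>.\<close>

lemma coefficient_eq:
  assumes m: "m \<in> multi_indices k l"
  shows "A_coeff k l m = (\<Prod>e\<in>edges k l.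
    of_bool (m (tail_index e) \<le> m (head_index e)) / fact (m (head_index e) - m (tail_index e)))"
proof -
  let ?f = "\<lambda>j. fact (m j) :: complex"
  have mz: "m Zero = 0"
    using m Zero_notin_indices by (auto simp: multi_indices_def indices_def)
  have heads: "(\<Prod>e\<in>edges k l. ?f (head_index e)) =
      (\<Prod>i=1..l. ?f (Roof i) ^ (k i + k (i + 1))) * (\<Prod>b\<in>boxes k l. ?f (Box b) ^ 2)"
  proof -
    have "(\<Prod>e\<in>edges k l. ?f (head_index e)) =
        (\<Prod>j\<in>indices. \<Prod>e\<in>{e \<in> edges k l. head_index e = j}. ?f (head_index e))"
      using finite_edges finite_indices edge_head_in by (intro prod.group[symmetric]) auto
    also have "\<dots> = (\<Prod>j\<in>indices. ?f j ^ card {e \<in> edges k l. head_index e = j})"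
      by (intro prod.cong) auto
    also have "\<dots> = (\<Prod>i=1..l. ?f (Roof i) ^ (k i + k (i + 1))) * (\<Prod>b\<in>boxes k l. ?f (Box b) ^ 2)"
      unfolding prod_indices
      by (intro arg_cong2[of _ _ _ _ "(*)"] prod.cong refl)
        (simp_all only: heads_Roof card_roof heads_Box card_corner)
    finally show ?thesis .
  qed
  have tails: "(\<Prod>e\<in>edges k l. ?f (tail_index e)) = (\<Prod>b\<in>boxes k l. ?f (Box b) ^ 2)"
  proof -
    have "(\<Prod>e\<in>edges k l. ?f (tail_index e)) =
        (\<Prod>j\<in>insert Zero indices. \<Prod>e\<in>{e \<in> edges k l. tail_index e = j}. ?f (tail_index e))"
      using finite_edges finite_indices edge_tail_in by (intro prod.group[symmetric]) auto
    also have "\<dots> = (\<Prod>j\<in>insert Zero indices. ?f j ^ card {e \<in> edges k l. tail_index e = j})"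
      by (intro prod.cong) auto
    also have "\<dots> = (\<Prod>j\<in>indices. ?f j ^ card {e \<in> edges k l. tail_index e = j})"
      using Zero_notin_indices finite_indices by (simp add: mz)
    also have "\<dots> = (\<Prod>i=1..l. 1) * (\<Prod>b\<in>boxes k l. ?f (Box b) ^ 2)"
      unfolding prod_indices
      by (intro arg_cong2[of _ _ _ _ "(*)"] prod.cong refl)
        (simp_all only: tails_Roof tails_Box card_opp_corner card.empty power_0)
    finally show ?thesis by simp
  qed
  have choose: "complex_of_nat (a choose b) = fact a / fact b * (of_bool (b \<le> a) / fact (a - b))" for a b
    by (simp add: binomial_fact)
  have "complex_of_nat (B_coeff k l m) =
      (\<Prod>e\<in>edges k l. of_nat (m (head_index e) choose m (tail_index e)))"
    unfolding B_coeff_def W_set_eq prod.reindex[OF crossing_inj] by (simp add: head_index_def tail_index_def)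
  also have "\<dots> = (\<Prod>e\<in>edges k l. ?f (head_index e) / ?f (tail_index e) *
      (of_bool (m (tail_index e) \<le> m (head_index e)) / fact (m (head_index e) - m (tail_index e))))"
    by (intro prod.cong refl choose)
  also have "\<dots> = (\<Prod>e\<in>edges k l. ?f (head_index e)) / (\<Prod>e\<in>edges k l. ?f (tail_index e)) *
      (\<Prod>e\<in>edges k l. of_bool (m (tail_index e) \<le> m (head_index e)) / fact (m (head_index e) - m (tail_index e)))"
    by (simp only: prod.distrib prod_dividef)
  also have "(\<Prod>e\<in>edges k l. ?f (head_index e)) / (\<Prod>e\<in>edges k l. ?f (tail_index e)) =
      (\<Prod>i=1..l. ?f (Roof i) ^ (k i + k (i + 1)))"
    unfolding heads tails using finite_boxes by simp
  finally show ?thesis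
    by (simp add: A_coeff_def prod_dividef)
qed

end

text \<open>The combinatorial data of a maximal cone.\<close>

locale ladder_cone = ladder +
  fixes G\<^sub>0 :: "edge set"
  assumes G0_subset: "G\<^sub>0 \<subseteq> edges k l"
    and roof_omit: "\<And>i. i \<in> {1..l} \<Longrightarrow> card (roof k l i - G\<^sub>0) = 1"
    and corner_omit: "\<And>b. b \<in> boxes k l \<Longrightarrow> card (corner b - G\<^sub>0) = 1"
begin

definition omitted :: "index \<Rightarrow> edge" where
  "omitted j = (THE e. e \<in> edges k l \<and> head_index e = j \<and> e \<notin> G\<^sub>0)"

lemma omitted_ex1:
  assumes "j \<in> indices" shows "\<exists>!e. e \<in> edges k l \<and> head_index e = j \<and> e \<notin> G\<^sub>0"
proof -
  have "card ({e \<in> edges k l. head_index e = j} - G\<^sub>0) = 1"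
    using assms by (cases rule: indices_cases) (simp_all only: heads_Roof heads_Box roof_omit corner_omit)
  then obtain e where e: "{e \<in> edges k l. head_index e = j} - G\<^sub>0 = {e}"
    by (rule card_1_singletonE)
  have "e' \<in> edges k l \<and> head_index e' = j \<and> e' \<notin> G\<^sub>0 \<longleftrightarrow> e' \<in> {e}" for e'
    unfolding e[symmetric] by blast
  then show ?thesis by simp
qed

lemma omitted: assumes "j \<in> indices"
  shows "omitted j \<in> edges k l" "head_index (omitted j) = j" "omitted j \<notin> G\<^sub>0"
  using theI'[OF omitted_ex1[OF assms]] by (auto simp: omitted_def)

lemma omitted_eq: "e \<in> edges k l \<Longrightarrow> e \<notin> G\<^sub>0 \<Longrightarrow> omitted (head_index e) = e"
  using omitted omitted_ex1 edge_head_in by blast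

sublocale cycle_system "edges k l" indices head_index tail_index Zero index_rank omitted
  by unfold_locales
    (use finite_edges finite_indices Zero_notin_indices edge_head_in edge_tail_in index_rank_less omitted
      in auto)

lemma G_eq_G0: "G = G\<^sub>0"
  using G0_subset omitted omitted_eq edge_head_in unfolding G_def by (auto, metis image_eqI)

lemma card_G: "card G = card (squares k l)"
proof -
  have sub: "omitted ` indices \<subseteq> edges k l"
    using omitted by blast
  then have "card (edges k l) = card (omitted ` indices) + card G"
    unfolding G_def using card_mono[OF finite_edges sub]
    by (simp add: card_Diff_subset finite_indices)
  then show ?thesis
    using card_edges by (simp add: card_image inj_on_omit)
qed

lemma card_heads_ge_2: assumes "j \<in> indices" shows "card (heads j) \<ge> 2"
  using assms
proof (cases rule: indices_cases)
  case (Roof i)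
  then show ?thesis
    using card_roof[of i] heads_Roof[of i] k_pos[of i] k_pos[of "i + 1"] by (simp add: heads_def)
next
  case (Box b)
  then show ?thesis using heads_Box[of b] by (simp add: heads_def card_corner)
qed

text \<open>Suppose that \<open>\<delta> e\<close>, for an omitted edge \<open>e\<close>, is a nonnegative combination of the kept
  \<open>\<delta> g\<close>.  Then the difference is a flow that is 1 at \<open>e\<close>, nonpositive at kept edges and zero at the
  other omitted edges.  Its potential is positive on the other edges with the same head as \<open>e\<close>,
  and there is at least one of these.\<close>

lemma cone_edges_eq: "cone_edges k l (cone_of (delta k l ` G\<^sub>0)) = G\<^sub>0"
proof
  have fin: "finite G\<^sub>0" using G0_subset finite_edges finite_subset by blast
  show "G\<^sub>0 \<subseteq> cone_edges k l (cone_of (delta k l ` G\<^sub>0))"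
  proof
    fix e assume e: "e \<in> G\<^sub>0"
    have "delta k l e = (\<lambda>v. \<Sum>a\<in>delta k l ` G\<^sub>0. of_bool (a = delta k l e) * a v)"
    proof
      fix v
      have "(\<Sum>a\<in>delta k l ` G\<^sub>0. of_bool (a = delta k l e) * a v) = (\<Sum>a\<in>{delta k l e}. a v)"
        using fin e by (intro sum.mono_neutral_cong_right) auto
      then show "delta k l e v = (\<Sum>a\<in>delta k l ` G\<^sub>0. of_bool (a = delta k l e) * a v)" by simp
    qed
    then have "delta k l e \<in> cone_of (delta k l ` G\<^sub>0)"
      unfolding cone_of_def by (intro CollectI exI[of _ "\<lambda>a. of_bool (a = delta k l e)"]) auto
    then show "e \<in> cone_edges k l (cone_of (delta k l ` G\<^sub>0))"
      using e G0_subset by (auto simp: cone_edges_def)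
  qed
  show "cone_edges k l (cone_of (delta k l ` G\<^sub>0)) \<subseteq> G\<^sub>0"
  proof (rule subsetI, rule ccontr)
    fix e assume "e \<in> cone_edges k l (cone_of (delta k l ` G\<^sub>0))" and notin: "e \<notin> G\<^sub>0"
    then obtain c where e: "e \<in> edges k l"
      and c: "delta k l e = (\<lambda>v. \<Sum>a\<in>delta k l ` G\<^sub>0. c a * a v)" "\<forall>a\<in>delta k l ` G\<^sub>0. 0 \<le> c a"
      by (auto simp: cone_edges_def cone_of_def)
    \<comment> \<open>The cone is generated by a set of vectors; choosing one edge for each vector turns sums over
      vectors into sums over edges.\<close>
    obtain G' where G': "G' \<subseteq> G\<^sub>0" "inj_on (delta k l) G'" "delta k l ` G\<^sub>0 = delta k l ` G'"
      by (meson subset_image_inj order_refl)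
    define X where "X e' = (if e' = e then 1 else if e' \<in> G' then - c (delta k l e') else 0)" for e'
    have X0: "X e' = 0" if "e' \<notin> edges k l" for e'
      using that e G' G0_subset by (auto simp: X_def)
    have flow: "(\<Sum>e'\<in>edges k l. X e' * delta k l e' v) = 0" for v
    proof -
      have "e \<notin> G'" using notin G' by blast
      have "(\<Sum>e'\<in>edges k l. X e' * delta k l e' v) = (\<Sum>e'\<in>insert e G'. X e' * delta k l e' v)"
        using finite_edges e G' G0_subset by (intro sum.mono_neutral_right) (auto simp: X_def)
      also have "\<dots> = delta k l e v + (\<Sum>e'\<in>G'. X e' * delta k l e' v)"
        using \<open>e \<notin> G'\<close> finite_subset[OF G'(1) fin] by (simp add: X_def)
      also have "(\<Sum>e'\<in>G'. X e' * delta k l e' v) = (\<Sum>e'\<in>G'. - (c (delta k l e') * delta k l e' v))"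
        using \<open>e \<notin> G'\<close> by (intro sum.cong) (auto simp: X_def)
      also have "\<dots> = - (\<Sum>a\<in>delta k l ` G'. c a * a v)"
        by (simp add: sum.reindex[OF G'(2)] sum_negf)
      also have "\<dots> = - delta k l e v"
        by (simp add: c(1) G'(3))
      finally show ?thesis by simp
    qed
    obtain m where m: "m Zero = 0" "\<And>e'. e' \<in> edges k l \<Longrightarrow> X e' = m (head_index e') - m (tail_index e')"
      using flow_potential[OF X0 flow] by blast
    define j where "j = head_index e"
    have j: "j \<in> indices" using e edge_head_in by (simp add: j_def)
    have om_j: "omitted j = e" using omitted_eq[OF e notin] by (simp add: j_def)
    have "\<not> heads j \<subseteq> {e}"
      using card_heads_ge_2[OF j] card_mono[of "{e}" "heads j"] by auto
    then obtain f where f: "f \<in> edges k l" "head_index f = j" "f \<noteq> e"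
      by (auto simp: heads_def)
    have "m (head_index f) - m (tail_index f) > 0"
    proof (rule potential_positive[where j = j])
      show "m Zero = 0" "j \<in> indices" "f \<in> edges k l" "head_index f = j"
        by (fact m(1) j f(1,2))+
      show "m i = m (tail_index (omitted i))" if "i \<in> indices" "i \<noteq> j" for i
      proof -
        have "omitted i \<noteq> e" using om_j that inj_on_omit j by (metis inj_onD)
        moreover have "omitted i \<notin> G'" using omitted(3)[OF that(1)] G' by blast
        ultimately have "X (omitted i) = 0" by (simp add: X_def)
        then show ?thesis using m(2)[OF omitted(1)[OF that(1)]] omitted(2)[OF that(1)] by simp
      qed
      show "0 < m j - m (tail_index (omitted j))"
        using m(2)[OF e] om_j by (simp add: X_def j_def)
    qed
    moreover have "X f \<le> 0"
      using f c(2) G' by (auto simp: X_def)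
    ultimately show False using m(2)[OF f(1)] by simp
  qed
qed

end

locale ladder_period = ladder_cone +
  fixes q :: "nat \<Rightarrow> complex" and qt :: "pt \<Rightarrow> complex" and es gs :: "edge list" and bs :: "pt list"
  assumes q: "\<And>i. i \<in> {1..l} \<Longrightarrow> q i \<noteq> 0" and qt: "\<And>b. b \<in> boxes k l \<Longrightarrow> qt b \<noteq> 0"
    and es: "distinct es" "set es = edges k l" and bs: "distinct bs" "set bs = boxes k l"
    and gs: "distinct gs" "set gs = G\<^sub>0"
begin

abbreviation \<sigma> where "\<sigma> \<equiv> cone_of (delta k l ` G\<^sub>0)"

definition param :: "index \<Rightarrow> complex" where
  "param j = (case j of Roof i \<Rightarrow> q i | Box b \<Rightarrow> qt b | Zero \<Rightarrow> 1)"

lemma param_nonzero: "j \<in> indices \<Longrightarrow> param j \<noteq> 0"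
  by (cases rule: indices_cases) (auto simp: param_def q qt)

lemma relation_Roof: "i \<in> {1..l} \<Longrightarrow> relation param (Roof i) = F_eq k l q i"
  by (rule ext) (simp only: relation_def F_eq_def heads_def tails_def heads_Roof tails_Roof param_def
      index.case prod.empty mult_1_right)

lemma relation_Box: "b \<in> boxes k l \<Longrightarrow> relation param (Box b) = G_eq qt b"
  by (rule ext) (simp only: relation_def G_eq_def heads_def tails_def heads_Box tails_Box param_def index.case)

lemma M_variety_iff:
  "y \<in> M_variety k l q qt \<longleftrightarrow> y \<in> affine_space (edges k l) \<and> (\<forall>j\<in>indices. relation param j y = 0)"
proof -
  have "(\<forall>j\<in>indices. relation param j y = 0) \<longleftrightarrow>
      (\<forall>i\<in>{1..l}. relation param (Roof i) y = 0) \<and> (\<forall>b\<in>boxes k l. relation param (Box b) y = 0)"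
    unfolding indices_def by blast
  also have "\<dots> \<longleftrightarrow> (\<forall>i\<in>{1..l}. F_eq k l q i y = 0) \<and> (\<forall>b\<in>boxes k l. G_eq qt b y = 0)"
    by (intro arg_cong2[of _ _ _ _ "(\<and>)"] ball_cong refl) (simp_all only: relation_Roof relation_Box)
  finally show ?thesis
    by (simp add: M_variety_def)
qed

text \<open>The logarithms of the constants and the exponents in the monomial parametrization of the torus by
  the angles of the kept coordinates.\<close>

definition log_shift :: "edge \<Rightarrow> complex" where
  "log_shift = (SOME x. (\<forall>g\<in>G. x g = 0) \<and>
     (\<forall>j\<in>indices. sum x (heads j) = Ln (param j) + sum x (tails j)))"

definition exponent :: "edge \<Rightarrow> edge \<Rightarrow> real" where
  "exponent e h = (SOME x. (\<forall>g\<in>G. x g = of_bool (g = h)) \<and>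
     (\<forall>j\<in>indices. sum x (heads j) = 0 + sum x (tails j))) e"

lemma log_shift: "g \<in> G \<Longrightarrow> log_shift g = 0"
  "j \<in> indices \<Longrightarrow> sum log_shift (heads j) = Ln (param j) + sum log_shift (tails j)"
  using someI_ex[OF relations_solvable[of "\<lambda>_. 0" "\<lambda>j. Ln (param j)"]] unfolding log_shift_def by blast+

lemma exponent: "g \<in> G \<Longrightarrow> exponent g h = of_bool (g = h)"
  "j \<in> indices \<Longrightarrow> (\<Sum>e\<in>heads j. exponent e h) = (\<Sum>e\<in>tails j. exponent e h)"
proof -
  have "(\<forall>g\<in>G. exponent g h = of_bool (g = h)) \<and>
      (\<forall>j\<in>indices. (\<Sum>e\<in>heads j. exponent e h) = 0 + (\<Sum>e\<in>tails j. exponent e h))"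
    unfolding exponent_def by (rule someI_ex[OF relations_solvable])
  then show "g \<in> G \<Longrightarrow> exponent g h = of_bool (g = h)"
    "j \<in> indices \<Longrightarrow> (\<Sum>e\<in>heads j. exponent e h) = (\<Sum>e\<in>tails j. exponent e h)"
    by (blast, metis add_0)
qed

definition log_coord :: "(edge \<Rightarrow> real) \<Rightarrow> edge \<Rightarrow> complex" where
  "log_coord = (\<lambda>\<theta> e. log_shift e + \<i> * of_real (\<Sum>h\<in>G. exponent e h * \<theta> h))"

definition coord :: "(edge \<Rightarrow> real) \<Rightarrow> edge \<Rightarrow> complex" where
  "coord \<theta> e = (if e \<in> edges k l then exp (log_coord \<theta> e) else 0)"

lemma log_coord_relation:
  "j \<in> indices \<Longrightarrow> sum (log_coord \<theta>) (heads j) = Ln (param j) + sum (log_coord \<theta>) (tails j)"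
  unfolding log_coord_def by (intro affine_log_relation log_shift exponent)

lemma log_coord_G: "g \<in> G \<Longrightarrow> log_coord \<theta> g = \<i> * of_real (\<theta> g)"
  unfolding log_coord_def by (intro affine_log_on_G log_shift exponent)

lemma coord_nonzero: "e \<in> edges k l \<Longrightarrow> coord \<theta> e \<noteq> 0"
  by (simp add: coord_def)

lemma coord_relation: assumes j: "j \<in> indices" shows "relation param j (coord \<theta>) = 0"
proof -
  have "prod (coord \<theta>) A = exp (sum (log_coord \<theta>) A)" if "A \<subseteq> edges k l" "finite A" for A
    using that by (subst exp_sum) (auto simp: coord_def intro!: prod.cong)
  moreover have "heads j \<subseteq> edges k l" "tails j \<subseteq> edges k l"
    by (auto simp: heads_def tails_def)
  ultimately show ?thesis
    using log_coord_relation[OF j] param_nonzero[OF j] finite_heads finite_tails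
    by (simp add: relation_def exp_add)
qed

lemma coord_G: "g \<in> G \<Longrightarrow> coord \<theta> g = cis (\<theta> g)"
  using G_subset by (auto simp: coord_def log_coord_G cis_conv_exp)

lemma coord_in_affine_space: "coord \<theta> \<in> affine_space (edges k l)"
  by (simp add: affine_space_def coord_def)

lemma cone_edges_G: "cone_edges k l \<sigma> = G"
  by (simp only: cone_edges_eq G_eq_G0)

lemma torus_point_eq: "torus_point k l q qt \<sigma> \<theta> = coord \<theta>"
  unfolding torus_point_def
proof (rule the_equality)
  show "coord \<theta> \<in> gamma_torus k l q qt \<sigma> \<and> (\<forall>e\<in>cone_edges k l \<sigma>. coord \<theta> e = cis (\<theta> e))"
    unfolding gamma_torus_def cone_edges_G
    by (simp add: M_variety_iff coord_in_affine_space coord_relation coord_G)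
next
  fix y assume *: "y \<in> gamma_torus k l q qt \<sigma> \<and> (\<forall>e\<in>cone_edges k l \<sigma>. y e = cis (\<theta> e))"
  then have y: "y \<in> affine_space (edges k l)" "\<And>j. j \<in> indices \<Longrightarrow> relation param j y = 0"
    "\<And>g. g \<in> G \<Longrightarrow> y g = cis (\<theta> g)"
    unfolding gamma_torus_def cone_edges_G by (simp_all add: M_variety_iff)
  have "y e = coord \<theta> e" if e: "e \<in> edges k l" for e
  proof (rule multiplicative_solution_unique[where Q = param, OF _ _ _ _ e])
    show "prod y (heads j) = param j * prod y (tails j)" if "j \<in> indices" for j
      using y(2)[OF that] by (simp add: relation_def)
    show "prod (coord \<theta>) (heads j) = param j * prod (coord \<theta>) (tails j)" if "j \<in> indices" for j
      using coord_relation[OF that] by (simp add: relation_def)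
    show "y g = coord \<theta> g" "y g \<noteq> 0" if "g \<in> G" for g
      using y(3)[OF that] by (simp_all add: coord_G that)
  qed
  moreover have "y e = coord \<theta> e" if "e \<notin> edges k l" for e
  proof -
    have "y e = 0" using y(1) that unfolding affine_space_def by blast
    then show ?thesis using that by (simp add: coord_def)
  qed
  ultimately show "y = coord \<theta>" by blast
qed

lemma torus_tangent_eq:
  assumes g: "g \<in> G"
  shows "torus_tangent k l q qt \<sigma> \<theta> g = (\<lambda>e. \<i> * of_real (exponent e g) * coord \<theta> e)"
proof
  fix e
  show "torus_tangent k l q qt \<sigma> \<theta> g e = \<i> * of_real (exponent e g) * coord \<theta> e"
  proof (cases "e \<in> edges k l")
    case True
    define r where "r = log_shift e + \<i> * of_real (\<Sum>h\<in>G - {g}. exponent e h * \<theta> h)"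
    have lc: "log_coord (\<theta>(g := t)) e = r + \<i> * of_real (exponent e g) * of_real t" for t
    proof -
      have "(\<Sum>h\<in>G. exponent e h * (\<theta>(g := t)) h) =
          exponent e g * t + (\<Sum>h\<in>G - {g}. exponent e h * (\<theta>(g := t)) h)"
        using g finite_G by (simp add: sum.remove)
      also have "(\<Sum>h\<in>G - {g}. exponent e h * (\<theta>(g := t)) h) = (\<Sum>h\<in>G - {g}. exponent e h * \<theta> h)"
        by (intro sum.cong) auto
      finally show ?thesis
        by (simp add: log_coord_def r_def algebra_simps del: of_real_sum fun_upd_apply)
    qed
    have "((\<lambda>z. exp (r + \<i> * of_real (exponent e g) * z)) has_field_derivative
        \<i> * of_real (exponent e g) * exp (r + \<i> * of_real (exponent e g) * of_real (\<theta> g)))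
        (at (of_real (\<theta> g)))"
      by (auto intro!: derivative_eq_intros)
    from has_vector_derivative_real_field[OF this]
    have "((\<lambda>t. exp (r + \<i> * of_real (exponent e g) * of_real t)) has_vector_derivative
        \<i> * of_real (exponent e g) * exp (r + \<i> * of_real (exponent e g) * of_real (\<theta> g))) (at (\<theta> g))" .
    moreover have "exp (r + \<i> * of_real (exponent e g) * of_real (\<theta> g)) = coord \<theta> e"
      using lc[of "\<theta> g"] True by (simp add: coord_def)
    ultimately show ?thesis
      using True unfolding torus_tangent_def torus_point_eq
      by (simp add: coord_def lc vector_derivative_at)
  qed (simp add: torus_tangent_def torus_point_eq coord_def)
qed

text \<open>In the angle coordinates the form is constant on the torus.\<close>

lemma omega_on_torus:
  "\<exists>\<epsilon>\<in>{1, -1}. \<forall>\<theta>. omega k l q qt es bs (torus_point k l q qt \<sigma> \<theta>)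
     (map (torus_tangent k l q qt \<sigma> \<theta>) gs) = \<epsilon> * \<i> ^ card G"
proof -
  define js where "js = map Roof [1..<l + 1] @ map Box bs"
  have js: "distinct js" "set js = indices"
    using bs by (auto simp: js_def distinct_map inj_on_def indices_def)
  have fs: "map (F_eq k l q) [1..<l + 1] @ map (G_eq qt) bs = map (relation param) js"
    using bs by (auto simp: js_def relation_Roof relation_Box)
  have gs': "set gs = G"
    using gs(2) G_eq_G0 by simp
  note res_ex = residue_on_torus[OF js gs(1) gs' es, where Q = param]
  obtain \<epsilon> :: complex where \<epsilon>: "\<epsilon> \<in> {1, -1}" and res: "\<forall>y t. (\<forall>e\<in>edges k l. y e \<noteq> 0) \<longrightarrow>
      (\<forall>j\<in>indices. relation param j y = 0) \<longrightarrow> (\<forall>g\<in>G. t g \<in> affine_space (edges k l)) \<longrightarrow>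
      (\<forall>g\<in>G. \<forall>j\<in>indices. (\<Sum>e\<in>heads j. t g e / y e) = (\<Sum>e\<in>tails j. t g e / y e)) \<longrightarrow>
      (\<forall>g\<in>G. \<forall>h\<in>G. t h g / y g = \<i> * of_bool (g = h)) \<longrightarrow>
      residue_form es (map (relation param) js) y (map t gs) = \<epsilon> * \<i> ^ card G"
    using res_ex by (elim bexE) assumption
  have "residue_form es (map (relation param) js) (coord \<theta>) (map (torus_tangent k l q qt \<sigma> \<theta>) gs) =
      \<epsilon> * \<i> ^ card G" for \<theta>
  proof (rule res[THEN spec, THEN spec, THEN mp, THEN mp, THEN mp, THEN mp, THEN mp])
    show "\<forall>e\<in>edges k l. coord \<theta> e \<noteq> 0" using coord_nonzero by blast
    show "\<forall>j\<in>indices. relation param j (coord \<theta>) = 0" using coord_relation by blast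
    show "\<forall>g\<in>G. torus_tangent k l q qt \<sigma> \<theta> g \<in> affine_space (edges k l)"
      by (simp add: torus_tangent_eq affine_space_def coord_def)
    have quot: "(\<Sum>e\<in>A. torus_tangent k l q qt \<sigma> \<theta> g e / coord \<theta> e) = \<i> * of_real (\<Sum>e\<in>A. exponent e g)"
      if "g \<in> G" "A \<subseteq> edges k l" for g A
    proof -
      have "(\<Sum>e\<in>A. torus_tangent k l q qt \<sigma> \<theta> g e / coord \<theta> e) = (\<Sum>e\<in>A. \<i> * of_real (exponent e g))"
        using that coord_nonzero by (intro sum.cong) (auto simp: torus_tangent_eq)
      then show ?thesis by (simp add: sum_distrib_left)
    qed
    show "\<forall>g\<in>G. \<forall>j\<in>indices. (\<Sum>e\<in>heads j. torus_tangent k l q qt \<sigma> \<theta> g e / coord \<theta> e) =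
        (\<Sum>e\<in>tails j. torus_tangent k l q qt \<sigma> \<theta> g e / coord \<theta> e)"
    proof (intro ballI)
      fix g j assume "g \<in> G" "j \<in> indices"
      moreover have "heads j \<subseteq> edges k l" "tails j \<subseteq> edges k l"
        by (auto simp: heads_def tails_def)
      ultimately show "(\<Sum>e\<in>heads j. torus_tangent k l q qt \<sigma> \<theta> g e / coord \<theta> e) =
          (\<Sum>e\<in>tails j. torus_tangent k l q qt \<sigma> \<theta> g e / coord \<theta> e)"
        using quot exponent(2)[of j g] by (simp del: of_real_sum)
    qed
    show "\<forall>g\<in>G. \<forall>h\<in>G. torus_tangent k l q qt \<sigma> \<theta> h g / coord \<theta> g = \<i> * of_bool (g = h)"
      using coord_nonzero G_subset by (auto simp: torus_tangent_eq exponent(1))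
  qed
  then show ?thesis
    using \<epsilon> unfolding omega_def fs torus_point_eq by blast
qed

lemma torus_integral_const:
  "set_lebesgue_integral (PiM G (\<lambda>_. lborel)) (PiE G (\<lambda>_. {0..2 * pi})) (\<lambda>\<theta>. c) = c * (2 * pi) ^ card G"
  for c :: complex
proof -
  have "set_lebesgue_integral (PiM G (\<lambda>_. lborel)) (PiE G (\<lambda>_. {0..2 * pi})) (\<lambda>\<theta>. c * 1) =
      c * set_lebesgue_integral (PiM G (\<lambda>_. lborel)) (PiE G (\<lambda>_. {0..2 * pi})) (\<lambda>\<theta>. 1)"
    by (rule set_integral_mult_right)
  then show ?thesis
    using torus_integral_character[OF finite_G, of "\<lambda>_. 0"] by simp
qed

text \<open>The sign in the orientation equals the constant sign of the form, so the two cancel.\<close>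

lemma period_integral_eq:
  "period_integral k l q qt \<sigma> es bs gs =
     1 / (2 * pi) ^ card G * set_lebesgue_integral (PiM G (\<lambda>_. lborel)) (PiE G (\<lambda>_. {0..2 * pi}))
       (\<lambda>\<theta>. exp (\<Sum>e\<in>edges k l. exp (log_coord \<theta> e)))"
proof -
  define d where "d = card G"
  obtain \<epsilon> where \<epsilon>: "\<epsilon> = 1 \<or> \<epsilon> = -1" and om: "\<And>\<theta>. omega k l q qt es bs (torus_point k l q qt \<sigma> \<theta>)
     (map (torus_tangent k l q qt \<sigma> \<theta>) gs) = \<epsilon> * \<i> ^ d"
    using omega_on_torus unfolding d_def by blast
  have \<epsilon>2: "\<epsilon> * \<epsilon> = 1" using \<epsilon> by auto
  have d: "card (squares k l) = d" by (simp add: d_def card_G)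
  have two_pi: "(2 * complex_of_real pi) ^ d \<noteq> 0" by simp
  have vol: "torus_integral k l q qt \<sigma> gs (omega k l q qt es bs) = \<epsilon> * \<i> ^ d * (2 * pi) ^ d"
    unfolding torus_integral_def cone_edges_G om by (simp add: torus_integral_const d_def)
  have norm_vol: "1 / (2 * pi * \<i>) ^ card (squares k l) *
      (\<epsilon>' * torus_integral k l q qt \<sigma> gs (omega k l q qt es bs)) = \<epsilon>' * \<epsilon>" for \<epsilon>'
    unfolding vol d using two_pi by (simp add: power_mult_distrib field_simps)
  have sign: "torus_sign k l q qt \<sigma> es bs gs = \<epsilon>"
    unfolding torus_sign_def norm_vol
    by (rule the_equality) (use \<epsilon> in auto)
  have sum_coord: "(\<Sum>e\<in>edges k l. coord \<theta> e) = (\<Sum>e\<in>edges k l. exp (log_coord \<theta> e))" for \<theta>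
    by (intro sum.cong) (auto simp: coord_def)
  let ?I = "set_lebesgue_integral (PiM G (\<lambda>_. lborel)) (PiE G (\<lambda>_. {0..2 * pi}))
       (\<lambda>\<theta>. exp (\<Sum>e\<in>edges k l. exp (log_coord \<theta> e)))"
  have "torus_integral k l q qt \<sigma> gs (\<lambda>y vs. exp (\<Sum>e\<in>edges k l. y e) * omega k l q qt es bs y vs) =
      ?I * (\<epsilon> * \<i> ^ d)"
    unfolding torus_integral_def cone_edges_G om unfolding torus_point_eq sum_coord
    by (rule set_integral_mult_left)
  then have "period_integral k l q qt \<sigma> es bs gs =
      1 / (2 * pi * \<i>) ^ d * (\<epsilon> * (?I * (\<epsilon> * \<i> ^ d)))"
    unfolding period_integral_def sign d by simp
  also have "\<dots> = (\<epsilon> * \<epsilon>) * (1 / (2 * pi) ^ d * ?I)"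
    using two_pi by (simp add: power_mult_distrib field_simps)
  finally show ?thesis
    by (simp add: \<epsilon>2 d_def)
qed

lemma period_series:
  "((\<lambda>m. A_coeff k l m * (\<Prod>i = 1..l. q i ^ m (Roof i)) * (\<Prod>b\<in>boxes k l. qt b ^ m (Box b)))
     has_sum period_integral k l q qt \<sigma> es bs gs) (multi_indices k l)"
proof -
  have mi: "multi_indices k l = {m. \<forall>j. j \<notin> indices \<longrightarrow> m j = 0}"
    by (simp add: multi_indices_def indices_def)
  have "((\<lambda>m. (\<Prod>j\<in>indices. param j ^ m j) * (\<Prod>e\<in>edges k l.
        of_bool (m (tail_index e) \<le> m (head_index e)) / fact (m (head_index e) - m (tail_index e))))
      has_sum period_integral k l q qt \<sigma> es bs gs) (multi_indices k l)"
    unfolding period_integral_eq mi log_coord_def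
    by (rule torus_mean_of_exp[where L = "\<lambda>j. Ln (param j)"])
      (use log_shift exponent param_nonzero in auto)
  moreover have "(\<Prod>j\<in>indices. param j ^ m j) * (\<Prod>e\<in>edges k l.
        of_bool (m (tail_index e) \<le> m (head_index e)) / fact (m (head_index e) - m (tail_index e))) =
      A_coeff k l m * (\<Prod>i = 1..l. q i ^ m (Roof i)) * (\<Prod>b\<in>boxes k l. qt b ^ m (Box b))"
    if "m \<in> multi_indices k l" for m
    unfolding prod_indices coefficient_eq[OF that] by (simp add: param_def)
  ultimately show ?thesis
    by (subst has_sum_cong[symmetric]) auto
qed

end

theorem theorem5p1p6:
  fixes k :: "nat \<Rightarrow> nat" and l :: nat
    and q :: "nat \<Rightarrow> complex" and qt :: "pt \<Rightarrow> complex"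
    and \<sigma> :: "(pt \<Rightarrow> real) set"
    and es gs :: "edge list" and bs :: "pt list"
  assumes "l \<ge> 1"
    and "\<And>i. i \<in> {1..l+1} \<Longrightarrow> k i \<ge> 1"
    and "\<And>i. i \<in> {1..l} \<Longrightarrow> q i \<noteq> 0"
    and "\<And>b. b \<in> boxes k l \<Longrightarrow> qt b \<noteq> 0"
    and "\<sigma> \<in> maximal_cones k l"
    and "distinct es" "set es = edges k l"
    and "distinct bs" "set bs = boxes k l"
    and "distinct gs" "set gs = cone_edges k l \<sigma>"
  shows "((\<lambda>m. A_coeff k l m * (\<Prod>i = 1..l. q i ^ m (Roof i)) *
             (\<Prod>b\<in>boxes k l. qt b ^ m (Box b)))
           has_sum period_integral k l q qt \<sigma> es bs gs) (multi_indices k l)"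
proof -
  obtain G where G: "\<sigma> = cone_of (delta k l ` G)" "G \<subseteq> edges k l"
    "\<And>i. i \<in> {1..l} \<Longrightarrow> card (roof k l i - G) = 1" "\<And>b. b \<in> boxes k l \<Longrightarrow> card (corner b - G) = 1"
    using assms(5) unfolding maximal_cones_def by blast
  interpret ladder_cone k l G
    by unfold_locales (use assms(2) G in auto)
  interpret ladder_period k l G q qt es gs bs
    by unfold_locales (use assms G cone_edges_eq in auto)
  show ?thesis
    unfolding G(1) by (rule period_series)
qed

end
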